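(* Let $1<p,q<+\infty$. The Bergman projection $P$ is bounded from the space $L^q(\mathbb{T},L^p[0,1])$ onto $RM(p,q)$.
   Context: $\mathbb{D}$ is the open unit disc of $\mathbb{C}$, $\mathbb{T}$ its boundary, and $\mathcal{H}(\mathbb{D})$ the space of holomorphic functions on $\mathbb{D}$. For $1<p,q<\infty$ and a measurable function $f$ on $\mathbb{D}$ set $$\rho_{p,q}(f)=\left(\frac{1}{2\pi}\int_0^{2\pi}\left(\int_0^1|f(re^{it})|^p\,dr\right)^{q/p}dt\right)^{1/q}.$$ $L^q(\mathbb{T},L^p[0,1])$ is the Banach space of (classes of a.e. equal) measurable functions $f:\mathbb{D}\to\mathbb{C}$ with $\rho_{p,q}(f)<+\infty$, with norm $\rho_{p,q}$, and $RM(p,q)=\{f\in\mathcal{H}(\mathbb{D}):\rho_{p,q}(f)<+\infty\}$, with the same norm. The Bergman projection is $$P(f)(z)=\int_{\mathbb{D}}\frac{f(w)}{(1-z\overline{w})^{2}}\,dA(w),\quad z\in\mathbb{D},$$ where $dA$ is normalized Lebesgue area measure on $\mathbb{D}$, i.e. $dA(\rho e^{i\varphi})=\frac1\pi\,\rho\,d\rho\,d\varphi$; it is well defined on $L^1(\mathbb{D})$. *)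

theory Defs
  imports "HOL-Complex_Analysis.Complex_Analysis"
begin

abbreviation disc :: "complex set" where
  "disc \<equiv> ball 0 1"

(* Real powers of extended nonnegative reals; only used with exponents a > 0. *)
definition epowr :: "ennreal \<Rightarrow> real \<Rightarrow> ennreal" where
  "epowr x a = (if x = \<infinity> then \<infinity> else ennreal (enn2real x powr a))"

(* The value \<infinity> is allowed, so that "rho p q f < \<infinity>" is the genuine finiteness
   condition.  The radial integral runs over [0,1) since f is a function on the open disc:
   values of f outside the disc never matter. *)
definition rho :: "real \<Rightarrow> real \<Rightarrow> (complex \<Rightarrow> complex) \<Rightarrow> ennreal" where
  "rho p q f =
     epowr (ennreal (1 / (2 * pi)) *
       (\<integral>\<^sup>+ t. epowr (\<integral>\<^sup>+ r. ennreal (cmod (f (of_real r * cis t)) powr p) \<partial>lebesgue_on {0..<1})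
                  (q / p) \<partial>lebesgue_on {0..2 * pi}))
     (1 / q)"

(* Functions rather than classes modulo null sets: statements about the space of classes
   are made for all representatives. *)
definition LqLp :: "real \<Rightarrow> real \<Rightarrow> (complex \<Rightarrow> complex) set" where
  "LqLp p q = {f. f \<in> borel_measurable (lebesgue_on disc) \<and> rho p q f < \<infinity>}"

definition RM :: "real \<Rightarrow> real \<Rightarrow> (complex \<Rightarrow> complex) set" where
  "RM p q = {f. f holomorphic_on disc \<and> rho p q f < \<infinity>}"

definition dA :: "complex measure" where
  "dA = density (lebesgue_on disc) (\<lambda>_. ennreal (1 / pi))"

definition bergman_kernel_integrand :: "(complex \<Rightarrow> complex) \<Rightarrow> complex \<Rightarrow> complex \<Rightarrow> complex" where
  "bergman_kernel_integrand f z w = f w / (1 - z * cnj w)\<^sup>2"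

definition bergman :: "(complex \<Rightarrow> complex) \<Rightarrow> complex \<Rightarrow> complex" where
  "bergman f z = (\<integral>w. bergman_kernel_integrand f z w \<partial>dA)"

(* bergman only depends on the class of f modulo null sets. *)
lemma bergman_cong_AE:
  assumes f: "f \<in> borel_measurable (lebesgue_on disc)"
    and g: "g \<in> borel_measurable (lebesgue_on disc)"
    and eq: "AE w in dA. f w = g w"
  shows "bergman f z = bergman g z"
proof -
  have sets: "sets dA = sets (lebesgue_on disc)"
    by (simp add: dA_def)
  have mb: "h \<in> borel_measurable dA" if "h \<in> borel_measurable (lebesgue_on disc)"
    for h :: "complex \<Rightarrow> complex"
    using that measurable_cong_sets[OF sets refl] by blast
  have "(\<lambda>w. (1 - z * cnj w)\<^sup>2) \<in> borel_measurable borel"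
    by (intro borel_measurable_continuous_onI continuous_intros)
  then have "(\<lambda>w. (1 - z * cnj w)\<^sup>2) \<in> borel_measurable lebesgue"
    by (simp add: measurable_completion)
  then have k: "(\<lambda>w. (1 - z * cnj w)\<^sup>2) \<in> borel_measurable dA"
    by (intro mb measurable_restrict_space1)
  show ?thesis
    unfolding bergman_def bergman_kernel_integrand_def
  proof (rule integral_cong_AE)
    show "(\<lambda>w. f w / (1 - z * cnj w)\<^sup>2) \<in> borel_measurable dA"
      by (rule borel_measurable_divide[OF mb[OF f] k])
    show "(\<lambda>w. g w / (1 - z * cnj w)\<^sup>2) \<in> borel_measurable dA"
      by (rule borel_measurable_divide[OF mb[OF g] k])
    show "AE w in dA. f w / (1 - z * cnj w)\<^sup>2 = g w / (1 - z * cnj w)\<^sup>2"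
      using eq by eventually_elim simp
  qed
qed

end

theory Submission
  imports Defs "HOL-Real_Asymp.Real_Asymp"
begin

text \<open>Write \<open>x = 1 - \<bar>z\<bar>\<close>, \<open>y = 1 - \<bar>w\<bar>\<close>. The Bergman kernel is dominated, up to \<open>2\<pi>\<close>-translates of the angles
  \<open>t\<close> of \<open>z\<close> and \<open>s\<close> of \<open>w\<close>, by the positive symmetric kernel \<open>K = (x + y + \<bar>t - s\<bar>)\<^sup>-\<^sup>2\<close>, so it suffices to bound
  the integral operator of \<open>K\<close> in the mixed norm, equivalently the bilinear form \<open>B(F, G)\<close> with
  kernel \<open>K\<close> by the norms of \<open>F\<close> in \<open>L\<^sup>q(L\<^sup>p)\<close> and of \<open>G\<close> in the dual space. By symmetry of \<open>K\<close> one may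
  assume \<open>p \<le> q\<close>. A Schur test with radial power weights and an extra weight \<open>u(t)\<close> then works, because
  integrating \<open>K\<close> against \<open>u\<close> costs the Hardy-Littlewood maximal function of \<open>u\<close>, which is bounded on
  \<open>L\<^sup>r\<close> for \<open>r\<close> conjugate to \<open>q / p\<close>. Surjectivity holds because \<open>P g = g\<close> for integrable holomorphic \<open>g\<close>, as
  one sees from the Taylor coefficients in polar coordinates.\<close>

subsection \<open>Extended real powers and Hoelder's inequality\<close>

text \<open>The bound survives taking absolute values in the kernel: integrating \<open>kern\<close>
  over the angle leaves a multiple of 1/(x + y), the Hilbert kernel on the half-line, for which
  powers strictly between -1 and 0 serve as Schur weights. That alone settles p = q. For p < q the
  radial integrals of F^p are controlled only in the outer exponent q/p, so they must be paired with
  a function of the conjugate exponent. This function is u, split off from the fibre norms of the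
  dual function G; the angular part of the kernel averages it over intervals around the angle of w,
  whence the maximal function. Such a pairing makes sense only for q/p >= 1, which explains the
  reduction to p <= q. Depths run over all positive reals and angles over the whole line, so that
  the kernel is homogeneous and translation invariant; periodicity is paid for by three translates.
  All estimates take extended nonnegative values, so finiteness is an outcome and seldom a side
  condition.\<close>

lemma epowr_0 [simp]: "epowr 0 a = 0"
  by (simp add: epowr_def)

lemma epowr_top [simp]: "epowr \<infinity> a = \<infinity>" "epowr top a = top"
  by (simp_all add: epowr_def)

lemma epowr_1 [simp]: "epowr 1 a = 1"
  by (simp add: epowr_def)

lemma epowr_one [simp]: "epowr x 1 = x"
  by (simp add: epowr_def less_top)

lemma epowr_ennreal: "x \<ge> 0 \<Longrightarrow> epowr (ennreal x) a = ennreal (x powr a)"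
  by (simp add: epowr_def)

lemma epowr_eq_0_iff [simp]: "epowr x a = 0 \<longleftrightarrow> x = 0"
  by (cases x) (auto simp: epowr_ennreal)

lemma epowr_eq_top_iff [simp]: "epowr x a = top \<longleftrightarrow> x = top" "epowr x a = \<infinity> \<longleftrightarrow> x = \<infinity>"
  by (auto simp: epowr_def)

lemma epowr_less_top_iff [simp]: "epowr x a < top \<longleftrightarrow> x < top" "epowr x a < \<infinity> \<longleftrightarrow> x < \<infinity>"
  by (simp_all add: less_top[symmetric])

lemma epowr_mono: "x \<le> y \<Longrightarrow> 0 \<le> a \<Longrightarrow> epowr x a \<le> epowr y a"
  by (cases x; cases y) (auto simp: epowr_ennreal top_unique intro!: ennreal_leI powr_mono2)

lemma epowr_mult: "epowr (x * y) a = epowr x a * epowr y a"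
proof (cases "x = 0 \<or> y = 0")
  case True
  then show ?thesis by auto
next
  case False
  then show ?thesis
    by (cases x; cases y)
      (auto simp: epowr_ennreal ennreal_mult[symmetric] powr_mult ennreal_mult_top ennreal_top_mult)
qed

lemma epowr_epowr: "epowr (epowr x a) b = epowr x (a * b)"
  by (cases x) (auto simp: epowr_ennreal powr_powr)

lemma epowr_add: "epowr x (a + b) = epowr x a * epowr x b"
  by (cases x) (auto simp: epowr_ennreal powr_add ennreal_mult[symmetric] ennreal_mult_top)

lemma epowr_inverse_cancel [simp]: "a \<noteq> 0 \<Longrightarrow> epowr (epowr x a) (1 / a) = x"
    "a \<noteq> 0 \<Longrightarrow> epowr (epowr x (1 / a)) a = x"
  by (simp_all add: epowr_epowr)

lemma epowr_measurable [measurable]: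
  assumes [measurable]: "f \<in> borel_measurable M"
  shows "(\<lambda>x. epowr (f x) a) \<in> borel_measurable M"
  unfolding epowr_def by measurable

text \<open>Bounding x + y by twice the maximum treats a < 1 and a >= 1 alike. Both can occur, since
  a will be p as well as q/p.\<close>

lemma epowr_add_le:
  assumes "0 < a"
  shows "epowr (x + y) a \<le> ennreal (2 powr a) * (epowr x a + epowr y a)"
proof -
  have "epowr (x + y) a \<le> epowr (2 * max x y) a"
    using assms by (intro epowr_mono) (auto simp: mult_2 intro: add_mono)
  also have "\<dots> = ennreal (2 powr a) * epowr (max x y) a"
    using epowr_ennreal[of 2 a] by (simp add: epowr_mult)
  also have "\<dots> \<le> ennreal (2 powr a) * (epowr x a + epowr y a)"
    by (intro mult_left_mono) (auto simp: max_def add_increasing2 add_increasing)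
  finally show ?thesis .
qed

lemma conjugate_exponent:
  fixes p :: real
  assumes "1 < p" "1 / p + 1 / p' = 1"
  shows "1 < p'"
proof -
  have "1 / p' = 1 - 1 / p" using assms by simp
  moreover have "0 < 1 - 1 / p" "1 - 1 / p < 1" using assms by auto
  ultimately have "0 < 1 / p'" "1 / p' < 1" by linarith+
  then show ?thesis by (simp add: divide_less_eq split: if_splits)
qed

lemma epowr_young:
  assumes "1 < p" and q: "1 / p + 1 / q = 1"
  shows "x * y \<le> ennreal (1 / p) * epowr x p + ennreal (1 / q) * epowr y q"
proof -
  have "q > 1" using conjugate_exponent[OF assms] .
  then have "q > 0" by simp
  show ?thesis
  proof (cases "x = top \<or> y = top")
    case True
    then show ?thesis
      using assms \<open>q > 0\<close> by (auto simp: ennreal_mult_top)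
  next
    case False
    then obtain a b where "x = ennreal a" "y = ennreal b" "a \<ge> 0" "b \<ge> 0"
      by (cases x; cases y) auto
    then show ?thesis
      using Youngs_inequality[of p q a b] assms \<open>q > 0\<close> \<open>q > 1\<close>
      by (simp add: epowr_ennreal ennreal_mult[symmetric] ennreal_plus[symmetric] del: ennreal_plus)
  qed
qed

text \<open>Young's inequality, integrated after dividing both factors by their norms. Among
  extended values this division is possible only if both norms are positive and finite, hence the
  three cases.\<close>

lemma nn_integral_holder:
  assumes p: "1 < p" and q: "1 / p + 1 / q = 1"
    and [measurable]: "f \<in> borel_measurable M" "g \<in> borel_measurable M"
  shows "(\<integral>\<^sup>+ x. f x * g x \<partial>M) \<le>
    epowr (\<integral>\<^sup>+ x. epowr (f x) p \<partial>M) (1 / p) * epowr (\<integral>\<^sup>+ x. epowr (g x) q \<partial>M) (1 / q)"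
    (is "?L \<le> epowr ?A _ * epowr ?B _")
proof -
  have q0: "q > 0" using conjugate_exponent[OF p q] by simp
  consider "?A = 0 \<or> ?B = 0" | "?A \<noteq> 0" "?B \<noteq> 0" "?A = top \<or> ?B = top"
    | "?A \<noteq> 0" "?B \<noteq> 0" "?A < top" "?B < top"
    unfolding less_top[symmetric] by blast
  then show ?thesis
  proof cases
    case 1
    \<comment> \<open>As 0 * top = 0, the right side is 0 here even if the other norm is infinite,
      so the left side has to vanish.\<close>
    then have "AE x in M. f x * g x = 0"
      by (auto simp: nn_integral_0_iff_AE elim!: eventually_mono)
    then have "?L = 0" by (simp add: nn_integral_0_iff_AE)
    then show ?thesis by simp
  next
    case 2
    then show ?thesis by (auto simp: ennreal_mult_top ennreal_top_mult)
  next
    case 3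
    define a where "a = epowr ?A (1 / p)"
    define b where "b = epowr ?B (1 / q)"
    have ab: "a \<noteq> 0" "b \<noteq> 0" "a < top" "b < top"
      using 3 by (auto simp: a_def b_def less_top[symmetric])
    have A: "?A = epowr a p" and B: "?B = epowr b q"
      using p q0 by (simp_all add: a_def b_def)
    have inv: "epowr (inverse c) s * epowr c s = 1" if "c \<noteq> 0" "c < top" for c s
      using that epowr_mult[of "inverse c" c s] by (simp add: ennreal_inverse_mult mult.commute ennreal_divide_self divide_ennreal_def[symmetric])
    have "(\<integral>\<^sup>+ x. (inverse a * f x) * (inverse b * g x) \<partial>M) \<le>
      (\<integral>\<^sup>+ x. ennreal (1 / p) * epowr (inverse a * f x) p + ennreal (1 / q) * epowr (inverse b * g x) q \<partial>M)"
      by (intro nn_integral_mono epowr_young p q)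
    also have "\<dots> = ennreal (1 / p) * (epowr (inverse a) p * ?A) + ennreal (1 / q) * (epowr (inverse b) q * ?B)"
      by (simp add: nn_integral_add nn_integral_cmult epowr_mult)
    also have "\<dots> = ennreal (1 / p + 1 / q)"
      using p q0 by (simp add: A B inv ab)
    finally have "(\<integral>\<^sup>+ x. (inverse a * inverse b) * (f x * g x) \<partial>M) \<le> 1"
      by (simp add: q mult_ac)
    then have *: "(inverse a * inverse b) * ?L \<le> 1"
      by (simp add: nn_integral_cmult)
    have "?L = (a * inverse a) * (b * inverse b) * ?L"
      using ab by (simp add: divide_ennreal_def[symmetric] ennreal_divide_self)
    also have "\<dots> = (a * b) * ((inverse a * inverse b) * ?L)" by (simp add: mult_ac)
    also have "\<dots> \<le> (a * b) * 1" by (intro mult_left_mono *) auto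
    finally show ?thesis by (simp add: a_def b_def)
  qed
qed

subsection \<open>The Hardy-Littlewood maximal function on the line\<close>

lemma nn_integral_lborel_swap:
  fixes f :: "real \<Rightarrow> real \<Rightarrow> ennreal"
  assumes "case_prod f \<in> borel_measurable (borel \<Otimes>\<^sub>M borel)"
  shows "(\<integral>\<^sup>+ x. \<integral>\<^sup>+ y. f x y \<partial>lborel \<partial>lborel) = (\<integral>\<^sup>+ y. \<integral>\<^sup>+ x. f x y \<partial>lborel \<partial>lborel)"
proof -
  have "case_prod f \<in> borel_measurable (lborel \<Otimes>\<^sub>M lborel)"
    using assms by (simp cong: measurable_cong_sets)
  from lborel_pair.Fubini'[OF this] show ?thesis by simp
qed

text \<open>Stated for a single value \<open>m\<close>, possibly infinite; distribution functions
  arise from it by Tonelli.\<close>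

lemma layer_cake:
  assumes s: "0 < s"
  shows "(\<integral>\<^sup>+ l. (if 0 < l \<and> ennreal l < m then ennreal (s * l powr (s - 1)) else 0) \<partial>lborel) = epowr m s"
proof -
  have fin: "(\<integral>\<^sup>+ l. ennreal (s * l powr (s - 1)) * indicator {0..c} l \<partial>lborel) = ennreal (c powr s)"
    if "c \<ge> 0" for c
  proof (rule nn_integral_has_integral_lebesgue')
    show "((\<lambda>l. s * l powr (s - 1)) has_integral c powr s) {0..c}"
      using has_integral_mult_right[OF has_integral_powr_from_0[of "s - 1" c], of s] s that by simp
  qed (use s in auto)
  show ?thesis
  proof (cases m)
    case (real c)
    \<comment> \<open>The strict inequalities and the closed interval in \<open>fin\<close> can
      differ only at these two points.\<close>
    have "AE l in lborel. l \<noteq> 0 \<and> l \<noteq> c"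
      by (intro AE_conjI AE_lborel_singleton)
    then have "AE l in lborel. (if 0 < l \<and> ennreal l < m then ennreal (s * l powr (s - 1)) else 0) =
        ennreal (s * l powr (s - 1)) * indicator {0..c} l"
      by eventually_elim (use real in \<open>auto simp: indicator_def ennreal_less_iff\<close>)
    then show ?thesis
      using fin[of c] real by (simp add: nn_integral_cong_AE epowr_ennreal)
  next
    case top
    \<comment> \<open>For \<open>m = top\<close> the integral dominates each integral over [0, n],
      and those are unbounded.\<close>
    have "ennreal (real n powr s) \<le> (\<integral>\<^sup>+ l. (if 0 < l \<and> ennreal l < m then ennreal (s * l powr (s - 1)) else 0) \<partial>lborel)" for n
      unfolding fin[of "real n", OF of_nat_0_le_iff, symmetric]
      by (rule nn_integral_mono) (auto simp: indicator_def top)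
    then have "(SUP n. ennreal (real n powr s)) \<le> (\<integral>\<^sup>+ l. (if 0 < l \<and> ennreal l < m then ennreal (s * l powr (s - 1)) else 0) \<partial>lborel)"
      by (intro SUP_least)
    moreover have "(SUP n. ennreal (real n powr s)) = top"
    proof (rule LIMSEQ_unique[OF LIMSEQ_SUP])
      show "incseq (\<lambda>n. ennreal (real n powr s))"
        using s by (auto simp: incseq_def intro!: ennreal_leI powr_mono2)
      have "filterlim (\<lambda>n. real n powr s) at_top sequentially"
        using s by real_asymp
      then show "(\<lambda>n. ennreal (real n powr s)) \<longlonglongrightarrow> top"
        by (rule ennreal_tendsto_top_eq_at_top[THEN iffD2])
    qed
    ultimately show ?thesis
      by (simp add: top top_unique)
  qed
qed

definition box_integral :: "(real \<Rightarrow> ennreal) \<Rightarrow> real \<Rightarrow> real \<Rightarrow> ennreal" where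
  "box_integral u r t = (\<integral>\<^sup>+ s. (if \<bar>s - t\<bar> < r then u s else 0) \<partial>lborel)"

text \<open>The centred Hardy-Littlewood maximal function, normalised by the radius and not by the
  length 2r, hence twice the usual one. Rational radii make the supremum countable and therefore
  measurable.\<close>

definition maxfun :: "(real \<Rightarrow> ennreal) \<Rightarrow> real \<Rightarrow> ennreal" where
  "maxfun u t = (SUP r\<in>\<rat> \<inter> {0<..}. ennreal (1 / r) * box_integral u r t)"

lemma box_integral_measurable [measurable]:
  assumes [measurable]: "u \<in> borel_measurable borel"
  shows "box_integral u r \<in> borel_measurable borel"
  unfolding box_integral_def by measurable

lemma maxfun_measurable [measurable]:
  assumes [measurable]: "u \<in> borel_measurable borel"
  shows "maxfun u \<in> borel_measurable borel"
  unfolding maxfun_def[abs_def]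
  by (intro borel_measurable_SUP) (auto intro: countable_rat countable_subset[of _ "\<rat>"])

lemma emeasure_box: "r \<ge> 0 \<Longrightarrow> emeasure lborel {s::real. \<bar>s - t\<bar> < r} = ennreal (2 * r)"
proof -
  have "{s::real. \<bar>s - t\<bar> < r} = {t - r<..<t + r}" by (auto simp: abs_less_iff)
  then show "r \<ge> 0 \<Longrightarrow> ?thesis" by simp
qed

lemma box_integral_const:
  assumes "r \<ge> 0"
  shows "box_integral (\<lambda>_. c) r t = c * ennreal (2 * r)"
proof -
  have "box_integral (\<lambda>_. c) r t = (\<integral>\<^sup>+ s. c * indicator {s. \<bar>s - t\<bar> < r} s \<partial>lborel)"
    unfolding box_integral_def by (intro nn_integral_cong) (auto simp: indicator_def)
  also have "\<dots> = c * ennreal (2 * r)"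
    by (subst nn_integral_cmult_indicator) (auto simp: emeasure_box assms)
  finally show ?thesis .
qed

text \<open>A rational radius between r and 2r enlarges the integral and costs the factor 2.\<close>

lemma box_integral_le_maxfun:
  assumes "0 < r"
  shows "box_integral u r t \<le> ennreal (2 * r) * maxfun u t"
proof -
  obtain r' where r': "r < r'" "r' < 2 * r" "r' \<in> \<rat>"
    using Rats_dense_in_real[of r "2 * r"] assms by auto
  have "box_integral u r t \<le> box_integral u r' t"
    unfolding box_integral_def using r' by (intro nn_integral_mono) auto
  also have "\<dots> = ennreal r' * (ennreal (1 / r') * box_integral u r' t)"
    using r' assms by (simp add: mult.assoc[symmetric] ennreal_mult[symmetric])
  also have "\<dots> \<le> ennreal (2 * r) * maxfun u t"
    unfolding maxfun_def using r' assms by (intro mult_mono SUP_upper) (auto simp: ennreal_leI)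
  finally show ?thesis .
qed

text \<open>Each point of the level set is the centre of an interval whose mass exceeds l times its
  radius r. Vitali's lemma selects disjoint ones whose fivefold dilations cover the level set; a
  dilated interval has length 10 r, which is less than 10/l times the mass of the undilated
  one.\<close>

lemma maxfun_weak_type:
  assumes [measurable]: "u \<in> borel_measurable borel" and l: "0 < l"
  shows "emeasure lborel {t. ennreal l < maxfun u t} \<le> ennreal (10 / l) * (\<integral>\<^sup>+ s. u s \<partial>lborel)"
proof (cases "(\<integral>\<^sup>+ s. u s \<partial>lborel) = top")
  case True
  then show ?thesis using l by (simp add: ennreal_mult_top)
next
  case False
  then obtain i where i: "(\<integral>\<^sup>+ s. u s \<partial>lborel) = ennreal i" "i \<ge> 0"
    by (cases "(\<integral>\<^sup>+ s. u s \<partial>lborel)") auto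
  \<comment> \<open>Pairs of centre and radius. As the total mass is i, the radii are at most i/l,
    and Vitali's lemma requires such a bound; this is why infinite mass was treated apart.\<close>
  define K where "K = {(t, r). 0 < r \<and> ennreal (l * r) < box_integral u r t}"
  define S where "S = {t. ennreal l < maxfun u t}"
  have [measurable]: "S \<in> sets borel" unfolding S_def by measurable
  have K: "0 < snd k \<and> snd k \<le> i / l" if "k \<in> K" for k
  proof -
    have "ennreal (l * snd k) < box_integral u (snd k) (fst k)" "0 < snd k"
      using that by (auto simp: K_def)
    note this(1)
    also have "box_integral u (snd k) (fst k) \<le> ennreal i"
      unfolding box_integral_def i(1)[symmetric] by (intro nn_integral_mono) auto
    finally show ?thesis using l i(2) \<open>0 < snd k\<close> by (simp add: ennreal_less_iff field_simps)
  qed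
  have "S \<subseteq> (\<Union>k\<in>K. ball (fst k) (snd k))"
  proof
    fix t assume "t \<in> S"
    then obtain r where r: "0 < r" "ennreal l < ennreal (1 / r) * box_integral u r t"
      by (auto simp: S_def maxfun_def less_SUP_iff)
    have "ennreal (l * r) = ennreal r * ennreal l"
      using r l by (simp add: ennreal_mult[symmetric] mult.commute)
    also have "\<dots> < ennreal r * (ennreal (1 / r) * box_integral u r t)"
      using r by (intro ennreal_mult_strict_left_mono) auto
    also have "\<dots> = box_integral u r t"
      using r by (simp add: mult.assoc[symmetric] ennreal_mult[symmetric])
    finally have "(t, r) \<in> K" using r by (simp add: K_def)
    then show "t \<in> (\<Union>k\<in>K. ball (fst k) (snd k))" using r by force
  qed
  then obtain C where C: "countable C" "C \<subseteq> K"
    and disj: "pairwise (\<lambda>i j. disjnt (ball (fst i) (snd i)) (ball (fst j) (snd j))) C"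
    and cov: "S \<subseteq> (\<Union>k\<in>C. ball (fst k) (5 * snd k))"
    using K by (rule Vitali_covering_lemma_balls)
  have pos: "0 < snd k" if "k \<in> C" for k using K C that by blast
  have "emeasure lborel S = (\<integral>\<^sup>+ s. indicator S s \<partial>lborel)" by simp
  also have "\<dots> \<le> (\<integral>\<^sup>+ s. (\<integral>\<^sup>+ k. indicator (ball (fst k) (5 * snd k)) s \<partial>count_space C) \<partial>lborel)"
  proof (intro nn_integral_mono)
    fix s :: real
    show "indicator S s \<le> (\<integral>\<^sup>+ k. indicator (ball (fst k) (5 * snd k)) s \<partial>count_space C)"
    proof (cases "s \<in> S")
      case True
      then obtain k where k: "k \<in> C" "s \<in> ball (fst k) (5 * snd k)" using cov by auto
      have "indicator S s = indicator (ball (fst k) (5 * snd k)) s" using k True by simp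
      also have "\<dots> \<le> (\<integral>\<^sup>+ k. indicator (ball (fst k) (5 * snd k)) s \<partial>count_space C)"
        using k(1) by (rule nn_integral_ge_point)
      finally show ?thesis .
    qed simp
  qed
  also have "\<dots> = (\<integral>\<^sup>+ k. (\<integral>\<^sup>+ s. indicator (ball (fst k) (5 * snd k)) s \<partial>lborel) \<partial>count_space C)"
    by (rule nn_integral_count_space_nn_integral) (use C in \<open>auto intro!: borel_measurable_indicator\<close>)
  also have "\<dots> \<le> (\<integral>\<^sup>+ k. ennreal (10 / l) * (\<integral>\<^sup>+ s. u s * indicator (ball (fst k) (snd k)) s \<partial>lborel) \<partial>count_space C)"
  proof (intro nn_integral_mono)
    fix k assume "k \<in> space (count_space C)"
    then have k: "k \<in> C" by simp
    have ball: "ball (fst k) r = {s. \<bar>s - fst k\<bar> < r}" for r by (auto simp: dist_real_def)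
    have eq: "(\<integral>\<^sup>+ s. u s * indicator (ball (fst k) (snd k)) s \<partial>lborel) = box_integral u (snd k) (fst k)"
      unfolding box_integral_def ball by (intro nn_integral_cong) (auto simp: indicator_def)
    have "(\<integral>\<^sup>+ s. indicator (ball (fst k) (5 * snd k)) s \<partial>lborel) = ennreal (10 * snd k)"
      using pos[OF k] by (simp add: ball emeasure_box del: nn_integral_indicator)
        (simp add: emeasure_box nn_integral_indicator)
    also have "\<dots> = ennreal (10 / l) * ennreal (l * snd k)"
      using l pos[OF k] by (simp add: ennreal_mult[symmetric])
    also have "\<dots> \<le> ennreal (10 / l) * box_integral u (snd k) (fst k)"
      using C(2) k by (intro mult_left_mono) (auto simp: K_def)
    finally show "(\<integral>\<^sup>+ s. indicator (ball (fst k) (5 * snd k)) s \<partial>lborel) \<le>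
      ennreal (10 / l) * (\<integral>\<^sup>+ s. u s * indicator (ball (fst k) (snd k)) s \<partial>lborel)"
      unfolding eq .
  qed
  also have "\<dots> = ennreal (10 / l) * (\<integral>\<^sup>+ k. emeasure (density lborel u) (ball (fst k) (snd k)) \<partial>count_space C)"
    by (simp add: nn_integral_cmult emeasure_density)
  \<comment> \<open>Disjointness of the undilated intervals turns the sum of their masses into the
    mass of a union.\<close>
  also have "(\<integral>\<^sup>+ k. emeasure (density lborel u) (ball (fst k) (snd k)) \<partial>count_space C) =
      emeasure (density lborel u) (\<Union>k\<in>C. ball (fst k) (snd k))"
    by (rule emeasure_UN_countable[symmetric])
      (use C disj in \<open>auto simp: disjoint_family_on_def pairwise_def disjnt_def\<close>)
  also have "\<dots> \<le> (\<integral>\<^sup>+ s. u s \<partial>lborel)"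
    using emeasure_space[of "density lborel u" "\<Union>k\<in>C. ball (fst k) (snd k)"]
    by (simp add: emeasure_density)
  finally show ?thesis by (simp add: S_def mult_left_mono)
qed

text \<open>Values of u up to l/4 contribute at most l/2, because an interval of radius r has length
  2r and averages are divided by r.\<close>

lemma maxfun_split:
  assumes [measurable]: "u \<in> borel_measurable borel" and l: "0 < l"
  shows "maxfun u t \<le> maxfun (\<lambda>s. if ennreal (l / 4) < u s then u s else 0) t + ennreal (l / 2)"
  unfolding maxfun_def
proof (rule SUP_least)
  fix r :: real assume r: "r \<in> \<rat> \<inter> {0<..}"
  let ?v = "\<lambda>s. if ennreal (l / 4) < u s then u s else 0"
  have "box_integral u r t \<le> (\<integral>\<^sup>+ s. (if \<bar>s - t\<bar> < r then ?v s else 0) + (if \<bar>s - t\<bar> < r then ennreal (l / 4) else 0) \<partial>lborel)"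
    unfolding box_integral_def by (intro nn_integral_mono) auto
  also have "\<dots> = box_integral ?v r t + box_integral (\<lambda>_. ennreal (l / 4)) r t"
    unfolding box_integral_def by (rule nn_integral_add) auto
  also have "\<dots> = box_integral ?v r t + ennreal (l / 2 * r)"
    using r l by (simp add: box_integral_const ennreal_mult[symmetric] mult.commute)
  finally have "ennreal (1 / r) * box_integral u r t \<le> ennreal (1 / r) * (box_integral ?v r t + ennreal (l / 2 * r))"
    by (intro mult_left_mono) auto
  also have "\<dots> = ennreal (1 / r) * box_integral ?v r t + ennreal (l / 2)"
    using r l by (simp add: distrib_left ennreal_mult[symmetric])
  also have "\<dots> \<le> (SUP r\<in>\<rat> \<inter> {0<..}. ennreal (1 / r) * box_integral ?v r t) + ennreal (l / 2)"
    using r by (intro add_right_mono SUP_upper)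
  finally show "ennreal (1 / r) * box_integral u r t \<le> \<dots>" .
qed

text \<open>Marcinkiewicz interpolation between the weak type bound and the trivial bound for
  bounded functions. At level l only the part of u above l/4 matters; the weak type bound at level
  l/2 gives 20/l. Integrating l^(r-2) over 0 < l < 4 u(s) yields 4^(r-1)/(r-1), finite since r >
  1.\<close>

lemma maxfun_strong_type:
  assumes [measurable]: "u \<in> borel_measurable borel" and r: "1 < r"
  shows "(\<integral>\<^sup>+ t. epowr (maxfun u t) r \<partial>lborel) \<le>
    ennreal (20 * r / (r - 1) * 4 powr (r - 1)) * (\<integral>\<^sup>+ t. epowr (u t) r \<partial>lborel)"
proof -
  have weak: "emeasure lborel {t. ennreal l < maxfun u t} \<le>
      ennreal (20 / l) * (\<integral>\<^sup>+ s. (if ennreal (l / 4) < u s then u s else 0) \<partial>lborel)" if "0 < l" for l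
  proof -
    let ?v = "\<lambda>s. if ennreal (l / 4) < u s then u s else 0"
    have "{t. ennreal l < maxfun u t} \<subseteq> {t. ennreal (l / 2) < maxfun ?v t}"
    proof safe
      fix t assume "ennreal l < maxfun u t"
      also have "maxfun u t \<le> maxfun ?v t + ennreal (l / 2)"
        using that by (intro maxfun_split) auto
      finally have "ennreal (l / 2) + ennreal (l / 2) < maxfun ?v t + ennreal (l / 2)"
        using that by (simp add: ennreal_plus[symmetric] del: ennreal_plus)
      then show "ennreal (l / 2) < maxfun ?v t"
        by (meson add_right_mono not_le)
    qed
    then have "emeasure lborel {t. ennreal l < maxfun u t} \<le> emeasure lborel {t. ennreal (l / 2) < maxfun ?v t}"
      by (intro emeasure_mono) auto
    also have "\<dots> \<le> ennreal (10 / (l / 2)) * (\<integral>\<^sup>+ s. ?v s \<partial>lborel)"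
      using that by (intro maxfun_weak_type) auto
    finally show ?thesis by simp
  qed
  have "(\<integral>\<^sup>+ t. epowr (maxfun u t) r \<partial>lborel) =
    (\<integral>\<^sup>+ t. (\<integral>\<^sup>+ l. (if 0 < l \<and> ennreal l < maxfun u t then ennreal (r * l powr (r - 1)) else 0) \<partial>lborel) \<partial>lborel)"
    using r by (simp add: layer_cake)
  also have "\<dots> = (\<integral>\<^sup>+ l. (\<integral>\<^sup>+ t. (if 0 < l \<and> ennreal l < maxfun u t then ennreal (r * l powr (r - 1)) else 0) \<partial>lborel) \<partial>lborel)"
    by (rule nn_integral_lborel_swap) measurable
  also have "\<dots> \<le> (\<integral>\<^sup>+ l. (\<integral>\<^sup>+ s. (if 0 < l \<and> ennreal (l / 4) < u s then ennreal (20 * r * l powr (r - 2)) * u s else 0) \<partial>lborel) \<partial>lborel)"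
  proof (rule nn_integral_mono)
    fix l :: real
    show "(\<integral>\<^sup>+ t. (if 0 < l \<and> ennreal l < maxfun u t then ennreal (r * l powr (r - 1)) else 0) \<partial>lborel) \<le>
      (\<integral>\<^sup>+ s. (if 0 < l \<and> ennreal (l / 4) < u s then ennreal (20 * r * l powr (r - 2)) * u s else 0) \<partial>lborel)"
    proof (cases "0 < l")
      case True
      have "(\<integral>\<^sup>+ t. (if 0 < l \<and> ennreal l < maxfun u t then ennreal (r * l powr (r - 1)) else 0) \<partial>lborel) =
        (\<integral>\<^sup>+ t. ennreal (r * l powr (r - 1)) * indicator {t. ennreal l < maxfun u t} t \<partial>lborel)"
        using True by (intro nn_integral_cong) (auto simp: indicator_def)
      also have "\<dots> = ennreal (r * l powr (r - 1)) * emeasure lborel {t. ennreal l < maxfun u t}"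
        by (rule nn_integral_cmult_indicator) auto
      also have "\<dots> \<le> ennreal (r * l powr (r - 1)) * (ennreal (20 / l) * (\<integral>\<^sup>+ s. (if ennreal (l / 4) < u s then u s else 0) \<partial>lborel))"
        by (intro mult_left_mono weak True) auto
      also have "\<dots> = ennreal (20 * r * l powr (r - 2)) * (\<integral>\<^sup>+ s. (if ennreal (l / 4) < u s then u s else 0) \<partial>lborel)"
      proof -
        have "l powr (r - 1) = l powr (r - 2) * l"
          using True powr_add[of l "r - 2" 1] by simp
        then have "r * l powr (r - 1) * (20 / l) = 20 * r * l powr (r - 2)"
          using True by simp
        then show ?thesis using True r by (simp add: mult.assoc[symmetric] ennreal_mult[symmetric])
      qed
      also have "\<dots> = (\<integral>\<^sup>+ s. ennreal (20 * r * l powr (r - 2)) * (if ennreal (l / 4) < u s then u s else 0) \<partial>lborel)"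
        by (rule nn_integral_cmult[symmetric]) auto
      also have "\<dots> = (\<integral>\<^sup>+ s. (if 0 < l \<and> ennreal (l / 4) < u s then ennreal (20 * r * l powr (r - 2)) * u s else 0) \<partial>lborel)"
        using True by (intro nn_integral_cong) auto
      finally show ?thesis .
    qed simp
  qed
  also have "\<dots> = (\<integral>\<^sup>+ s. (\<integral>\<^sup>+ l. (if 0 < l \<and> ennreal (l / 4) < u s then ennreal (20 * r * l powr (r - 2)) * u s else 0) \<partial>lborel) \<partial>lborel)"
    by (rule nn_integral_lborel_swap) measurable
  also have "\<dots> = (\<integral>\<^sup>+ s. ennreal (20 * r / (r - 1) * 4 powr (r - 1)) * epowr (u s) r \<partial>lborel)"
  proof (rule nn_integral_cong)
    fix s :: real
    have iff: "ennreal (l / 4) < u s \<longleftrightarrow> ennreal l < 4 * u s" if "0 < l" for l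
    proof (cases "u s")
      case (real c)
      then have "4 * u s = ennreal (4 * c)" by (simp add: ennreal_mult)
      with real that show ?thesis by (simp add: ennreal_less_iff) auto
    qed (simp add: ennreal_mult_top)
    \<comment> \<open>At fixed s the integral over l is again a layer cake, now with exponent r - 1
      and height \<open>4 * u s\<close>.\<close>
    have "(\<integral>\<^sup>+ l. (if 0 < l \<and> ennreal (l / 4) < u s then ennreal (20 * r * l powr (r - 2)) * u s else 0) \<partial>lborel) =
      (\<integral>\<^sup>+ l. (ennreal (20 * r / (r - 1)) * u s) * (if 0 < l \<and> ennreal l < 4 * u s then ennreal ((r - 1) * l powr (r - 1 - 1)) else 0) \<partial>lborel)"
    proof (intro nn_integral_cong)
      fix l :: real
      have "20 * r * l powr (r - 2) = 20 * r / (r - 1) * ((r - 1) * l powr (r - 1 - 1))"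
        using r by simp
      then have "ennreal (20 * r * l powr (r - 2)) = ennreal (20 * r / (r - 1)) * ennreal ((r - 1) * l powr (r - 1 - 1))"
        using r by (simp add: ennreal_mult[symmetric] del: diff_diff_eq)
      then show "(if 0 < l \<and> ennreal (l / 4) < u s then ennreal (20 * r * l powr (r - 2)) * u s else 0) =
        (ennreal (20 * r / (r - 1)) * u s) * (if 0 < l \<and> ennreal l < 4 * u s then ennreal ((r - 1) * l powr (r - 1 - 1)) else 0)"
        by (auto simp: iff mult_ac simp del: diff_diff_eq)
    qed
    also have "\<dots> = ennreal (20 * r / (r - 1)) * u s * epowr (4 * u s) (r - 1)"
      using r by (subst nn_integral_cmult) (auto simp: layer_cake)
    also have "\<dots> = (ennreal (20 * r / (r - 1)) * ennreal (4 powr (r - 1))) * (epowr (u s) 1 * epowr (u s) (r - 1))"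
      using epowr_ennreal[of 4 "r - 1"] by (simp add: epowr_mult mult_ac)
    also have "\<dots> = ennreal (20 * r / (r - 1) * 4 powr (r - 1)) * epowr (u s) r"
      unfolding epowr_add[symmetric] using r by (simp add: ennreal_mult[symmetric])
    finally show "(\<integral>\<^sup>+ l. (if 0 < l \<and> ennreal (l / 4) < u s then ennreal (20 * r * l powr (r - 2)) * u s else 0) \<partial>lborel) =
      ennreal (20 * r / (r - 1) * 4 powr (r - 1)) * epowr (u s) r" .
  qed
  also have "\<dots> = ennreal (20 * r / (r - 1) * 4 powr (r - 1)) * (\<integral>\<^sup>+ t. epowr (u t) r \<partial>lborel)"
    by (rule nn_integral_cmult) auto
  finally show ?thesis .
qed

subsection \<open>The positive kernel and its weighted bilinear bound\<close>

text \<open>Functions of depth and angle are measured by \<open>borel\<close> of the pair type and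
  not by a product sigma-algebra, so the projections get their own rules.\<close>

lemma borel_measurable_fst_comp [measurable (raw)]:
  fixes f :: "'c \<Rightarrow> 'a::second_countable_topology \<times> 'b::second_countable_topology"
  assumes "f \<in> borel_measurable M"
  shows "(\<lambda>x. fst (f x)) \<in> borel_measurable M"
  using assms by (rule measurable_compose) (intro borel_measurable_continuous_onI continuous_intros)

lemma borel_measurable_snd_comp [measurable (raw)]:
  fixes f :: "'c \<Rightarrow> 'a::second_countable_topology \<times> 'b::second_countable_topology"
  assumes "f \<in> borel_measurable M"
  shows "(\<lambda>x. snd (f x)) \<in> borel_measurable M"
  using assms by (rule measurable_compose) (intro borel_measurable_continuous_onI continuous_intros)

lemma nn_integral_lborel_pair:
  fixes f :: "'a::euclidean_space \<times> 'b::euclidean_space \<Rightarrow> ennreal"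
  assumes f: "f \<in> borel_measurable borel"
  shows "(\<integral>\<^sup>+ z. f z \<partial>lborel) = (\<integral>\<^sup>+ x. \<integral>\<^sup>+ y. f (x, y) \<partial>lborel \<partial>lborel)"
    and "(\<integral>\<^sup>+ z. f z \<partial>lborel) = (\<integral>\<^sup>+ y. \<integral>\<^sup>+ x. f (x, y) \<partial>lborel \<partial>lborel)"
proof -
  interpret pair_sigma_finite "lborel :: 'a measure" "lborel :: 'b measure" ..
  have f': "f \<in> borel_measurable (lborel \<Otimes>\<^sub>M lborel)"
    using f by (simp add: lborel_prod)
  show "(\<integral>\<^sup>+ z. f z \<partial>lborel) = (\<integral>\<^sup>+ x. \<integral>\<^sup>+ y. f (x, y) \<partial>lborel \<partial>lborel)"
    using lborel.nn_integral_fst[OF f'] by (simp add: lborel_prod)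
  show "(\<integral>\<^sup>+ z. f z \<partial>lborel) = (\<integral>\<^sup>+ y. \<integral>\<^sup>+ x. f (x, y) \<partial>lborel \<partial>lborel)"
    using lborel_pair.nn_integral_snd[OF f'] by (simp add: lborel_prod)
qed

text \<open>1/(s + d)^2 is the integral of 2 r^(-3) over r >= s + d, which writes the kernel as a
  superposition of intervals of radius r >= s. Each carries mass at most 2r times
  \<open>maxfun u c\<close>, and 4 r^(-2) integrates to 4/s over r >= s.\<close>

lemma inverse_square_maxfun:
  assumes [measurable]: "u \<in> borel_measurable borel" and s: "0 < s"
  shows "(\<integral>\<^sup>+ t. ennreal (1 / (s + \<bar>t - c\<bar>)\<^sup>2) * u t \<partial>lborel) \<le> ennreal (4 / s) * maxfun u c"
proof -
  have tail: "(\<integral>\<^sup>+ r. ennreal (k * r powr e) * indicator {a..} r \<partial>lborel) = ennreal (k * (- (a powr (e + 1)) / (e + 1)))"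
    if "a > 0" "e < -1" "k \<ge> 0" for a e k :: real
    by (rule nn_integral_has_integral_lebesgue'[OF _ has_integral_mult_right[OF has_integral_powr_to_inf]])
      (use that in auto)
  have "(\<integral>\<^sup>+ t. ennreal (1 / (s + \<bar>t - c\<bar>)\<^sup>2) * u t \<partial>lborel) =
    (\<integral>\<^sup>+ t. (\<integral>\<^sup>+ r. (if s + \<bar>t - c\<bar> \<le> r then ennreal (2 * r powr -3) * u t else 0) \<partial>lborel) \<partial>lborel)"
  proof (intro nn_integral_cong)
    fix t :: real
    have "(\<integral>\<^sup>+ r. (if s + \<bar>t - c\<bar> \<le> r then ennreal (2 * r powr -3) * u t else 0) \<partial>lborel) =
      (\<integral>\<^sup>+ r. ennreal (2 * r powr -3) * indicator {s + \<bar>t - c\<bar>..} r * u t \<partial>lborel)"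
      by (intro nn_integral_cong) (auto simp: indicator_def)
    also have "\<dots> = ennreal (2 * (- ((s + \<bar>t - c\<bar>) powr (-3 + 1)) / (-3 + 1))) * u t"
      using s by (subst nn_integral_multc) (auto simp: tail simp del: mult_minus_right)
    also have "2 * (- ((s + \<bar>t - c\<bar>) powr (-3 + 1)) / (-3 + 1)) = 1 / (s + \<bar>t - c\<bar>)\<^sup>2"
      using s by (simp add: powr_minus_divide)
    finally show "ennreal (1 / (s + \<bar>t - c\<bar>)\<^sup>2) * u t =
      (\<integral>\<^sup>+ r. (if s + \<bar>t - c\<bar> \<le> r then ennreal (2 * r powr -3) * u t else 0) \<partial>lborel)" by simp
  qed
  also have "\<dots> = (\<integral>\<^sup>+ r. (\<integral>\<^sup>+ t. (if s + \<bar>t - c\<bar> \<le> r then ennreal (2 * r powr -3) * u t else 0) \<partial>lborel) \<partial>lborel)"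
    by (rule nn_integral_lborel_swap) measurable
  also have "\<dots> \<le> (\<integral>\<^sup>+ r. ennreal (4 * r powr -2) * indicator {s..} r * maxfun u c \<partial>lborel)"
  proof (intro nn_integral_mono)
    fix r :: real
    show "(\<integral>\<^sup>+ t. (if s + \<bar>t - c\<bar> \<le> r then ennreal (2 * r powr -3) * u t else 0) \<partial>lborel) \<le>
      ennreal (4 * r powr -2) * indicator {s..} r * maxfun u c"
    proof (cases "s \<le> r")
      case True
      have "(\<integral>\<^sup>+ t. (if s + \<bar>t - c\<bar> \<le> r then ennreal (2 * r powr -3) * u t else 0) \<partial>lborel) \<le>
        (\<integral>\<^sup>+ t. ennreal (2 * r powr -3) * (if \<bar>t - c\<bar> < r then u t else 0) \<partial>lborel)"
        using s by (intro nn_integral_mono) auto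
      also have "\<dots> = ennreal (2 * r powr -3) * box_integral u r c"
        unfolding box_integral_def by (rule nn_integral_cmult) measurable
      also have "\<dots> \<le> ennreal (2 * r powr -3) * (ennreal (2 * r) * maxfun u c)"
        using s True by (intro mult_left_mono box_integral_le_maxfun) auto
      also have "\<dots> = ennreal (4 * r powr -2) * maxfun u c"
      proof -
        have "r powr -3 * r = r powr -2"
          using s True powr_add[of r "-3" 1] by simp
        then have "2 * r powr -3 * (2 * r) = 4 * r powr -2" by simp
        moreover have "ennreal (2 * r powr -3) * ennreal (2 * r) = ennreal (2 * r powr -3 * (2 * r))"
          using s True by (intro ennreal_mult[symmetric]) auto
        ultimately show ?thesis by (simp only: mult.assoc[symmetric])
      qed
      finally show ?thesis using True by simp
    next
      case False
      then have "(\<integral>\<^sup>+ t. (if s + \<bar>t - c\<bar> \<le> r then ennreal (2 * r powr -3) * u t else 0) \<partial>lborel) = (\<integral>\<^sup>+ (t::real). 0 \<partial>lborel)"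
        by (intro nn_integral_cong) auto
      then show ?thesis by simp
    qed
  qed
  also have "\<dots> = ennreal (4 * (- (s powr (-2 + 1)) / (-2 + 1))) * maxfun u c"
    using s by (subst nn_integral_multc) (auto simp: tail simp del: mult_minus_right)
  also have "4 * (- (s powr (-2 + 1)) / (-2 + 1)) = 4 / s"
    using s by (simp add: powr_minus_divide)
  finally show ?thesis .
qed

lemma maxfun_one: "maxfun (\<lambda>_. 1) c \<le> 2"
  unfolding maxfun_def
proof (rule SUP_least)
  fix r :: real assume "r \<in> \<rat> \<inter> {0<..}"
  then show "ennreal (1 / r) * box_integral (\<lambda>_. 1) r c \<le> 2"
    by (simp add: box_integral_const ennreal_mult[symmetric])
qed

text \<open>The denominator is at least y for x <= y and at least x beyond. Integrability at 0 comes
  from b < 1 and at infinity from b > 0; the exact constant would be pi / sin(pi b).\<close>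

lemma hilbert_kernel_powr:
  assumes b: "0 < b" "b < 1" and y: "0 < y"
  shows "(\<integral>\<^sup>+ x. (if 0 < x then ennreal (x powr -b / (x + y)) else 0) \<partial>lborel) \<le> ennreal ((1 / (1 - b) + 1 / b) * y powr -b)"
proof -
  have 1: "(\<integral>\<^sup>+ x. ennreal (1 / y * x powr -b) * indicator {0..y} x \<partial>lborel) = ennreal (1 / y * (y powr (-b + 1) / (-b + 1)))"
    by (rule nn_integral_has_integral_lebesgue'[OF _ has_integral_mult_right[OF has_integral_powr_from_0]])
      (use assms in auto)
  have 2: "(\<integral>\<^sup>+ x. ennreal (x powr (-b-1)) * indicator {y..} x \<partial>lborel) = ennreal (- (y powr (-b-1+1)) / (-b-1+1))"
    by (rule nn_integral_has_integral_lebesgue'[OF _ has_integral_powr_to_inf])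
      (use assms in auto)
  have "(\<integral>\<^sup>+ x. (if 0 < x then ennreal (x powr -b / (x + y)) else 0) \<partial>lborel) \<le>
    (\<integral>\<^sup>+ x. ennreal (1 / y * x powr -b) * indicator {0..y} x + ennreal (x powr (-b-1)) * indicator {y..} x \<partial>lborel)"
  proof (intro nn_integral_mono)
    fix x :: real
    consider "x \<le> 0" | "0 < x" "x \<le> y" | "0 < x" "y < x" by linarith
    then show "(if 0 < x then ennreal (x powr -b / (x + y)) else 0) \<le>
      ennreal (1 / y * x powr -b) * indicator {0..y} x + ennreal (x powr (-b-1)) * indicator {y..} x"
    proof cases
      case 2
      then have "x powr -b / (x + y) \<le> x powr -b / y" using y by (intro divide_left_mono) auto
      then show ?thesis using 2 by (auto simp: add_increasing2 ennreal_leI)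
    next
      case 3
      then have "x powr -b / (x + y) \<le> x powr -b / x" using y by (intro divide_left_mono) auto
      also have "\<dots> = x powr (-b - 1)" using 3 by (simp add: powr_diff)
      finally show ?thesis using 3 by (auto simp: add_increasing ennreal_leI)
    qed auto
  qed
  also have "\<dots> = ennreal (1 / y * (y powr (-b + 1) / (-b + 1))) + ennreal (- (y powr (-b-1+1)) / (-b-1+1))"
    unfolding 1[symmetric] 2[symmetric] by (rule nn_integral_add) measurable
  also have "\<dots> = ennreal (1 / y * (y powr (-b + 1) / (-b + 1)) + - (y powr (-b-1+1)) / (-b-1+1))"
    using b y by (subst ennreal_plus) (auto simp: divide_nonneg_nonneg)
  also have "1 / y * (y powr (-b + 1) / (-b + 1)) + - (y powr (-b-1+1)) / (-b-1+1) = (1 / (1 - b) + 1 / b) * y powr -b"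
  proof -
    have "y powr (-b + 1) = y * y powr -b"
      using y powr_add[of y "-b" 1] by simp
    then show ?thesis using b y by (simp add: field_simps)
  qed
  finally show ?thesis .
qed

text \<open>First coordinates are distances to the circle, second coordinates are angles. The value
  0 off the half-plane of positive depths lets every integral run over the whole plane.\<close>

definition kern :: "real \<times> real \<Rightarrow> real \<times> real \<Rightarrow> ennreal" where
  "kern w z = (if 0 < fst w \<and> 0 < fst z then ennreal (1 / (fst w + fst z + \<bar>snd w - snd z\<bar>)\<^sup>2) else 0)"

lemma kern_commute: "kern w z = kern z w"
  by (auto simp: kern_def abs_minus_commute add_ac)

lemma kern_measurable [measurable]:
  assumes [measurable]: "f \<in> borel_measurable M" "g \<in> borel_measurable M"
  shows "(\<lambda>x. kern (f x) (g x)) \<in> borel_measurable M"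
  unfolding kern_def by measurable

text \<open>The angular integral yields the maximal function and a factor 4/(x + y); what remains is
  the Hilbert kernel. Radial powers thus reproduce themselves up to a constant, as a Schur test
  demands.\<close>

lemma kern_weight:
  assumes b: "0 < b" "b < 1" and [measurable]: "u \<in> borel_measurable borel"
  shows "(\<integral>\<^sup>+ z. kern w z * (ennreal (fst z powr -b) * u (snd z)) \<partial>lborel) \<le>
    ennreal (4 * (1 / (1 - b) + 1 / b) * fst w powr -b) * maxfun u (snd w)"
proof (cases "0 < fst w")
  case True
  obtain y c where w: "w = (y, c)" by force
  have y: "0 < y" using True w by simp
  have "(\<integral>\<^sup>+ z. kern w z * (ennreal (fst z powr -b) * u (snd z)) \<partial>lborel) =
    (\<integral>\<^sup>+ x. (\<integral>\<^sup>+ t. kern w (x, t) * (ennreal (x powr -b) * u t) \<partial>lborel) \<partial>lborel)"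
    by (subst nn_integral_lborel_pair(1)) auto
  also have "\<dots> \<le> (\<integral>\<^sup>+ x. (if 0 < x then ennreal (x powr -b / (x + y)) else 0) * (4 * maxfun u c) \<partial>lborel)"
  proof (intro nn_integral_mono)
    fix x :: real
    show "(\<integral>\<^sup>+ t. kern w (x, t) * (ennreal (x powr -b) * u t) \<partial>lborel) \<le>
      (if 0 < x then ennreal (x powr -b / (x + y)) else 0) * (4 * maxfun u c)"
    proof (cases "0 < x")
      case x: True
      have "(\<integral>\<^sup>+ t. kern w (x, t) * (ennreal (x powr -b) * u t) \<partial>lborel) =
        (\<integral>\<^sup>+ t. ennreal (x powr -b) * (ennreal (1 / (x + y + \<bar>t - c\<bar>)\<^sup>2) * u t) \<partial>lborel)"
        using x y by (intro nn_integral_cong) (auto simp: kern_def w abs_minus_commute add_ac mult_ac)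
      also have "\<dots> = ennreal (x powr -b) * (\<integral>\<^sup>+ t. ennreal (1 / (x + y + \<bar>t - c\<bar>)\<^sup>2) * u t \<partial>lborel)"
        by (rule nn_integral_cmult) measurable
      also have "\<dots> \<le> ennreal (x powr -b) * (ennreal (4 / (x + y)) * maxfun u c)"
        using x y by (intro mult_left_mono inverse_square_maxfun) auto
      also have "\<dots> = ennreal (x powr -b / (x + y)) * (4 * maxfun u c)"
      proof -
        have "x powr -b * (4 / (x + y)) = x powr -b / (x + y) * 4" by simp
        then have "ennreal (x powr -b) * ennreal (4 / (x + y)) = ennreal (x powr -b / (x + y)) * ennreal 4"
          using x y by (simp only: ennreal_mult[symmetric] powr_ge_zero divide_nonneg_pos add_pos_pos zero_le_numeral)
        then show ?thesis by (simp add: mult.assoc[symmetric])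
      qed
      finally show ?thesis using x by simp
    qed (simp add: kern_def)
  qed
  also have "\<dots> = (\<integral>\<^sup>+ x. (if 0 < x then ennreal (x powr -b / (x + y)) else 0) \<partial>lborel) * (4 * maxfun u c)"
    by (rule nn_integral_multc) measurable
  also have "\<dots> \<le> ennreal ((1 / (1 - b) + 1 / b) * y powr -b) * (4 * maxfun u c)"
    by (intro mult_right_mono hilbert_kernel_powr b y) auto
  also have "\<dots> = ennreal (4 * (1 / (1 - b) + 1 / b) * fst w powr -b) * maxfun u (snd w)"
  proof -
    have "ennreal (4 * (1 / (1 - b) + 1 / b) * y powr -b) = ennreal 4 * ennreal ((1 / (1 - b) + 1 / b) * y powr -b)"
      using b by (subst ennreal_mult[symmetric]) (auto simp: mult.assoc)
    then show ?thesis by (simp add: w mult_ac)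
  qed
  finally show ?thesis .
qed (simp add: kern_def)

section \<open>The bilinear form and its weighted Schur test\<close>

definition bilform :: "(real \<times> real \<Rightarrow> ennreal) \<Rightarrow> (real \<times> real \<Rightarrow> ennreal) \<Rightarrow> ennreal" where
  "bilform F G = (\<integral>\<^sup>+ z. (\<integral>\<^sup>+ w. kern w z * F w * G z \<partial>lborel) \<partial>lborel)"

lemma bilform_pair:
  assumes [measurable]: "F \<in> borel_measurable borel" "G \<in> borel_measurable borel"
  shows "bilform F G = (\<integral>\<^sup>+ x. kern (fst x) (snd x) * F (fst x) * G (snd x) \<partial>lborel)"
  unfolding bilform_def by (subst nn_integral_lborel_pair(2)) auto

lemma bilform_commute:
  assumes [measurable]: "F \<in> borel_measurable borel" "G \<in> borel_measurable borel"
  shows "bilform F G = bilform G F"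
  unfolding bilform_pair[OF assms]
  by (subst nn_integral_lborel_pair(1)) (auto simp: bilform_def kern_commute mult_ac)

text \<open>Hoelder on the product space for the splitting K = K^(1/p) K^(1/p'). Raised to the power
  p, the first factor has u inside the integral over z, where the kernel turns it into
  \<open>maxfun u\<close> at the angle of w; in the second factor v stays outside the integral over
  w and is untouched. This asymmetry is what makes room for different outer exponents.\<close>

lemma bilform_weighted:
  assumes p: "1 < p" and pp': "1 / p + 1 / p' = 1"
    and [measurable]: "F \<in> borel_measurable borel" "G \<in> borel_measurable borel"
      "u \<in> borel_measurable borel" "v \<in> borel_measurable borel"
  shows "bilform F (\<lambda>z. G z * epowr (u (snd z)) (1 / p) * epowr (v (snd z)) (1 / p')) \<le>
    ennreal (8 * (p + p')) * epowr (\<integral>\<^sup>+ w. epowr (F w) p * maxfun u (snd w) \<partial>lborel) (1 / p) *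
      epowr (\<integral>\<^sup>+ z. epowr (G z) p' * v (snd z) \<partial>lborel) (1 / p')"
    (is "bilform F ?G \<le> _ * epowr ?X _ * epowr ?Y _")
proof -
  have p': "1 < p'" using conjugate_exponent[OF p pp'] .
  \<comment> \<open>The factor 4 (1/(1 - b) + 1/b) from \<open>kern_weight\<close> has this value
    for b = 1/p and for b = 1/p'.\<close>
  define C where "C = 4 * (p + p')"
  have C1: "4 * (1 / (1 - 1 / p') + 1 / (1 / p')) = C"
  proof -
    have "1 - 1 / p' = 1 / p" using pp' by simp
    then show ?thesis by (simp add: C_def)
  qed
  have C2: "4 * (1 / (1 - 1 / p) + 1 / (1 / p)) = C"
  proof -
    have "1 - 1 / p = 1 / p'" using pp' by simp
    then show ?thesis by (simp add: C_def)
  qed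
  have C0: "C > 8" using p p' by (simp add: C_def)
  \<comment> \<open>Raised to the power p, the weights get exponents of size 1/p', and raised to the
    power p' of size 1/p. Both lie in (0, 1), as \<open>kern_weight\<close> demands, and the weight
    outside the inner integral cancels the power that this integral produces.\<close>
  let ?a = "1 / (p * p')"
  have ap: "?a * p = 1 / p'" "?a * p' = 1 / p" using p p' by auto
  define f where "f = (\<lambda>x. epowr (kern (fst x) (snd x)) (1 / p) * F (fst x) *
    ennreal (fst (fst x) powr ?a) * ennreal (fst (snd x) powr -?a) * epowr (u (snd (snd x))) (1 / p))"
  define g where "g = (\<lambda>x. epowr (kern (fst x) (snd x)) (1 / p') * G (snd x) *
    ennreal (fst (fst x) powr -?a) * ennreal (fst (snd x) powr ?a) * epowr (v (snd (snd x))) (1 / p'))"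
  have [measurable]: "f \<in> borel_measurable borel" "g \<in> borel_measurable borel"
    unfolding f_def g_def by measurable
  have fg: "kern (fst x) (snd x) * F (fst x) * ?G (snd x) = f x * g x" for x
  proof (cases "0 < fst (fst x) \<and> 0 < fst (snd x)")
    case True
    have one: "ennreal (s powr ?a) * ennreal (s powr -?a) = 1" if "0 < s" for s
      using that by (simp add: ennreal_mult[symmetric] powr_add[symmetric])
    have "f x * g x = (epowr (kern (fst x) (snd x)) (1 / p) * epowr (kern (fst x) (snd x)) (1 / p')) * F (fst x) * ?G (snd x)
      * (ennreal (fst (fst x) powr ?a) * ennreal (fst (fst x) powr -?a))
      * (ennreal (fst (snd x) powr ?a) * ennreal (fst (snd x) powr -?a))"
      unfolding f_def g_def by (simp only: mult_ac)
    also have "\<dots> = kern (fst x) (snd x) * F (fst x) * ?G (snd x)"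
      using True by (simp add: one epowr_add[symmetric] pp')
    finally show ?thesis by simp
  qed (auto simp: f_def g_def kern_def)
  have X: "(\<integral>\<^sup>+ x. epowr (f x) p \<partial>lborel) \<le> ennreal C * ?X"
  proof -
    have f_powr: "epowr (f (w, z)) p = (epowr (F w) p * ennreal (fst w powr (1 / p'))) *
        (kern w z * (ennreal (fst z powr -(1 / p')) * u (snd z)))" for w z
    proof -
      have "- ?a * p = -(1 / p')" using ap by simp
      then show ?thesis using p ap unfolding f_def
        by (simp add: epowr_mult epowr_epowr epowr_ennreal powr_powr mult_ac)
    qed
    have "(\<integral>\<^sup>+ x. epowr (f x) p \<partial>lborel) = (\<integral>\<^sup>+ w. (\<integral>\<^sup>+ z. epowr (f (w, z)) p \<partial>lborel) \<partial>lborel)"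
      by (rule nn_integral_lborel_pair(1)) measurable
    also have "\<dots> = (\<integral>\<^sup>+ w. (epowr (F w) p * ennreal (fst w powr (1 / p'))) *
        (\<integral>\<^sup>+ z. kern w z * (ennreal (fst z powr -(1 / p')) * u (snd z)) \<partial>lborel) \<partial>lborel)"
      unfolding f_powr by (subst nn_integral_cmult) auto
    also have "\<dots> \<le> (\<integral>\<^sup>+ w. ennreal C * (epowr (F w) p * maxfun u (snd w)) \<partial>lborel)"
    proof (rule nn_integral_mono)
      fix w :: "real \<times> real"
      show "(epowr (F w) p * ennreal (fst w powr (1 / p'))) *
        (\<integral>\<^sup>+ z. kern w z * (ennreal (fst z powr -(1 / p')) * u (snd z)) \<partial>lborel) \<le>
        ennreal C * (epowr (F w) p * maxfun u (snd w))"
      proof (cases "0 < fst w")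
        case True
        have "(epowr (F w) p * ennreal (fst w powr (1 / p'))) *
            (\<integral>\<^sup>+ z. kern w z * (ennreal (fst z powr -(1 / p')) * u (snd z)) \<partial>lborel) \<le>
          (epowr (F w) p * ennreal (fst w powr (1 / p'))) *
            (ennreal (C * fst w powr -(1 / p')) * maxfun u (snd w))"
          unfolding C1[symmetric] using p' by (intro mult_left_mono kern_weight) auto
        also have "\<dots> = (ennreal (fst w powr (1 / p')) * ennreal (C * fst w powr -(1 / p'))) *
          (epowr (F w) p * maxfun u (snd w))"
          by (simp add: mult_ac)
        also have "ennreal (fst w powr (1 / p')) * ennreal (C * fst w powr -(1 / p')) = ennreal C"
        proof -
          have "fst w powr (1 / p') * (C * fst w powr -(1 / p')) = C"
            using True powr_add[of "fst w" "1 / p'" "- (1 / p')"] by (simp add: mult_ac)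
          then show ?thesis using C0 by (simp add: ennreal_mult[symmetric])
        qed
        finally show ?thesis .
      qed (simp add: kern_def)
    qed
    also have "\<dots> = ennreal C * ?X"
      by (rule nn_integral_cmult) measurable
    finally show ?thesis .
  qed
  \<comment> \<open>The angular weight inside the integral over w is constantly 1, and its maximal
    function is at most 2; hence \<open>2 * C\<close>.\<close>
  have Y: "(\<integral>\<^sup>+ x. epowr (g x) p' \<partial>lborel) \<le> ennreal (2 * C) * ?Y"
  proof -
    have g_powr: "epowr (g (w, z)) p' = (epowr (G z) p' * ennreal (fst z powr (1 / p)) * v (snd z)) *
        (kern z w * (ennreal (fst w powr -(1 / p)) * 1))" for w z
    proof -
      have "- ?a * p' = -(1 / p)" using ap by simp
      then show ?thesis using p' ap unfolding g_def
        by (simp add: epowr_mult epowr_epowr epowr_ennreal powr_powr mult_ac kern_commute[of w])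
    qed
    have "(\<integral>\<^sup>+ x. epowr (g x) p' \<partial>lborel) = (\<integral>\<^sup>+ z. (\<integral>\<^sup>+ w. epowr (g (w, z)) p' \<partial>lborel) \<partial>lborel)"
      by (rule nn_integral_lborel_pair(2)) measurable
    also have "\<dots> = (\<integral>\<^sup>+ z. (epowr (G z) p' * ennreal (fst z powr (1 / p)) * v (snd z)) *
        (\<integral>\<^sup>+ w. kern z w * (ennreal (fst w powr -(1 / p)) * 1) \<partial>lborel) \<partial>lborel)"
      unfolding g_powr by (subst nn_integral_cmult) auto
    also have "\<dots> \<le> (\<integral>\<^sup>+ z. ennreal (2 * C) * (epowr (G z) p' * v (snd z)) \<partial>lborel)"
    proof (rule nn_integral_mono)
      fix z :: "real \<times> real"
      show "(epowr (G z) p' * ennreal (fst z powr (1 / p)) * v (snd z)) *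
        (\<integral>\<^sup>+ w. kern z w * (ennreal (fst w powr -(1 / p)) * 1) \<partial>lborel) \<le>
        ennreal (2 * C) * (epowr (G z) p' * v (snd z))"
      proof (cases "0 < fst z")
        case True
        have "(\<integral>\<^sup>+ w. kern z w * (ennreal (fst w powr -(1 / p)) * 1) \<partial>lborel) \<le>
          ennreal (C * fst z powr -(1 / p)) * maxfun (\<lambda>_. 1) (snd z)"
          unfolding C2[symmetric] using p by (intro kern_weight) auto
        also have "\<dots> \<le> ennreal (C * fst z powr -(1 / p)) * ennreal 2"
          using maxfun_one by (intro mult_left_mono) auto
        finally have "(epowr (G z) p' * ennreal (fst z powr (1 / p)) * v (snd z)) *
            (\<integral>\<^sup>+ w. kern z w * (ennreal (fst w powr -(1 / p)) * 1) \<partial>lborel) \<le>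
          (epowr (G z) p' * ennreal (fst z powr (1 / p)) * v (snd z)) *
            (ennreal (C * fst z powr -(1 / p)) * ennreal 2)"
          by (intro mult_left_mono) auto
        also have "\<dots> = (ennreal (fst z powr (1 / p)) * (ennreal (C * fst z powr -(1 / p)) * ennreal 2)) *
          (epowr (G z) p' * v (snd z))"
          by (simp only: mult_ac)
        also have "ennreal (fst z powr (1 / p)) * (ennreal (C * fst z powr -(1 / p)) * ennreal 2) = ennreal (2 * C)"
        proof -
          have "fst z powr (1 / p) * (C * fst z powr -(1 / p) * 2) = 2 * C"
            using True powr_add[of "fst z" "1 / p" "- (1 / p)"] by (simp add: mult_ac)
          then show ?thesis using C0 by (simp only: ennreal_mult[symmetric] powr_ge_zero mult_nonneg_nonneg zero_le_numeral)
        qed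
        finally show ?thesis .
      qed (simp add: kern_def)
    qed
    also have "\<dots> = ennreal (2 * C) * ?Y"
      by (rule nn_integral_cmult) measurable
    finally show ?thesis .
  qed
  have "bilform F ?G = (\<integral>\<^sup>+ x. f x * g x \<partial>lborel)"
    by (subst bilform_pair) (auto simp: fg)
  also have "\<dots> \<le> epowr (\<integral>\<^sup>+ x. epowr (f x) p \<partial>lborel) (1 / p) * epowr (\<integral>\<^sup>+ x. epowr (g x) p' \<partial>lborel) (1 / p')"
    by (rule nn_integral_holder[OF p pp']) auto
  also have "\<dots> \<le> epowr (ennreal (2 * C) * ?X) (1 / p) * epowr (ennreal (2 * C) * ?Y) (1 / p')"
    using p p' C0 by (intro mult_mono epowr_mono X Y order_trans[OF X] mult_right_mono) (auto simp: ennreal_leI)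
  also have "\<dots> = (epowr (ennreal (2 * C)) (1 / p) * epowr (ennreal (2 * C)) (1 / p')) * epowr ?X (1 / p) * epowr ?Y (1 / p')"
    by (simp add: epowr_mult mult_ac)
  also have "epowr (ennreal (2 * C)) (1 / p) * epowr (ennreal (2 * C)) (1 / p') = ennreal (8 * (p + p'))"
    unfolding epowr_add[symmetric] pp' by (simp add: C_def)
  finally show ?thesis .
qed

subsection \<open>Mixed norm bounds and duality\<close>

text \<open>The q-th power of the mixed norm, without the factor 1/(2 pi). The depth is the inner
  variable.\<close>

definition mixed_int :: "real \<Rightarrow> real \<Rightarrow> (real \<times> real \<Rightarrow> ennreal) \<Rightarrow> ennreal" where
  "mixed_int p q F = (\<integral>\<^sup>+ t. epowr (\<integral>\<^sup>+ x. epowr (F (x, t)) p \<partial>lborel) (q / p) \<partial>lborel)"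

text \<open>Equality is taken fibrewise because \<open>G\<close> will be replaced on the angles
  where its fibre norm is infinite, a null set, and where it is 0, so that \<open>G\<close> vanishes
  almost everywhere on the fibre.\<close>

lemma bilform_cong_AE:
  assumes [measurable]: "F \<in> borel_measurable borel" "G \<in> borel_measurable borel" "G' \<in> borel_measurable borel"
    and eq: "AE t in lborel. AE x in lborel. G (x, t) = G' (x, t)"
  shows "bilform F G = bilform F G'"
proof -
  have "bilform F H = (\<integral>\<^sup>+ t. (\<integral>\<^sup>+ x. (\<integral>\<^sup>+ w. kern w (x, t) * F w \<partial>lborel) * H (x, t) \<partial>lborel) \<partial>lborel)"
    if [measurable]: "H \<in> borel_measurable borel" for H
    unfolding bilform_def
    by (subst nn_integral_lborel_pair(2)) (auto simp: nn_integral_multc)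
  then show ?thesis
    using eq by (auto intro!: nn_integral_cong_AE elim!: eventually_mono)
qed

text \<open>With \<open>g\<close> the fibrewise \<open>p'\<close>-norm of \<open>G\<close>, write \<open>G = H g\<close> and \<open>g = u\<^sup>1\<^sup>/\<^sup>p v\<^sup>1\<^sup>/\<^sup>p\<^sup>'\<close>,
  where \<open>u\<close> and \<open>v\<close> are the powers of \<open>g\<close> for which both factors of the weighted bound are
  controlled by the integral of \<open>g\<close> to the power \<open>q'\<close>. The exponent conjugate to \<open>q / p\<close> is \<open>1 / c\<close>.\<close>

lemma bilform_mixed_ge:
  assumes p: "1 < p" and pp': "1 / p + 1 / p' = 1" and q: "p \<le> q" and qq': "1 / q + 1 / q' = 1"
  obtains C :: real where "0 < C"
    "\<And>F G. F \<in> borel_measurable borel \<Longrightarrow> G \<in> borel_measurable borel \<Longrightarrow> mixed_int p' q' G < top \<Longrightarrow>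
      bilform F G \<le> ennreal C * epowr (mixed_int p q F) (1 / q) * epowr (mixed_int p' q' G) (1 / q')"
proof -
  have p': "1 < p'" using conjugate_exponent[OF p pp'] .
  have q1: "1 < q" using p q by simp
  have q': "1 < q'" using conjugate_exponent[OF q1 qq'] .
  define c where "c = (if p = q then 0 else 1 - p / q)"
  have c0: "0 \<le> c" "p < q \<Longrightarrow> 0 < c" "c < 1" using p q by (auto simp: c_def)
  have cp: "1 - c = p / q" using p by (auto simp: c_def)
  \<comment> \<open>For p = q the conjugate exponent is infinite and u has to be constantly 1. This
    is a separate case because \<open>epowr\<close> with exponent 0 still maps 0 to 0 and
    \<open>top\<close> to \<open>top\<close>.\<close>
  define B where "B = (if p = q then 2 else epowr (ennreal (20 * (1 / c) / (1 / c - 1) * 4 powr (1 / c - 1))) c)"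
  have B: "B < top" by (auto simp: B_def)
  \<comment> \<open>Hoelder with exponents q/p and 1/c, then the strong maximal inequality. For p =
    q the last factor has exponent 0 and equals 1 because the integral is neither 0 nor
    infinite.\<close>
  have key: "(\<integral>\<^sup>+ t. P t * maxfun (\<lambda>t. if p = q then 1 else epowr (g t) (q' * c)) t \<partial>lborel) \<le>
      B * epowr (\<integral>\<^sup>+ t. epowr (P t) (q / p) \<partial>lborel) (p / q) * epowr (\<integral>\<^sup>+ t. epowr (g t) q' \<partial>lborel) c"
    if [measurable]: "P \<in> borel_measurable borel" "g \<in> borel_measurable borel"
      and g0: "(\<integral>\<^sup>+ t. epowr (g t) q' \<partial>lborel) \<noteq> 0" "(\<integral>\<^sup>+ t. epowr (g t) q' \<partial>lborel) \<noteq> top" for P g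
  proof (cases "p = q")
    case True
    have "(\<integral>\<^sup>+ t. P t * maxfun (\<lambda>t. 1) t \<partial>lborel) \<le> (\<integral>\<^sup>+ t. P t * 2 \<partial>lborel)"
      by (intro nn_integral_mono mult_left_mono maxfun_one) auto
    also have "\<dots> = 2 * (\<integral>\<^sup>+ t. P t \<partial>lborel)"
      by (simp add: nn_integral_multc mult.commute)
    finally show ?thesis
      using True p g0 by (cases "\<integral>\<^sup>+ t. epowr (g t) q' \<partial>lborel")
        (auto simp: B_def c_def epowr_ennreal)
  next
    case False
    then have c: "0 < c" "c < 1" and pq: "p < q" using c0 q by auto
    have "(\<integral>\<^sup>+ t. P t * maxfun (\<lambda>t. epowr (g t) (q' * c)) t \<partial>lborel) \<le>
      epowr (\<integral>\<^sup>+ t. epowr (P t) (q / p) \<partial>lborel) (1 / (q / p)) *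
      epowr (\<integral>\<^sup>+ t. epowr (maxfun (\<lambda>t. epowr (g t) (q' * c)) t) (1 / c) \<partial>lborel) (1 / (1 / c))"
      by (rule nn_integral_holder) (use p pq cp in auto)
    also have "\<dots> \<le> epowr (\<integral>\<^sup>+ t. epowr (P t) (q / p) \<partial>lborel) (1 / (q / p)) *
      epowr (ennreal (20 * (1 / c) / (1 / c - 1) * 4 powr (1 / c - 1)) *
        (\<integral>\<^sup>+ t. epowr (epowr (g t) (q' * c)) (1 / c) \<partial>lborel)) (1 / (1 / c))"
      using c by (intro mult_left_mono epowr_mono maxfun_strong_type) auto
    also have "\<dots> = B * epowr (\<integral>\<^sup>+ t. epowr (P t) (q / p) \<partial>lborel) (p / q) * epowr (\<integral>\<^sup>+ t. epowr (g t) q' \<partial>lborel) c"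
      using False c by (simp add: B_def epowr_mult epowr_epowr mult_ac)
    finally show ?thesis using False by simp
  qed
  define D where "D = ennreal (8 * (p + p')) * epowr B (1 / p)"
  have D: "D < top" using B by (simp add: D_def ennreal_mult_less_top)
  have main: "bilform F G \<le> D * epowr (mixed_int p q F) (1 / q) * epowr (mixed_int p' q' G) (1 / q')"
    if [measurable]: "F \<in> borel_measurable borel" "G \<in> borel_measurable borel" and fin: "mixed_int p' q' G < top" for F G
  proof -
    define g where "g = (\<lambda>t. epowr (\<integral>\<^sup>+ x. epowr (G (x, t)) p' \<partial>lborel) (1 / p'))"
    have [measurable]: "g \<in> borel_measurable borel" unfolding g_def by measurable
    have g_p': "epowr (g t) p' = (\<integral>\<^sup>+ x. epowr (G (x, t)) p' \<partial>lborel)" for t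
      using p' by (simp add: g_def)
    have N: "mixed_int p' q' G = (\<integral>\<^sup>+ t. epowr (g t) q' \<partial>lborel)"
      unfolding mixed_int_def g_def by (simp add: epowr_epowr)
    define H where "H = (\<lambda>z. if 0 < g (snd z) \<and> g (snd z) < top then G z * inverse (g (snd z)) else 0)"
    have [measurable]: "H \<in> borel_measurable borel" unfolding H_def by measurable
    define u where "u = (\<lambda>t. if p = q then 1 else epowr (g t) (q' * c))"
    define v where "v = (\<lambda>t. epowr (g t) q')"
    have [measurable]: "u \<in> borel_measurable borel" "v \<in> borel_measurable borel" unfolding u_def v_def by measurable
    have AE_top: "AE t in lborel. g t < top"
      using nn_integral_PInf_AE[of "\<lambda>t. epowr (g t) q'" lborel] fin by (auto simp: N less_top)
    show ?thesis
    proof (cases "mixed_int p' q' G = 0")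
      case True
      then have "AE t in lborel. epowr (g t) q' = 0" unfolding N by (subst (asm) nn_integral_0_iff_AE) auto
      then have "AE t in lborel. AE x in lborel. G (x, t) = 0"
      proof eventually_elim
        case (elim t)
        then have "(\<integral>\<^sup>+ x. epowr (G (x, t)) p' \<partial>lborel) = 0" using g_p'[of t] by simp
        then show ?case by (subst (asm) nn_integral_0_iff_AE) auto
      qed
      then have "bilform F G = bilform F (\<lambda>_. 0)"
        by (intro bilform_cong_AE) auto
      then show ?thesis by (simp add: bilform_def)
    next
      case nz: False
    \<comment> \<open>Precisely the condition for u^(1/p) v^(1/p') = g.\<close>
    have expo: "q' * c / p + q' / p' = 1"
    proof -
      have "c / p = 1 / p - 1 / q" using p cp by (simp add: field_simps)
      moreover have "1 / p' = 1 - 1 / p" "1 / q' = 1 - 1 / q" using pp' qq' by auto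
      ultimately have "c / p + 1 / p' = 1 / q'" by simp
      then have "q' * (c / p + 1 / p') = 1" using q' by simp
      then show ?thesis by (simp add: distrib_left)
    qed
    have uv: "epowr (u t) (1 / p) * epowr (v t) (1 / p') = g t" for t
    proof (cases "p = q")
      case True
      then show ?thesis using expo by (simp add: u_def v_def epowr_epowr c_def)
    next
      case False
      then show ?thesis using expo by (simp add: u_def v_def epowr_epowr epowr_add[symmetric])
    qed
    have "bilform F G = bilform F (\<lambda>z. H z * epowr (u (snd z)) (1 / p) * epowr (v (snd z)) (1 / p'))"
    proof (rule bilform_cong_AE)
      show "AE t in lborel. AE x in lborel. G (x, t) =
        H (x, t) * epowr (u (snd (x, t))) (1 / p) * epowr (v (snd (x, t))) (1 / p')"
        using AE_top
      proof eventually_elim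
        case (elim t)
        have eq: "H (x, t) * epowr (u (snd (x, t))) (1 / p) * epowr (v (snd (x, t))) (1 / p') = H (x, t) * g t" for x
          by (simp add: mult.assoc uv)
        show ?case
        proof (cases "g t = 0")
          case True
          then have "(\<integral>\<^sup>+ x. epowr (G (x, t)) p' \<partial>lborel) = 0" using g_p'[of t] by simp
          then have "AE x in lborel. G (x, t) = 0" by (subst (asm) nn_integral_0_iff_AE) auto
          then show ?thesis unfolding eq by eventually_elim (use True in auto)
        next
          case False
          then have "inverse (g t) * g t = 1"
            using elim by (simp add: mult.commute[of "inverse _"] divide_ennreal_def[symmetric] ennreal_divide_self)
          then show ?thesis unfolding eq using elim False
            by (auto simp: H_def mult.assoc zero_less_iff_neq_zero)
        qed
      qed
    qed measurable
    also have "\<dots> \<le> ennreal (8 * (p + p')) * epowr (\<integral>\<^sup>+ w. epowr (F w) p * maxfun u (snd w) \<partial>lborel) (1 / p) *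
        epowr (\<integral>\<^sup>+ z. epowr (H z) p' * v (snd z) \<partial>lborel) (1 / p')"
      by (rule bilform_weighted[OF p pp']) measurable
    also have "\<dots> \<le> ennreal (8 * (p + p')) * epowr (B * epowr (mixed_int p q F) (p / q) * epowr (mixed_int p' q' G) c) (1 / p) *
        epowr (mixed_int p' q' G) (1 / p')"
    proof (intro mult_mono epowr_mono mult_left_mono)
      have "(\<integral>\<^sup>+ w. epowr (F w) p * maxfun u (snd w) \<partial>lborel) =
        (\<integral>\<^sup>+ t. (\<integral>\<^sup>+ x. epowr (F (x, t)) p \<partial>lborel) * maxfun u t \<partial>lborel)"
        by (subst nn_integral_lborel_pair(2)) (auto simp: nn_integral_multc)
      also have "\<dots> \<le> B * epowr (mixed_int p q F) (p / q) * epowr (mixed_int p' q' G) c"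
        unfolding mixed_int_def[of p q] N u_def using fin nz by (intro key) (auto simp: N)
      finally show "(\<integral>\<^sup>+ w. epowr (F w) p * maxfun u (snd w) \<partial>lborel) \<le>
        B * epowr (mixed_int p q F) (p / q) * epowr (mixed_int p' q' G) c" .
      have "(\<integral>\<^sup>+ z. epowr (H z) p' * v (snd z) \<partial>lborel) =
        (\<integral>\<^sup>+ t. (\<integral>\<^sup>+ x. epowr (H (x, t)) p' \<partial>lborel) * v t \<partial>lborel)"
        by (subst nn_integral_lborel_pair(2)) (auto simp: nn_integral_multc)
      \<comment> \<open>\<open>H\<close> is normalised on fibres: its integral to the power p' is 1
        there, or 0 where \<open>H\<close> was set to 0.\<close>
      also have "\<dots> \<le> (\<integral>\<^sup>+ t. 1 * v t \<partial>lborel)"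
      proof (intro nn_integral_mono mult_right_mono)
        fix t :: real
        show "(\<integral>\<^sup>+ x. epowr (H (x, t)) p' \<partial>lborel) \<le> 1"
        proof (cases "0 < g t \<and> g t < top")
          case True
          then have "(\<integral>\<^sup>+ x. epowr (H (x, t)) p' \<partial>lborel) = (\<integral>\<^sup>+ x. epowr (G (x, t)) p' \<partial>lborel) * epowr (inverse (g t)) p'"
            by (simp add: H_def epowr_mult nn_integral_multc)
          also have "\<dots> = epowr (g t * inverse (g t)) p'"
            by (simp add: g_p' epowr_mult)
          also have "\<dots> = 1"
            using True by (simp add: divide_ennreal_def[symmetric] ennreal_divide_self zero_less_iff_neq_zero)
          finally show ?thesis by simp
        qed (auto simp: H_def)
      qed auto
      finally show "(\<integral>\<^sup>+ z. epowr (H z) p' * v (snd z) \<partial>lborel) \<le> mixed_int p' q' G"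
        by (simp add: N v_def)
    qed (use p p' in auto)
    also have "\<dots> = D * epowr (mixed_int p q F) (1 / q) * (epowr (mixed_int p' q' G) (c / p) * epowr (mixed_int p' q' G) (1 / p'))"
      using p by (simp add: D_def epowr_mult epowr_epowr mult_ac)
    also have "epowr (mixed_int p' q' G) (c / p) * epowr (mixed_int p' q' G) (1 / p') = epowr (mixed_int p' q' G) (1 / q')"
    proof -
      have "c / p + 1 / p' = 1 / q'" using expo q' by (simp add: field_simps)
      then show ?thesis by (simp add: epowr_add[symmetric])
    qed
    finally show ?thesis .
    qed
  qed
  show ?thesis
  proof
    \<comment> \<open>Adding 1 ensures a strictly positive constant, so that its product with an
      infinite norm is infinite.\<close>
    show "0 < enn2real D + 1" by (simp add: add_nonneg_pos)
    fix F G :: "real \<times> real \<Rightarrow> ennreal"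
    assume *: "F \<in> borel_measurable borel" "G \<in> borel_measurable borel" "mixed_int p' q' G < top"
    have "D \<le> ennreal (enn2real D + 1)" using D by (cases D) (auto intro: ennreal_leI)
    then have "D * epowr (mixed_int p q F) (1 / q) * epowr (mixed_int p' q' G) (1 / q') \<le>
      ennreal (enn2real D + 1) * epowr (mixed_int p q F) (1 / q) * epowr (mixed_int p' q' G) (1 / q')"
      by (intro mult_right_mono) auto
    with main[OF *] show "bilform F G \<le>
      ennreal (enn2real D + 1) * epowr (mixed_int p q F) (1 / q) * epowr (mixed_int p' q' G) (1 / q')"
      by (rule order_trans)
  qed
qed

text \<open>p > q means p' < q', so this case is the previous lemma for the conjugate exponents with
  \<open>F\<close> and \<open>G\<close> exchanged. The exchange moves the finiteness assumption to
  the other function, hence two of them here.\<close>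

lemma bilform_mixed:
  assumes p: "1 < p" and pp': "1 / p + 1 / p' = 1" and q: "1 < q" and qq': "1 / q + 1 / q' = 1"
  obtains C :: real where "0 < C"
    "\<And>F G. F \<in> borel_measurable borel \<Longrightarrow> G \<in> borel_measurable borel \<Longrightarrow>
      mixed_int p q F < top \<Longrightarrow> mixed_int p' q' G < top \<Longrightarrow>
      bilform F G \<le> ennreal C * epowr (mixed_int p q F) (1 / q) * epowr (mixed_int p' q' G) (1 / q')"
proof (cases "p \<le> q")
  case True
  obtain C where "0 < C"
    "\<And>F G. F \<in> borel_measurable borel \<Longrightarrow> G \<in> borel_measurable borel \<Longrightarrow> mixed_int p' q' G < top \<Longrightarrow>
      bilform F G \<le> ennreal C * epowr (mixed_int p q F) (1 / q) * epowr (mixed_int p' q' G) (1 / q')"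
    using bilform_mixed_ge[OF p pp' True qq'] by metis
  then show ?thesis by (intro that[of C]) auto
next
  case False
  have p': "1 < p'" and q': "1 < q'"
    using conjugate_exponent[OF p pp'] conjugate_exponent[OF q qq'] .
  have "1 / p < 1 / q" using False p q by (simp add: field_simps)
  then have "1 / q' < 1 / p'" using pp' qq' by linarith
  then have "p' \<le> q'" using p' q' by (simp add: field_simps)
  moreover have "1 / p' + 1 / p = 1" "1 / q' + 1 / q = 1" using pp' qq' by auto
  ultimately obtain C where C: "0 < C"
    "\<And>F G. F \<in> borel_measurable borel \<Longrightarrow> G \<in> borel_measurable borel \<Longrightarrow> mixed_int p q G < top \<Longrightarrow>
      bilform F G \<le> ennreal C * epowr (mixed_int p' q' F) (1 / q') * epowr (mixed_int p q G) (1 / q)"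
    using bilform_mixed_ge[OF p', of p q' q] by metis
  show ?thesis
  proof (rule that[OF C(1)])
    fix F G :: "real \<times> real \<Rightarrow> ennreal"
    assume "F \<in> borel_measurable borel" "G \<in> borel_measurable borel" "mixed_int p q F < top"
    then show "bilform F G \<le> ennreal C * epowr (mixed_int p q F) (1 / q) * epowr (mixed_int p' q' G) (1 / q')"
      using C(2)[of G F] by (simp add: bilform_commute[of F G] mult_ac)
  qed
qed

section \<open>Monotone approximation, norming functions and the bound for the positive
  operator\<close>

lemma epowr_SUP:
  fixes f :: "nat \<Rightarrow> ennreal"
  assumes "0 < a"
  shows "epowr (SUP n. f n) a = (SUP n. epowr (f n) a)"
proof (rule antisym)
  have "f n \<le> epowr (SUP n. epowr (f n) a) (1 / a)" for n
  proof -
    have "epowr (f n) a \<le> (SUP n. epowr (f n) a)" by (rule SUP_upper) simp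
    from epowr_mono[OF this, of "1 / a"] show ?thesis using assms by simp
  qed
  then have "(SUP n. f n) \<le> epowr (SUP n. epowr (f n) a) (1 / a)"
    by (rule SUP_least)
  from epowr_mono[OF this, of a] show "epowr (SUP n. f n) a \<le> (SUP n. epowr (f n) a)"
    using assms by simp
  show "(SUP n. epowr (f n) a) \<le> epowr (SUP n. f n) a"
    using assms by (intro SUP_least epowr_mono SUP_upper) auto
qed

lemma mixed_int_SUP:
  assumes [measurable]: "\<And>n. H n \<in> borel_measurable borel" and inc: "incseq H" and pq: "0 < p" "0 < q"
  shows "mixed_int p q (\<lambda>z. SUP n. H n z) = (SUP n. mixed_int p q (H n))"
proof -
  have H: "H m z \<le> H n z" if "m \<le> n" for m n z
    using incseqD[OF inc that] by (rule le_funD)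
  have "mixed_int p q (\<lambda>z. SUP n. H n z) =
      (\<integral>\<^sup>+ t. epowr (\<integral>\<^sup>+ x. (SUP n. epowr (H n (x, t)) p) \<partial>lborel) (q / p) \<partial>lborel)"
    using pq by (simp add: mixed_int_def epowr_SUP)
  also have "\<dots> = (\<integral>\<^sup>+ t. epowr (SUP n. (\<integral>\<^sup>+ x. epowr (H n (x, t)) p \<partial>lborel)) (q / p) \<partial>lborel)"
    using pq by (subst nn_integral_monotone_convergence_SUP)
      (auto simp: incseq_def le_fun_def intro!: epowr_mono H)
  also have "\<dots> = (\<integral>\<^sup>+ t. (SUP n. epowr (\<integral>\<^sup>+ x. epowr (H n (x, t)) p \<partial>lborel) (q / p)) \<partial>lborel)"
    using pq by (simp add: epowr_SUP)
  also have "\<dots> = (SUP n. mixed_int p q (H n))"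
    unfolding mixed_int_def using pq by (subst nn_integral_monotone_convergence_SUP)
      (auto simp: incseq_def le_fun_def intro!: epowr_mono H nn_integral_mono)
  finally show ?thesis .
qed

definition kernop :: "(real \<times> real \<Rightarrow> ennreal) \<Rightarrow> real \<times> real \<Rightarrow> ennreal" where
  "kernop F z = (\<integral>\<^sup>+ w. kern w z * F w \<partial>lborel)"

lemma kernop_measurable [measurable]:
  assumes [measurable]: "F \<in> borel_measurable borel"
  shows "kernop F \<in> borel_measurable borel"
  unfolding kernop_def by measurable

text \<open>\<open>G\<close> is the extremal function of Hoelder's inequality: (H/h)^(p-1) for the
  inner variable and h^(q-1) for the outer one, h being the fibre norm. Finite fibres permit the
  division by h. In this form both exponents are positive, while the merged power h^(q-p) could have
  a negative one.\<close>

lemma mixed_int_dual: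
  assumes p: "1 < p" and pp': "1 / p + 1 / p' = 1" and q: "1 < q" and qq': "1 / q + 1 / q' = 1"
    and [measurable]: "H \<in> borel_measurable borel"
    and fin: "\<And>t. (\<integral>\<^sup>+ x. epowr (H (x, t)) p \<partial>lborel) < top"
  obtains G where "G \<in> borel_measurable borel" "mixed_int p' q' G \<le> mixed_int p q H"
    "mixed_int p q H \<le> (\<integral>\<^sup>+ z. H z * G z \<partial>lborel)"
proof -
  have p': "1 < p'" and q': "1 < q'"
    using conjugate_exponent[OF p pp'] conjugate_exponent[OF q qq'] .
  have ep: "(p - 1) * p' = p" "(q - 1) * q' = q" "p' \<noteq> 0"
  proof -
    have "1 / p' = (p - 1) / p" "1 / q' = (q - 1) / q"
      using pp' qq' p q by (simp_all add: diff_divide_distrib)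
    then show "(p - 1) * p' = p" "(q - 1) * q' = q" using p' q' p q by (auto simp: field_simps)
  qed (use p' in auto)
  define h where "h = (\<lambda>t. epowr (\<integral>\<^sup>+ x. epowr (H (x, t)) p \<partial>lborel) (1 / p))"
  have [measurable]: "h \<in> borel_measurable borel" unfolding h_def by measurable
  have hp: "epowr (h t) p = (\<integral>\<^sup>+ x. epowr (H (x, t)) p \<partial>lborel)" for t
    using p by (simp add: h_def)
  have hfin: "h t < top" for t using fin by (simp add: h_def)
  have N: "mixed_int p q H = (\<integral>\<^sup>+ t. epowr (h t) q \<partial>lborel)"
    by (simp add: mixed_int_def h_def epowr_epowr)
  define G where "G = (\<lambda>z. if h (snd z) = 0 then 0 else epowr (H z * inverse (h (snd z))) (p - 1) * epowr (h (snd z)) (q - 1))"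
  have [measurable]: "G \<in> borel_measurable borel" unfolding G_def by measurable
  have inv: "epowr (inverse (h t)) s * epowr (h t) s = 1" if "h t \<noteq> 0" for t s
    using that hfin[of t] epowr_mult[of "inverse (h t)" "h t" s]
    by (simp add: mult.commute[of "inverse _"] divide_ennreal_def[symmetric] ennreal_divide_self)
  show ?thesis
  proof (rule that)
    have "mixed_int p' q' G \<le> (\<integral>\<^sup>+ t. epowr (epowr (h t) ((q - 1) * p')) (q' / p') \<partial>lborel)"
      unfolding mixed_int_def
    proof (intro nn_integral_mono epowr_mono)
      fix t :: real
      show "(\<integral>\<^sup>+ x. epowr (G (x, t)) p' \<partial>lborel) \<le> epowr (h t) ((q - 1) * p')"
      proof (cases "h t = 0")
        case False
        then have "(\<integral>\<^sup>+ x. epowr (G (x, t)) p' \<partial>lborel) =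
          (\<integral>\<^sup>+ x. epowr (H (x, t)) p * (epowr (inverse (h t)) p * epowr (h t) ((q - 1) * p')) \<partial>lborel)"
          by (simp add: G_def epowr_mult epowr_epowr ep ep[unfolded mult.commute[of _ p']] mult_ac)
        also have "\<dots> = epowr (h t) p * (epowr (inverse (h t)) p * epowr (h t) ((q - 1) * p'))"
          by (subst nn_integral_multc) (auto simp: hp)
        also have "\<dots> = (epowr (inverse (h t)) p * epowr (h t) p) * epowr (h t) ((q - 1) * p')"
          by (simp only: mult_ac)
        finally show ?thesis using inv[OF False] by simp
      qed (simp add: G_def)
    qed (use p' q' in auto)
    also have "\<dots> = mixed_int p q H"
    proof -
      have "(q - 1) * p' * (q' / p') = q" using ep by simp
      then show ?thesis by (simp add: N epowr_epowr)
    qed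
    finally show "mixed_int p' q' G \<le> mixed_int p q H" .
    have "mixed_int p q H \<le> (\<integral>\<^sup>+ t. (\<integral>\<^sup>+ x. H (x, t) * G (x, t) \<partial>lborel) \<partial>lborel)"
      unfolding N
    proof (intro nn_integral_mono)
      fix t :: real
      show "epowr (h t) q \<le> (\<integral>\<^sup>+ x. H (x, t) * G (x, t) \<partial>lborel)"
      proof (cases "h t = 0")
        case False
        have "H (x, t) * G (x, t) = epowr (H (x, t)) p * (epowr (inverse (h t)) (p - 1) * epowr (h t) (q - 1))" for x
          using False epowr_add[of "H (x, t)" 1 "p - 1"] by (simp add: G_def epowr_mult mult_ac)
        then have "(\<integral>\<^sup>+ x. H (x, t) * G (x, t) \<partial>lborel) = epowr (h t) p * (epowr (inverse (h t)) (p - 1) * epowr (h t) (q - 1))"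
          by (simp add: nn_integral_multc hp)
        also have "epowr (h t) p = epowr (h t) 1 * epowr (h t) (p - 1)"
          by (simp only: epowr_add[symmetric]) simp
        also have "epowr (h t) 1 * epowr (h t) (p - 1) * (epowr (inverse (h t)) (p - 1) * epowr (h t) (q - 1)) =
           (epowr (inverse (h t)) (p - 1) * epowr (h t) (p - 1)) * (epowr (h t) 1 * epowr (h t) (q - 1))"
          by (simp only: mult_ac)
        also have "\<dots> = epowr (h t) q"
          unfolding inv[OF False] epowr_add[symmetric] by simp
        finally show ?thesis by simp
      qed simp
    qed
    also have "\<dots> = (\<integral>\<^sup>+ z. H z * G z \<partial>lborel)"
      by (subst nn_integral_lborel_pair(2)) auto
    finally show "mixed_int p q H \<le> (\<integral>\<^sup>+ z. H z * G z \<partial>lborel)" .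
  qed measurable
qed

text \<open>Duality: let N be the mixed integral of the image. Testing against a norming function
  gives N <= C |F| N^(1/q'), where |F| is the mixed norm, and division by N^(1/q') gives the bound.
  The division asks for 0 < N < top, so it is done for truncations, followed by monotone
  convergence.\<close>

theorem kernop_bounded:
  assumes p: "1 < p" and q: "1 < q"
  obtains C :: real where "0 < C"
    "\<And>F. F \<in> borel_measurable borel \<Longrightarrow>
      epowr (mixed_int p q (kernop F)) (1 / q) \<le> ennreal C * epowr (mixed_int p q F) (1 / q)"
proof -
  define p' where "p' = p / (p - 1)"
  define q' where "q' = q / (q - 1)"
  have pp': "1 / p + 1 / p' = 1" and qq': "1 / q + 1 / q' = 1"
    using p q by (simp_all add: p'_def q'_def add_divide_distrib[symmetric])
  obtain C where C: "0 < C"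
    "\<And>F G. F \<in> borel_measurable borel \<Longrightarrow> G \<in> borel_measurable borel \<Longrightarrow>
      mixed_int p q F < top \<Longrightarrow> mixed_int p' q' G < top \<Longrightarrow>
      bilform F G \<le> ennreal C * epowr (mixed_int p q F) (1 / q) * epowr (mixed_int p' q' G) (1 / q')"
    using bilform_mixed[OF p pp' q qq'] by metis
  have q': "1 < q'" using conjugate_exponent[OF q qq'] .
  show ?thesis
  proof (rule that[OF C(1)])
    fix F :: "real \<times> real \<Rightarrow> ennreal"
    assume [measurable]: "F \<in> borel_measurable borel"
    let ?A = "epowr (mixed_int p q F) (1 / q)"
    show "epowr (mixed_int p q (kernop F)) (1 / q) \<le> ennreal C * ?A"
    proof (cases "mixed_int p q F < top")
      case False
      then show ?thesis using C(1) by (simp add: less_top[symmetric] ennreal_mult_top)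
    next
      case fin: True
      \<comment> \<open>Truncation in height and in support: it makes every fibre integral finite,
        as the norming function requires, and also the whole mixed integral.\<close>
      define H where "H = (\<lambda>(n::nat) z. if \<bar>fst z\<bar> \<le> real n \<and> \<bar>snd z\<bar> \<le> real n then min (kernop F z) (of_nat n) else 0)"
      have [measurable]: "H n \<in> borel_measurable borel" for n unfolding H_def by measurable
      have "incseq H"
        unfolding incseq_def le_fun_def H_def by (auto intro: min.coboundedI2 order_trans)
      have sup: "(SUP n. H n z) = kernop F z" for z
      proof (rule antisym)
        show "(SUP n. H n z) \<le> kernop F z" by (intro SUP_least) (auto simp: H_def)
        show "kernop F z \<le> (SUP n. H n z)"
        proof (rule dense_le)
          fix y assume y: "y < kernop F z"
          then have "y < top" using less_le_trans top_greatest by (simp add: order_less_le_trans)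
          then obtain m where m: "y < of_nat m" using ennreal_Ex_less_of_nat[of y] by auto
          obtain k :: nat where k: "\<bar>fst z\<bar> + \<bar>snd z\<bar> \<le> real k" using real_arch_simple by blast
          have "y \<le> H (max m k) z"
          proof -
            have "y \<le> of_nat (max m k)"
              using m by (auto intro!: order_trans[OF less_imp_le[OF m]])
            then show ?thesis using y k by (auto simp: H_def)
          qed
          then show "y \<le> (SUP n. H n z)" by (rule SUP_upper2[rotated]) simp
        qed
      qed
      have bound: "epowr (mixed_int p q (H n)) (1 / q) \<le> ennreal C * ?A" for n
      proof -
        let ?N = "mixed_int p q (H n)"
        have fibre: "(\<integral>\<^sup>+ x. epowr (H n (x, t)) p \<partial>lborel) \<le>
            ennreal (real n powr p * (2 * real n)) * indicator {-real n..real n} t" for t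
        proof -
          have "(\<integral>\<^sup>+ x. epowr (H n (x, t)) p \<partial>lborel) \<le>
            (\<integral>\<^sup>+ x. (epowr (of_nat n) p * indicator {-real n..real n} t) * indicator {-real n..real n} x \<partial>lborel)"
            using p by (intro nn_integral_mono) (auto simp: H_def indicator_def intro!: epowr_mono)
          also have "\<dots> = (epowr (of_nat n) p * indicator {-real n..real n} t) * ennreal (2 * real n)"
            by (subst nn_integral_cmult_indicator) auto
          also have "epowr (of_nat n) p = ennreal (real n powr p)"
            using epowr_ennreal[of "real n" p] by (simp add: ennreal_of_nat_eq_real_of_nat)
          finally show ?thesis by (simp add: ennreal_mult mult_ac)
        qed
        have fin1: "(\<integral>\<^sup>+ x. epowr (H n (x, t)) p \<partial>lborel) < top" for t
          using fibre[of t] by (rule order_le_less_trans) (auto simp: indicator_def)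
        have "?N \<le> (\<integral>\<^sup>+ t. epowr (ennreal (real n powr p * (2 * real n)) * indicator {-real n..real n} t) (q / p) \<partial>lborel)"
          unfolding mixed_int_def using p q by (intro nn_integral_mono epowr_mono fibre) auto
        also have "\<dots> = (\<integral>\<^sup>+ t. epowr (ennreal (real n powr p * (2 * real n))) (q / p) * indicator {-real n..real n} t \<partial>lborel)"
          by (intro nn_integral_cong) (auto simp: indicator_def)
        also have "\<dots> = epowr (ennreal (real n powr p * (2 * real n))) (q / p) * emeasure lborel {-real n..real n}"
          by (rule nn_integral_cmult_indicator) auto
        also have "\<dots> < top" by (auto simp: ennreal_mult_less_top)
        finally have Nfin: "?N < top" .
        obtain G where [measurable]: "G \<in> borel_measurable borel" and G: "mixed_int p' q' G \<le> ?N"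
          "?N \<le> (\<integral>\<^sup>+ z. H n z * G z \<partial>lborel)"
          by (rule mixed_int_dual[OF p pp' q qq', of "H n"]) (auto simp: fin1)
        have "?N \<le> (\<integral>\<^sup>+ z. kernop F z * G z \<partial>lborel)"
          using G(2) by (rule order_trans) (intro nn_integral_mono mult_right_mono, auto simp: H_def)
        also have "\<dots> = bilform F G"
          by (simp add: bilform_def kernop_def nn_integral_multc)
        also have "\<dots> \<le> ennreal C * ?A * epowr (mixed_int p' q' G) (1 / q')"
          using fin G(1) Nfin by (intro C) auto
        also have "\<dots> \<le> ennreal C * ?A * epowr ?N (1 / q')"
          using q' by (intro mult_left_mono epowr_mono G) auto
        finally have "epowr ?N (1 / q + 1 / q') \<le> ennreal C * ?A * epowr ?N (1 / q')"
          by (simp add: qq')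
        then have *: "epowr ?N (1 / q') * epowr ?N (1 / q) \<le> epowr ?N (1 / q') * (ennreal C * ?A)"
          by (simp add: epowr_add mult_ac)
        show ?thesis
        proof (cases "?N = 0")
          case False
          with * Nfin show ?thesis
            by (subst (asm) ennreal_mult_le_mult_iff) auto
        qed simp
      qed
      have "mixed_int p q (kernop F) = (SUP n. mixed_int p q (H n))"
        using mixed_int_SUP[of H p q] \<open>incseq H\<close> p q by (simp add: sup)
      then have "epowr (mixed_int p q (kernop F)) (1 / q) = (SUP n. epowr (mixed_int p q (H n)) (1 / q))"
        using q by (simp add: epowr_SUP)
      also have "\<dots> \<le> ennreal C * ?A" by (intro SUP_least bound)
      finally show ?thesis .
    qed
  qed
qed

subsection \<open>Polar coordinates\<close>

lemma measurable_Complex [measurable (raw)]: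
  assumes [measurable]: "f \<in> borel_measurable M" "g \<in> borel_measurable M"
  shows "(\<lambda>x. Complex (f x) (g x)) \<in> borel_measurable M"
  unfolding Complex_eq by measurable

lemma measurable_cis [measurable (raw)]:
  assumes [measurable]: "f \<in> borel_measurable M"
  shows "(\<lambda>x. cis (f x)) \<in> borel_measurable M"
  unfolding cis.ctr by measurable

text \<open>Lebesgue measure is determined by its values on boxes, and pairing real and imaginary
  part preserves boxes and their areas.\<close>

lemma nn_integral_complex:
  assumes [measurable]: "h \<in> borel_measurable borel"
  shows "(\<integral>\<^sup>+ w. h w \<partial>lborel) = (\<integral>\<^sup>+ x. \<integral>\<^sup>+ y. h (Complex x y) \<partial>lborel \<partial>lborel)"
proof -
  let ?M = "distr (lborel :: (real \<times> real) measure) borel (\<lambda>z. Complex (fst z) (snd z))"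
  have "lborel = ?M"
  proof (rule lborel_eqI)
    fix l u :: complex
    assume le: "\<And>b. b \<in> Basis \<Longrightarrow> l \<bullet> b \<le> u \<bullet> b"
    have "Re l \<le> Re u" "Im l \<le> Im u"
      using le[of 1] le[of \<i>] by (auto simp: Basis_complex_def)
    moreover have "(\<lambda>z. Complex (fst z) (snd z)) -` box l u \<inter> space lborel = box (Re l, Im l) (Re u, Im u)"
      by (auto simp: box_def Basis_complex_def Basis_prod_def)
    ultimately show "emeasure ?M (box l u) = ennreal (\<Prod>b\<in>Basis. (u - l) \<bullet> b)"
      by (subst emeasure_distr) (auto simp: emeasure_lborel_box_eq Basis_complex_def Basis_prod_def prod.union_disjoint)
  qed simp
  then have "(\<integral>\<^sup>+ w. h w \<partial>lborel) = (\<integral>\<^sup>+ w. h w \<partial>?M)" by simp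
  also have "\<dots> = (\<integral>\<^sup>+ z. h (Complex (fst z) (snd z)) \<partial>lborel)"
    by (rule nn_integral_distr) measurable
  also have "\<dots> = (\<integral>\<^sup>+ x. \<integral>\<^sup>+ y. h (Complex x y) \<partial>lborel \<partial>lborel)"
    by (subst nn_integral_lborel_pair(1)) auto
  finally show ?thesis .
qed

text \<open>The substitution rule is for compact intervals. The intervals [-arctan n, arctan n] are
  mapped onto [-c n, c n] and exhaust the open interval, so monotone convergence on both sides
  finishes.\<close>

lemma nn_integral_tan_substitution:
  fixes f :: "real \<Rightarrow> ennreal"
  assumes [measurable]: "f \<in> borel_measurable borel" and c: "0 < c"
  shows "(\<integral>\<^sup>+ x. f x \<partial>lborel) =
    (\<integral>\<^sup>+ s. f (c * tan s) * ennreal (c / (cos s)\<^sup>2) * indicator {-pi/2<..<pi/2} s \<partial>lborel)"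
proof -
  let ?a = "\<lambda>n. arctan (real n)"
  have cos0: "cos s \<noteq> 0" if "\<bar>s\<bar> < pi / 2" for s
  proof -
    have "- (pi / 2) < s" "s < pi / 2" using that by linarith+
    from cos_gt_zero_pi[OF this] show ?thesis by simp
  qed
  have seg: "(\<integral>\<^sup>+ x. f x * indicator {c * tan (- ?a n)..c * tan (?a n)} x \<partial>lborel) =
      (\<integral>\<^sup>+ s. f (c * tan s) * ennreal (c / (cos s)\<^sup>2) * indicator {- ?a n..?a n} s \<partial>lborel)" if "0 < n" for n
  proof (rule nn_integral_substitution_aux)
    show "((\<lambda>s. c * tan s) has_real_derivative c / (cos s)\<^sup>2) (at s)" if "s \<in> {- ?a n..?a n}" for s
    proof -
      have "\<bar>s\<bar> < pi / 2" using that arctan_ubound[of "real n"] by auto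
      from cos0[OF this] show ?thesis by (auto intro!: derivative_eq_intros simp: field_simps)
    qed
    show "continuous_on {- ?a n..?a n} (\<lambda>s. c / (cos s)\<^sup>2)"
      using cos0 arctan_ubound[of "real n"] by (intro continuous_intros) auto
    show "- ?a n < ?a n" using that by simp
  qed (use c in auto)
  have "(\<integral>\<^sup>+ x. f x \<partial>lborel) = (\<integral>\<^sup>+ x. (SUP n. f x * indicator {- c * real (Suc n)..c * real (Suc n)} x) \<partial>lborel)"
  proof (intro nn_integral_cong antisym)
    fix x :: real
    obtain n :: nat where n: "\<bar>x\<bar> / c \<le> real n" using real_arch_simple by blast
    then have "\<bar>x\<bar> \<le> c * real n" using c by (simp add: field_simps)
    also have "\<dots> \<le> c * real (Suc n)" using c by simp
    finally have "f x = f x * indicator {- c * real (Suc n)..c * real (Suc n)} x" by (auto simp: indicator_def)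
    then show "f x \<le> (SUP n. f x * indicator {- c * real (Suc n)..c * real (Suc n)} x)"
      by (intro SUP_upper2[of n]) auto
    show "(SUP n. f x * indicator {- c * real (Suc n)..c * real (Suc n)} x) \<le> f x"
      by (intro SUP_least) (auto simp: indicator_def)
  qed
  also have "\<dots> = (SUP n. (\<integral>\<^sup>+ x. f x * indicator {- c * real (Suc n)..c * real (Suc n)} x \<partial>lborel))"
  proof (rule nn_integral_monotone_convergence_SUP)
    show "incseq (\<lambda>n x. f x * indicator {- c * real (Suc n)..c * real (Suc n)} x)"
    proof (intro incseq_SucI le_funI mult_left_mono)
      fix n x
      have "c * real (Suc n) \<le> c * real (Suc (Suc n))" using c by simp
      then show "indicator {- c * real (Suc n)..c * real (Suc n)} x \<le> (indicator {- c * real (Suc (Suc n))..c * real (Suc (Suc n))} x :: ennreal)"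
        by (auto simp: indicator_def simp del: of_nat_Suc)
    qed auto
  qed measurable
  also have "\<dots> = (SUP n. (\<integral>\<^sup>+ s. f (c * tan s) * ennreal (c / (cos s)\<^sup>2) * indicator {- ?a (Suc n)..?a (Suc n)} s \<partial>lborel))"
    using seg by (auto simp: tan_arctan tan_minus simp del: of_nat_Suc arctan_minus)
  also have "\<dots> = (\<integral>\<^sup>+ s. (SUP n. f (c * tan s) * ennreal (c / (cos s)\<^sup>2) * indicator {- ?a (Suc n)..?a (Suc n)} s) \<partial>lborel)"
  proof (rule nn_integral_monotone_convergence_SUP[symmetric])
    show "incseq (\<lambda>n s. f (c * tan s) * ennreal (c / (cos s)\<^sup>2) * indicator {- ?a (Suc n)..?a (Suc n)} s)"
    proof (intro incseq_SucI le_funI mult_left_mono)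
      fix n s
      have "?a (Suc n) \<le> ?a (Suc (Suc n))" by (simp add: arctan_le_iff)
      then show "indicator {- ?a (Suc n)..?a (Suc n)} s \<le> (indicator {- ?a (Suc (Suc n))..?a (Suc (Suc n))} s :: ennreal)"
        by (auto simp: indicator_def simp del: of_nat_Suc)
    qed auto
  qed (unfold tan_def, measurable)
  also have "\<dots> = (\<integral>\<^sup>+ s. f (c * tan s) * ennreal (c / (cos s)\<^sup>2) * indicator {-pi/2<..<pi/2} s \<partial>lborel)"
  proof (intro nn_integral_cong antisym)
    fix s :: real
    let ?f = "f (c * tan s) * ennreal (c / (cos s)\<^sup>2)"
    show "(SUP n. ?f * indicator {- ?a (Suc n)..?a (Suc n)} s) \<le> ?f * indicator {-pi/2<..<pi/2} s"
    proof (intro SUP_least mult_left_mono)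
      fix n
      show "indicator {- ?a (Suc n)..?a (Suc n)} s \<le> (indicator {-pi/2<..<pi/2} s :: ennreal)"
        using arctan_ubound[of "real (Suc n)"] by (auto simp: indicator_def simp del: of_nat_Suc)
    qed auto
    show "?f * indicator {-pi/2<..<pi/2} s \<le> (SUP n. ?f * indicator {- ?a (Suc n)..?a (Suc n)} s)"
    proof (cases "\<bar>s\<bar> < pi / 2")
      case True
      obtain n :: nat where n: "tan \<bar>s\<bar> \<le> real n" using real_arch_simple by blast
      have "\<bar>s\<bar> = arctan (tan \<bar>s\<bar>)" using True by (intro arctan_tan[symmetric]) auto
      also have "\<dots> \<le> ?a (Suc n)" using n by (simp add: arctan_le_iff)
      finally show ?thesis
        by (intro SUP_upper2[of n]) (auto simp: indicator_def simp del: of_nat_Suc)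
    qed (auto simp: indicator_def)
  qed
  finally show ?thesis .
qed

definition polar_fibre :: "(complex \<Rightarrow> ennreal) \<Rightarrow> real \<Rightarrow> ennreal" where
  "polar_fibre h t = (\<integral>\<^sup>+ r. (if 0 < r then ennreal r * h (of_real r * cis t) else 0) \<partial>lborel)"

lemma polar_fibre_measurable [measurable]:
  assumes [measurable]: "h \<in> borel_measurable borel"
  shows "polar_fibre h \<in> borel_measurable borel"
  unfolding polar_fibre_def by measurable

text \<open>Two one-dimensional substitutions: y = x tan s at fixed x and, after Tonelli, x = r cos
  s at fixed s. Their densities x / cos^2 s and cos s multiply to r.\<close>

lemma nn_integral_right_half_plane:
  assumes [measurable]: "h \<in> borel_measurable borel"
  shows "(\<integral>\<^sup>+ x. (if 0 < x then \<integral>\<^sup>+ y. h (Complex x y) \<partial>lborel else 0) \<partial>lborel) =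
    (\<integral>\<^sup>+ t. polar_fibre h t * indicator {-pi/2<..<pi/2} t \<partial>lborel)"
proof -
  have "(\<integral>\<^sup>+ x. (if 0 < x then \<integral>\<^sup>+ y. h (Complex x y) \<partial>lborel else 0) \<partial>lborel) =
    (\<integral>\<^sup>+ x. (\<integral>\<^sup>+ s. (if 0 < x then h (Complex x (x * (sin s / cos s))) * ennreal (x / (cos s)\<^sup>2) * indicator {-pi/2<..<pi/2} s else 0) \<partial>lborel) \<partial>lborel)"
  proof (intro nn_integral_cong)
    fix x :: real
    show "(if 0 < x then \<integral>\<^sup>+ y. h (Complex x y) \<partial>lborel else 0) =
      (\<integral>\<^sup>+ s. (if 0 < x then h (Complex x (x * (sin s / cos s))) * ennreal (x / (cos s)\<^sup>2) * indicator {-pi/2<..<pi/2} s else 0) \<partial>lborel)"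
      using nn_integral_tan_substitution[of "\<lambda>y. h (Complex x y)" x] by (auto simp: tan_def)
  qed
  also have "\<dots> = (\<integral>\<^sup>+ s. (\<integral>\<^sup>+ x. (if 0 < x then h (Complex x (x * (sin s / cos s))) * ennreal (x / (cos s)\<^sup>2) * indicator {-pi/2<..<pi/2} s else 0) \<partial>lborel) \<partial>lborel)"
    by (rule nn_integral_lborel_swap) measurable
  also have "\<dots> = (\<integral>\<^sup>+ t. polar_fibre h t * indicator {-pi/2<..<pi/2} t \<partial>lborel)"
  proof (intro nn_integral_cong)
    fix s :: real
    let ?g = "\<lambda>x. if 0 < x then h (Complex x (x * (sin s / cos s))) * ennreal (x / (cos s)\<^sup>2) * indicator {-pi/2<..<pi/2} s else 0"
    show "(\<integral>\<^sup>+ x. ?g x \<partial>lborel) = polar_fibre h s * indicator {-pi/2<..<pi/2} s"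
    proof (cases "s \<in> {-pi/2<..<pi/2}")
      case True
      then have c: "0 < cos s" using cos_gt_zero_pi[of s] by auto
      have "(\<integral>\<^sup>+ x. ?g x \<partial>lborel) = ennreal \<bar>cos s\<bar> * (\<integral>\<^sup>+ r. ?g (0 + cos s * r) \<partial>lborel)"
        using c by (intro nn_integral_real_affine) auto
      also have "\<dots> = (\<integral>\<^sup>+ r. ennreal (cos s) * ?g (cos s * r) \<partial>lborel)"
        using c unfolding add_0_left by (subst nn_integral_cmult) auto
      also have "\<dots> = polar_fibre h s"
        unfolding polar_fibre_def
      proof (intro nn_integral_cong)
        fix r :: real
        have "Complex (cos s * r) (cos s * r * (sin s / cos s)) = of_real r * cis s"
          using c by (auto simp: complex_eq_iff)
        moreover have "ennreal (cos s) * ennreal (cos s * r / (cos s)\<^sup>2) = ennreal r" if "0 < r"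
          using c that by (simp add: ennreal_mult[symmetric] power2_eq_square)
        then have "ennreal (cos s) * (a * ennreal (cos s * r / (cos s)\<^sup>2)) = ennreal r * a" if "0 < r" for a
          using that by (simp only: mult.left_commute[of _ a] mult.commute[of _ a])
        ultimately show "ennreal (cos s) * ?g (cos s * r) = (if 0 < r then ennreal r * h (of_real r * cis s) else 0)"
          using True c by (simp add: zero_less_mult_iff)
      qed
      finally show ?thesis using True by simp
    qed (simp add: if_distrib cong: if_cong)
  qed
  finally show ?thesis .
qed

lemma nn_integral_shift:
  assumes [measurable]: "f \<in> borel_measurable borel"
  shows "(\<integral>\<^sup>+ t. f (t + c) \<partial>lborel) = (\<integral>\<^sup>+ t. f t \<partial>(lborel :: real measure))"
  using nn_integral_real_affine[of f 1 c] by (simp add: add.commute)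

text \<open>The left half-plane becomes the right one under w -> -w, which shifts the angle by pi.
  Moving the angles in (-pi/2, 0) by 2 pi then makes the pieces tile [0, 2 pi] up to finitely many
  points.\<close>

theorem nn_integral_polar:
  assumes [measurable]: "h \<in> borel_measurable borel"
  shows "(\<integral>\<^sup>+ w. h w \<partial>lborel) = (\<integral>\<^sup>+ t. polar_fibre h t * indicator {0..2 * pi} t \<partial>lborel)"
proof -
  let ?r = "\<lambda>h x. if 0 < x then \<integral>\<^sup>+ y. h (Complex x y) \<partial>lborel else 0"
  have per: "polar_fibre h (t - 2 * pi) = polar_fibre h t" for t
  proof -
    have "cis (t - 2 * pi) = cis t" by (simp add: complex_eq_iff sin_diff cos_diff)
    then show ?thesis by (simp only: polar_fibre_def)
  qed
  have anti: "polar_fibre (\<lambda>w. h (- w)) (t - pi) = polar_fibre h t" for t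
  proof -
    have "- (of_real r * cis (t - pi)) = of_real r * cis t" for r
      by (simp add: complex_eq_iff sin_diff cos_diff)
    then show ?thesis by (simp only: polar_fibre_def)
  qed
  have "(\<integral>\<^sup>+ w. h w \<partial>lborel) = (\<integral>\<^sup>+ x. (\<integral>\<^sup>+ y. h (Complex x y) \<partial>lborel) \<partial>lborel)"
    by (rule nn_integral_complex) measurable
  also have "\<dots> = (\<integral>\<^sup>+ x. ?r h x + ?r (\<lambda>w. h (- w)) (- x) \<partial>lborel)"
  proof (rule nn_integral_cong_AE)
    have "AE x in lborel. x \<noteq> (0::real)" by (rule AE_lborel_singleton)
    then show "AE x in lborel. (\<integral>\<^sup>+ y. h (Complex x y) \<partial>lborel) = ?r h x + ?r (\<lambda>w. h (- w)) (- x)"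
    proof eventually_elim
      case (elim x)
      have "(\<integral>\<^sup>+ y. h (Complex x y) \<partial>lborel) = (\<integral>\<^sup>+ y. h (Complex x (- y)) \<partial>lborel)"
        using nn_integral_real_affine[of "\<lambda>y. h (Complex x y)" "-1" 0] by simp
      with elim show ?case by (auto simp: Complex_eq)
    qed
  qed
  also have "\<dots> = (\<integral>\<^sup>+ x. ?r h x \<partial>lborel) + (\<integral>\<^sup>+ x. ?r (\<lambda>w. h (- w)) (- x) \<partial>lborel)"
    by (rule nn_integral_add) measurable
  also have "(\<integral>\<^sup>+ x. ?r (\<lambda>w. h (- w)) (- x) \<partial>lborel) = (\<integral>\<^sup>+ x. ?r (\<lambda>w. h (- w)) x \<partial>lborel)"
    using nn_integral_real_affine[of "\<lambda>x. ?r (\<lambda>w. h (- w)) x" "-1" 0]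
    unfolding add_0_left mult_minus1 by simp
  also have "(\<integral>\<^sup>+ x. ?r h x \<partial>lborel) = (\<integral>\<^sup>+ t. polar_fibre h t * indicator {-pi/2<..<pi/2} t \<partial>lborel)"
    by (rule nn_integral_right_half_plane) measurable
  also have "(\<integral>\<^sup>+ x. ?r (\<lambda>w. h (- w)) x \<partial>lborel) =
      (\<integral>\<^sup>+ t. polar_fibre (\<lambda>w. h (- w)) t * indicator {-pi/2<..<pi/2} t \<partial>lborel)"
    by (rule nn_integral_right_half_plane) measurable
  also have "\<dots> = (\<integral>\<^sup>+ t. polar_fibre h t * indicator {pi/2<..<3*pi/2} t \<partial>lborel)"
    by (subst nn_integral_shift[of _ "- pi", symmetric])
      (auto simp: anti intro!: nn_integral_cong, auto simp: indicator_def)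
  also have "(\<integral>\<^sup>+ t. polar_fibre h t * indicator {-pi/2<..<pi/2} t \<partial>lborel) =
      (\<integral>\<^sup>+ t. polar_fibre h t * indicator {0..<pi/2} t + polar_fibre h t * indicator {-pi/2<..<0} t \<partial>lborel)"
    by (intro nn_integral_cong) (auto simp: indicator_def)
  also have "\<dots> = (\<integral>\<^sup>+ t. polar_fibre h t * indicator {0..<pi/2} t \<partial>lborel) + (\<integral>\<^sup>+ t. polar_fibre h t * indicator {-pi/2<..<0} t \<partial>lborel)"
    by (rule nn_integral_add) measurable
  also have "(\<integral>\<^sup>+ t. polar_fibre h t * indicator {-pi/2<..<0} t \<partial>lborel) = (\<integral>\<^sup>+ t. polar_fibre h t * indicator {3*pi/2<..<2*pi} t \<partial>lborel)"
    by (subst nn_integral_shift[of _ "- (2 * pi)", symmetric])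
      (auto simp: per intro!: nn_integral_cong, auto simp: indicator_def)
  also have "(\<integral>\<^sup>+ t. polar_fibre h t * indicator {0..<pi/2} t \<partial>lborel) + (\<integral>\<^sup>+ t. polar_fibre h t * indicator {3*pi/2<..<2*pi} t \<partial>lborel) +
      (\<integral>\<^sup>+ t. polar_fibre h t * indicator {pi/2<..<3*pi/2} t \<partial>lborel) =
    (\<integral>\<^sup>+ t. polar_fibre h t * indicator {0..<pi/2} t + polar_fibre h t * indicator {3*pi/2<..<2*pi} t + polar_fibre h t * indicator {pi/2<..<3*pi/2} t \<partial>lborel)"
    by (simp add: nn_integral_add)
  also have "\<dots> = (\<integral>\<^sup>+ t. polar_fibre h t * indicator {0..2 * pi} t \<partial>lborel)"
  proof (rule nn_integral_cong_AE)
    have "AE t in lborel. t \<noteq> pi / 2 \<and> t \<noteq> 3 * pi / 2 \<and> t \<noteq> 2 * pi"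
      by (intro AE_conjI AE_lborel_singleton)
    then show "AE t in lborel. polar_fibre h t * indicator {0..<pi/2} t + polar_fibre h t * indicator {3*pi/2<..<2*pi} t + polar_fibre h t * indicator {pi/2<..<3*pi/2} t =
      polar_fibre h t * indicator {0..2 * pi} t"
      by eventually_elim (auto simp: indicator_def)
  qed
  finally show ?thesis .
qed

text \<open>The polar density r is positive for r > 0, so a null set of the plane meets almost every
  ray in a null set. Hence \<open>rho\<close> does not depend on the representative.\<close>

lemma AE_polar:
  assumes "AE w in lborel. P w"
  shows "AE t in lborel. 0 \<le> t \<and> t \<le> 2 * pi \<longrightarrow> (AE r in lborel. 0 < r \<longrightarrow> P (of_real r * cis t))"
proof -
  obtain N where N: "{w. \<not> P w} \<subseteq> N" "emeasure lborel N = 0" "N \<in> sets borel"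
    using AE_E[OF assms] by auto
  note [measurable] = N(3)
  have "(\<integral>\<^sup>+ t. polar_fibre (indicator N) t * indicator {0..2 * pi} t \<partial>lborel) = 0"
    by (subst nn_integral_polar[symmetric]) (auto simp: N)
  then have "AE t in lborel. polar_fibre (indicator N) t * indicator {0..2 * pi} t = 0"
    by (subst (asm) nn_integral_0_iff_AE) auto
  then show ?thesis
  proof eventually_elim
    case (elim t)
    show ?case
    proof
      assume "0 \<le> t \<and> t \<le> 2 * pi"
      then have "polar_fibre (indicator N) t = 0" using elim by simp
      then have "AE r in lborel. (if 0 < r then ennreal r * indicator N (of_real r * cis t) else 0) = (0 :: ennreal)"
        unfolding polar_fibre_def by (subst (asm) nn_integral_0_iff_AE) auto
      then show "AE r in lborel. 0 < r \<longrightarrow> P (of_real r * cis t)"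
        by eventually_elim (use N(1) in \<open>auto simp: indicator_def split: if_splits\<close>)
    qed
  qed
qed

subsection \<open>Domination of the Bergman projection\<close>

lemma nn_integral_lebesgue_on:
  assumes "S \<in> sets lebesgue"
  shows "(\<integral>\<^sup>+ x. g x \<partial>lebesgue_on S) = (\<integral>\<^sup>+ x. g x * indicator S x \<partial>lborel)"
  using assms by (simp add: nn_integral_restrict_space nn_integral_completion)

text \<open>The bridge from Lebesgue measurable functions in the theorem to Borel functions in the
  kernel estimates.\<close>

lemma measurable_lebesgue_on_borel_version:
  fixes f :: "complex \<Rightarrow> complex"
  assumes f: "f \<in> borel_measurable (lebesgue_on S)" and S: "S \<in> sets lebesgue"
  obtains f' where "f' \<in> borel_measurable borel" "AE w in lborel. w \<in> S \<longrightarrow> f w = f' w"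
proof -
  define g where "g = (\<lambda>w. indicator S w *\<^sub>R f w)"
  have g: "g \<in> borel_measurable lebesgue"
    using f S unfolding g_def by (subst (asm) borel_measurable_restrict_space_iff) auto
  obtain a where a: "a \<in> borel_measurable lborel" "AE w in lborel. Re (g w) = a w"
    using completion_ex_borel_measurable_real[of "\<lambda>w. Re (g w)" lborel] g by auto
  obtain b where b: "b \<in> borel_measurable lborel" "AE w in lborel. Im (g w) = b w"
    using completion_ex_borel_measurable_real[of "\<lambda>w. Im (g w)" lborel] g by auto
  show ?thesis
  proof (rule that[of "\<lambda>w. Complex (a w) (b w)"])
    show "(\<lambda>w. Complex (a w) (b w)) \<in> borel_measurable borel"
      using a(1) b(1) by (intro measurable_Complex) simp_all
    show "AE w in lborel. w \<in> S \<longrightarrow> f w = Complex (a w) (b w)"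
      using a(2) b(2) by eventually_elim (auto simp: g_def complex_eq_iff)
  qed
qed

text \<open>The first coordinate is the depth 1 - r. Extension by 0 moves the function to the plane
  on which \<open>kern\<close> is translation invariant in the angle.\<close>

definition polar_repr :: "(complex \<Rightarrow> complex) \<Rightarrow> real \<times> real \<Rightarrow> ennreal" where
  "polar_repr f z = (if 0 < fst z \<and> fst z < 1 \<and> 0 \<le> snd z \<and> snd z \<le> 2 * pi
     then ennreal (cmod (f (of_real (1 - fst z) * cis (snd z)))) else 0)"

lemma polar_repr_measurable [measurable]:
  assumes [measurable]: "f \<in> borel_measurable borel"
  shows "polar_repr f \<in> borel_measurable borel"
  unfolding polar_repr_def by measurable

lemma nn_integral_reflect_one:
  assumes [measurable]: "g \<in> borel_measurable borel"
  shows "(\<integral>\<^sup>+ r. g (1 - r) \<partial>lborel) = (\<integral>\<^sup>+ x. g x \<partial>(lborel :: real measure))"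
  using nn_integral_real_affine[of g "-1" 1] by simp

lemma rho_eq_mixed_int:
  assumes [measurable]: "f' \<in> borel_measurable borel"
    and eq: "AE w in lborel. w \<in> disc \<longrightarrow> f w = f' w"
    and p: "0 < p" and q: "0 < q"
  shows "rho p q f = epowr (ennreal (1 / (2 * pi)) * mixed_int p q (polar_repr f')) (1 / q)"
proof -
  have "(\<integral>\<^sup>+ t. epowr (\<integral>\<^sup>+ r. ennreal (cmod (f (of_real r * cis t)) powr p) \<partial>lebesgue_on {0..<1})
                  (q / p) \<partial>lebesgue_on {0..2 * pi}) =
    (\<integral>\<^sup>+ t. epowr (\<integral>\<^sup>+ r. ennreal (cmod (f (of_real r * cis t)) powr p) * indicator {0..<1} r \<partial>lborel)
                  (q / p) * indicator {0..2 * pi} t \<partial>lborel)"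
    by (simp add: nn_integral_lebesgue_on)
  also have "\<dots> = mixed_int p q (polar_repr f')"
    unfolding mixed_int_def
  proof (rule nn_integral_cong_AE)
    show "AE t in lborel. epowr (\<integral>\<^sup>+ r. ennreal (cmod (f (of_real r * cis t)) powr p) * indicator {0..<1} r \<partial>lborel)
                  (q / p) * indicator {0..2 * pi} t = epowr (\<integral>\<^sup>+ x. epowr (polar_repr f' (x, t)) p \<partial>lborel) (q / p)"
      using AE_polar[OF eq]
    proof eventually_elim
      case (elim t)
      show ?case
      proof (cases "0 \<le> t \<and> t \<le> 2 * pi")
        case True
        with elim have "AE r in lborel. 0 < r \<longrightarrow> of_real r * cis t \<in> disc \<longrightarrow> f (of_real r * cis t) = f' (of_real r * cis t)" by simp
        \<comment> \<open>The centre r = 0 belongs to the radial integral of \<open>rho\<close>, but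
          \<open>polar_repr\<close> vanishes at depth 1.\<close>
        moreover have "AE r in lborel. r \<noteq> (0::real)" by (rule AE_lborel_singleton)
        ultimately have "AE r in lborel. ennreal (cmod (f (of_real r * cis t)) powr p) * indicator {0..<1} r =
          epowr (polar_repr f' (1 - r, t)) p"
          by eventually_elim
            (use p True in \<open>auto simp: polar_repr_def indicator_def epowr_ennreal norm_mult\<close>)
        then have "(\<integral>\<^sup>+ r. ennreal (cmod (f (of_real r * cis t)) powr p) * indicator {0..<1} r \<partial>lborel) =
            (\<integral>\<^sup>+ r. epowr (polar_repr f' (1 - r, t)) p \<partial>lborel)"
          by (rule nn_integral_cong_AE)
        also have "\<dots> = (\<integral>\<^sup>+ x. epowr (polar_repr f' (x, t)) p \<partial>lborel)"
          by (rule nn_integral_reflect_one) measurable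
        finally show ?thesis using True by simp
      next
        case False
        then have "polar_repr f' (x, t) = 0" for x by (auto simp: polar_repr_def)
        then show ?thesis using False by simp
      qed
    qed
  qed
  finally show ?thesis by (simp add: rho_def)
qed

lemma nn_integral_disc_polar:
  assumes [measurable]: "g \<in> borel_measurable borel"
  shows "(\<integral>\<^sup>+ w. g w * indicator disc w \<partial>lborel) =
    (\<integral>\<^sup>+ t. \<integral>\<^sup>+ x. (if 0 < x \<and> x < 1 \<and> 0 \<le> t \<and> t \<le> 2 * pi
      then ennreal (1 - x) * g (of_real (1 - x) * cis t) else 0) \<partial>lborel \<partial>lborel)"
proof -
  have [measurable]: "disc \<in> sets borel" by simp
  let ?G = "\<lambda>t x. if 0 < x \<and> x < 1 \<and> 0 \<le> t \<and> t \<le> 2 * pi then ennreal (1 - x) * g (of_real (1 - x) * cis t) else 0"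
  have "(\<integral>\<^sup>+ w. g w * indicator disc w \<partial>lborel) =
    (\<integral>\<^sup>+ t. polar_fibre (\<lambda>w. g w * indicator disc w) t * indicator {0..2 * pi} t \<partial>lborel)"
    by (rule nn_integral_polar) measurable
  also have "\<dots> = (\<integral>\<^sup>+ t. \<integral>\<^sup>+ x. ?G t x \<partial>lborel \<partial>lborel)"
  proof (rule nn_integral_cong)
    fix t :: real
    show "polar_fibre (\<lambda>w. g w * indicator disc w) t * indicator {0..2 * pi} t = (\<integral>\<^sup>+ x. ?G t x \<partial>lborel)"
    proof (cases "0 \<le> t \<and> t \<le> 2 * pi")
      case True
      then have "polar_fibre (\<lambda>w. g w * indicator disc w) t = (\<integral>\<^sup>+ r. ?G t (1 - r) \<partial>lborel)"
        unfolding polar_fibre_def by (intro nn_integral_cong) (auto simp: indicator_def norm_mult)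
      also have "\<dots> = (\<integral>\<^sup>+ x. ?G t x \<partial>lborel)"
        by (rule nn_integral_reflect_one) measurable
      finally show ?thesis using True by simp
    next
      case False
      then have "?G t = (\<lambda>_. 0)" by (auto simp: fun_eq_iff)
      moreover have "indicator {0..2 * pi} t = (0 :: ennreal)" using False by (simp add: indicator_def)
      ultimately show ?thesis by simp
    qed
  qed
  finally show ?thesis .
qed

lemma nn_integral_dA:
  assumes "g \<in> borel_measurable (lebesgue_on disc)"
  shows "(\<integral>\<^sup>+ w. g w \<partial>dA) = ennreal (1 / pi) * (\<integral>\<^sup>+ w. g w * indicator disc w \<partial>lborel)"
  using assms unfolding dA_def
  by (simp add: nn_integral_density nn_integral_cmult nn_integral_lebesgue_on)

lemma nn_integral_dA_norm:
  fixes g g' :: "complex \<Rightarrow> complex"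
  assumes g: "g \<in> borel_measurable (lebesgue_on disc)"
    and eq: "AE w in lborel. w \<in> disc \<longrightarrow> g w = g' w" and [measurable]: "g' \<in> borel_measurable borel"
  shows "(\<integral>\<^sup>+ w. ennreal (cmod (g w)) \<partial>dA) = ennreal (1 / pi) * (\<integral>\<^sup>+ w. ennreal (1 - fst w) * polar_repr g' w \<partial>lborel)"
proof -
  have "(\<integral>\<^sup>+ w. ennreal (cmod (g w)) \<partial>dA) = ennreal (1 / pi) * (\<integral>\<^sup>+ w. ennreal (cmod (g w)) * indicator disc w \<partial>lborel)"
    using g by (intro nn_integral_dA) measurable
  also have "(\<integral>\<^sup>+ w. ennreal (cmod (g w)) * indicator disc w \<partial>lborel) =
      (\<integral>\<^sup>+ w. ennreal (cmod (g' w)) * indicator disc w \<partial>lborel)"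
    by (rule nn_integral_cong_AE) (use eq in \<open>eventually_elim, auto simp: indicator_def\<close>)
  also have "\<dots> = (\<integral>\<^sup>+ w. ennreal (1 - fst w) * polar_repr g' w \<partial>lborel)"
    by (subst nn_integral_disc_polar, measurable, subst nn_integral_lborel_pair(2), measurable)
      (auto simp: polar_repr_def intro!: nn_integral_cong)
  finally show ?thesis .
qed

lemma sets_dA [measurable_cong]: "sets dA = sets (lebesgue_on disc)"
  by (simp add: dA_def)

lemma continuous_measurable_lebesgue_on:
  assumes "continuous_on UNIV (f :: complex \<Rightarrow> complex)"
  shows "f \<in> borel_measurable (lebesgue_on S)"
  using assms by (intro measurable_restrict_space1 measurable_completion)
    (simp add: borel_measurable_continuous_onI)

lemma kernel_integrand_measurable:
  assumes "f \<in> borel_measurable (lebesgue_on disc)"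
  shows "bergman_kernel_integrand f z \<in> borel_measurable (lebesgue_on disc)"
  unfolding bergman_kernel_integrand_def[abs_def]
  by (intro borel_measurable_divide assms continuous_measurable_lebesgue_on continuous_intros)

text \<open>The squared modulus is (1 - a)^2 + 4 a sin^2(t/2). For a >= 1/2 the sine term controls
  t^2; for a < 1/2 the modulus is at least 1/2 while the left side is bounded.\<close>

lemma cmod_one_minus_cis_ge:
  assumes a: "0 \<le> a" "a < 1" and t: "\<bar>t\<bar> \<le> pi"
  shows "((1 - a) + \<bar>t\<bar>)\<^sup>2 \<le> 72 * (cmod (1 - of_real a * cis t))\<^sup>2"
proof -
  have pi4: "pi \<le> 3.2" using pi_approx by simp
  have cm: "(cmod (1 - of_real a * cis t))\<^sup>2 = (1 - a)\<^sup>2 + 4 * a * (sin (t / 2))\<^sup>2"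
  proof -
    have "(cmod (1 - of_real a * cis t))\<^sup>2 = (1 - a * cos t)\<^sup>2 + (a * sin t)\<^sup>2"
      by (simp add: cmod_power2)
    also have "\<dots> = 1 - 2 * a * cos t + a\<^sup>2 * ((sin t)\<^sup>2 + (cos t)\<^sup>2)"
      by (simp only: power2_eq_square) algebra
    also have "\<dots> = (1 - a)\<^sup>2 + 2 * a * (1 - cos (2 * (t / 2)))"
      by (simp add: power2_eq_square algebra_simps)
    also have "cos (2 * (t / 2)) = 1 - 2 * (sin (t / 2))\<^sup>2" by (rule cos_double_sin)
    finally show ?thesis by simp
  qed
  \<comment> \<open>sin u >= u - u^3/6 >= u/2 for 0 <= u <= 1.6, a range that contains
    |t|/2.\<close>
  have s: "\<bar>t\<bar> / 4 \<le> \<bar>sin (t / 2)\<bar>"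
  proof -
    let ?u = "\<bar>t\<bar> / 2"
    have "\<bar>sin ?u - (\<Sum>m<3. sin_coeff m * ?u ^ m)\<bar> \<le> inverse (fact 3) * \<bar>?u\<bar> ^ 3"
      by (rule Maclaurin_sin_bound)
    then have "\<bar>sin ?u - ?u\<bar> \<le> ?u ^ 3 / 6"
      by (simp add: sin_coeff_def eval_nat_numeral)
    moreover have "?u ^ 3 / 6 \<le> ?u / 2"
    proof -
      have "?u * ?u \<le> 1.6 * 1.6" using t pi4 by (intro mult_mono) auto
      then have "?u * (?u * ?u) \<le> ?u * 3" by (intro mult_left_mono) auto
      then show ?thesis by (simp add: power3_eq_cube)
    qed
    ultimately have "\<bar>t\<bar> / 4 \<le> sin ?u" by linarith
    also have "\<dots> \<le> \<bar>sin (t / 2)\<bar>" by (cases "0 \<le> t") auto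
    finally show ?thesis .
  qed
  show ?thesis
  proof (cases "a \<ge> 1 / 2")
    case True
    have "(\<bar>t\<bar> / 4)\<^sup>2 \<le> \<bar>sin (t / 2)\<bar>\<^sup>2" using s by (intro power_mono) auto
    then have s2: "t\<^sup>2 / 16 \<le> (sin (t / 2))\<^sup>2" by (simp add: power_divide)
    have "2 * (sin (t / 2))\<^sup>2 \<le> 4 * a * (sin (t / 2))\<^sup>2" using True by (intro mult_right_mono) auto
    then have "(1 - a)\<^sup>2 + t\<^sup>2 / 8 \<le> (cmod (1 - of_real a * cis t))\<^sup>2" unfolding cm using s2 by linarith
    moreover have "((1 - a) + \<bar>t\<bar>)\<^sup>2 \<le> 2 * ((1 - a)\<^sup>2 + t\<^sup>2)"
      using sum_squares_bound[of "1 - a" "\<bar>t\<bar>"] by (simp add: power2_sum)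
    moreover have "2 * (u + v) \<le> 16 * (u + v / 8)" if "0 \<le> u" for u v :: real
      using that by simp
    moreover have "0 \<le> (1 - a)\<^sup>2" "0 \<le> (cmod (1 - of_real a * cis t))\<^sup>2" by auto
    ultimately show ?thesis by (smt (verit))
  next
    case False
    \<comment> \<open>This case fixes the constant: 4.2^2 = 17.64 is just below 72/4 = 18. The other
      case would allow 16.\<close>
    have "((1 - a) + \<bar>t\<bar>)\<^sup>2 \<le> 4.2\<^sup>2" using a t pi4 by (intro power_mono) auto
    moreover have "(1 / 2)\<^sup>2 \<le> (1 - a)\<^sup>2" using False by (intro power_mono) auto
    moreover have "(1 - a)\<^sup>2 \<le> (cmod (1 - of_real a * cis t))\<^sup>2" unfolding cm using a by auto
    ultimately show ?thesis by (simp add: power2_eq_square)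
  qed
qed

text \<open>For a = (1 - x)(1 - y) one has x + y <= 2 (1 - a), since xy is at most x and at most y;
  squaring gives 288 = 4 * 72. Two angles in [0, 2 pi] come within pi of each other after moving one
  by 0, 2 pi or -2 pi, and summing the three terms avoids a choice.\<close>

lemma bergman_kernel_le_kern:
  assumes x: "0 < x" "x < 1" and y: "0 < y" "y < 1"
    and t: "0 \<le> t" "t \<le> 2 * pi" and s: "0 \<le> s" "s \<le> 2 * pi"
  shows "ennreal (1 / (cmod (1 - (of_real (1 - x) * cis t) * cnj (of_real (1 - y) * cis s)))\<^sup>2) \<le>
    288 * (kern (y, s) (x, t) + kern (y, s) (x, t + 2 * pi) + kern (y, s) (x, t - 2 * pi))"
proof -
  let ?a = "(1 - x) * (1 - y)"
  let ?m = "cmod (1 - (of_real (1 - x) * cis t) * cnj (of_real (1 - y) * cis s))"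
  have "?a \<le> 1 - x" using x y by (intro mult_left_le) auto
  then have a: "0 \<le> ?a" "?a < 1" using x y by (simp, linarith)
  have xy: "x * y \<le> x" "x * y \<le> y" using x y by (simp_all add: mult_left_le mult_left_le_one_le)
  have core: "ennreal (1 / ?m\<^sup>2) \<le> 288 * kern (y, s) (x, t')"
    if t': "t' = t \<or> t' = t + 2 * pi \<or> t' = t - 2 * pi" "\<bar>s - t'\<bar> \<le> pi" for t'
  proof -
    have "cis t' = cis t" using t'(1) by (auto simp: complex_eq_iff sin_diff cos_diff sin_add cos_add)
    moreover have "cis t' * cnj (cis s) = cis (t' - s)"
      by (simp add: cis_cnj cis_mult)
    moreover have "(of_real a * cis t) * cnj (of_real b * cis s) = of_real (a * b) * (cis t * cnj (cis s))" for a b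
      by simp
    ultimately have "(of_real (1 - x) * cis t) * cnj (of_real (1 - y) * cis s) = of_real ?a * cis (t' - s)"
      by (simp only:)
    then have m: "?m = cmod (1 - of_real ?a * cis (t' - s))" by (simp only:)
    have le: "((1 - ?a) + \<bar>t' - s\<bar>)\<^sup>2 \<le> 72 * ?m\<^sup>2"
      unfolding m using a t'(2) by (intro cmod_one_minus_cis_ge) (auto simp: abs_minus_commute)
    have "x + y \<le> 2 * (1 - ?a)" using xy by (simp add: algebra_simps)
    then have "(y + x + \<bar>s - t'\<bar>)\<^sup>2 \<le> (2 * ((1 - ?a) + \<bar>t' - s\<bar>))\<^sup>2"
      using x y by (intro power_mono) (auto simp: abs_minus_commute)
    also have "\<dots> = 4 * ((1 - ?a) + \<bar>t' - s\<bar>)\<^sup>2" by (subst power_mult_distrib) simp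
    also have "\<dots> \<le> 288 * ?m\<^sup>2" using le by linarith
    finally have *: "(y + x + \<bar>s - t'\<bar>)\<^sup>2 \<le> 288 * ?m\<^sup>2" .
    have pos: "0 < (y + x + \<bar>s - t'\<bar>)\<^sup>2" using x y by (intro zero_less_power) auto
    with * have "0 < ?m\<^sup>2" by linarith
    with * pos have "1 / ?m\<^sup>2 \<le> 288 * (1 / (y + x + \<bar>s - t'\<bar>)\<^sup>2)" by (simp add: field_simps)
    then have "ennreal (1 / ?m\<^sup>2) \<le> ennreal (288 * (1 / (y + x + \<bar>s - t'\<bar>)\<^sup>2))" by (rule ennreal_leI)
    also have "\<dots> = ennreal 288 * ennreal (1 / (y + x + \<bar>s - t'\<bar>)\<^sup>2)" by (rule ennreal_mult) auto
    also have "\<dots> = 288 * kern (y, s) (x, t')" using x y by (simp add: kern_def)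
    finally show ?thesis .
  qed
  consider "\<bar>s - t\<bar> \<le> pi" | "\<bar>s - (t + 2 * pi)\<bar> \<le> pi" | "\<bar>s - (t - 2 * pi)\<bar> \<le> pi"
    using t s by linarith
  then show ?thesis
  proof cases
    case 1
    from core[OF _ this] show ?thesis by (rule order_trans) (auto intro!: mult_left_mono simp: add_increasing2)
  next
    case 2
    from core[OF _ this] show ?thesis by (rule order_trans) (auto intro!: mult_left_mono simp: add_increasing2 add_increasing)
  next
    case 3
    from core[OF _ this] show ?thesis by (rule order_trans) (auto intro!: mult_left_mono simp: add_increasing2 add_increasing)
  qed
qed

lemma bergman_le_kernop:
  assumes f: "f \<in> borel_measurable (lebesgue_on disc)"
    and eq: "AE w in lborel. w \<in> disc \<longrightarrow> f w = f' w" and [measurable]: "f' \<in> borel_measurable borel"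
    and x: "0 < x" "x < 1" and t: "0 \<le> t" "t \<le> 2 * pi"
  shows "ennreal (cmod (bergman f (of_real (1 - x) * cis t))) \<le>
    288 * (kernop (polar_repr f') (x, t) + kernop (polar_repr f') (x, t + 2 * pi) + kernop (polar_repr f') (x, t - 2 * pi))"
proof -
  let ?z = "of_real (1 - x) * cis t"
  let ?k = "\<lambda>w. f' w / (1 - ?z * cnj w)\<^sup>2"
  have [measurable]: "?k \<in> borel_measurable borel"
    by (intro borel_measurable_divide borel_measurable_continuous_onI[of "\<lambda>w. (1 - ?z * cnj w)\<^sup>2"] continuous_intros) measurable
  \<comment> \<open>A Bochner integral that does not exist is 0, so the inequality covers that case
    too.\<close>
  have "ennreal (cmod (bergman f ?z)) \<le> (\<integral>\<^sup>+ w. ennreal (cmod (bergman_kernel_integrand f ?z w)) \<partial>dA)"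
    unfolding bergman_def
    by (cases "integrable dA (bergman_kernel_integrand f ?z)")
      (auto simp: not_integrable_integral_eq intro: integral_norm_bound_ennreal)
  also have "\<dots> = ennreal (1 / pi) * (\<integral>\<^sup>+ w. ennreal (1 - fst w) * polar_repr ?k w \<partial>lborel)"
  proof (rule nn_integral_dA_norm[OF kernel_integrand_measurable[OF f]])
    show "AE w in lborel. w \<in> disc \<longrightarrow> bergman_kernel_integrand f ?z w = ?k w"
      using eq by eventually_elim (simp add: bergman_kernel_integrand_def)
  qed measurable
  \<comment> \<open>Both 1/pi and the polar density 1 - y are bounded by 1.\<close>
  also have "\<dots> \<le> 1 * (\<integral>\<^sup>+ w. 288 * (kern w (x, t) * polar_repr f' w + kern w (x, t + 2 * pi) * polar_repr f' w + kern w (x, t - 2 * pi) * polar_repr f' w) \<partial>lborel)"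
  proof (rule mult_mono[OF _ nn_integral_mono])
    fix w :: "real \<times> real"
    obtain y s where w: "w = (y, s)" by force
    show "ennreal (1 - fst w) * polar_repr ?k w \<le>
      288 * (kern w (x, t) * polar_repr f' w + kern w (x, t + 2 * pi) * polar_repr f' w + kern w (x, t - 2 * pi) * polar_repr f' w)"
    proof (cases "0 < y \<and> y < 1 \<and> 0 \<le> s \<and> s \<le> 2 * pi")
      case True
      have "polar_repr ?k w = ennreal (1 / (cmod (1 - ?z * cnj (of_real (1 - y) * cis s)))\<^sup>2) * polar_repr f' w"
        using True by (simp add: w polar_repr_def norm_divide norm_power ennreal_mult[symmetric] mult_ac)
      also have "\<dots> \<le> 288 * (kern w (x, t) + kern w (x, t + 2 * pi) + kern w (x, t - 2 * pi)) * polar_repr f' w"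
        unfolding w using True x t by (intro mult_right_mono bergman_kernel_le_kern) auto
      also have "\<dots> = 288 * (kern w (x, t) * polar_repr f' w + kern w (x, t + 2 * pi) * polar_repr f' w + kern w (x, t - 2 * pi) * polar_repr f' w)"
        by (simp add: distrib_left distrib_right mult_ac)
      finally have *: "polar_repr ?k w \<le> \<dots>" .
      have "ennreal (1 - fst w) * polar_repr ?k w \<le> 1 * polar_repr ?k w"
        using True by (intro mult_right_mono) (auto simp: w)
      with * show ?thesis by simp
    qed (auto simp: w polar_repr_def)
    show "ennreal (1 / pi) \<le> 1" using pi_ge_two by simp
  qed auto
  also have "\<dots> = 288 * (kernop (polar_repr f') (x, t) + kernop (polar_repr f') (x, t + 2 * pi) + kernop (polar_repr f') (x, t - 2 * pi))"
    by (simp add: kernop_def nn_integral_cmult nn_integral_add)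
  finally show ?thesis .
qed

text \<open>A quasi-triangle inequality in place of Minkowski's. \<open>epowr_add_le\<close> is
  applied inside with exponent p, whose constant is then raised to q/p, and outside with exponent
  q/p.\<close>

lemma mixed_int_add_le:
  assumes p: "0 < p" and q: "0 < q" and [measurable]: "A \<in> borel_measurable borel" "B \<in> borel_measurable borel"
  shows "mixed_int p q (\<lambda>z. A z + B z) \<le> ennreal (2 powr q * 2 powr (q / p)) * (mixed_int p q A + mixed_int p q B)"
proof -
  let ?a = "\<lambda>t. \<integral>\<^sup>+ x. epowr (A (x, t)) p \<partial>lborel"
  let ?b = "\<lambda>t. \<integral>\<^sup>+ x. epowr (B (x, t)) p \<partial>lborel"
  have "mixed_int p q (\<lambda>z. A z + B z) \<le>
    (\<integral>\<^sup>+ t. ennreal (2 powr q * 2 powr (q / p)) * (epowr (?a t) (q / p) + epowr (?b t) (q / p)) \<partial>lborel)"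
    unfolding mixed_int_def
  proof (intro nn_integral_mono)
    fix t :: real
    have "(\<integral>\<^sup>+ x. epowr (A (x, t) + B (x, t)) p \<partial>lborel) \<le> (\<integral>\<^sup>+ x. ennreal (2 powr p) * (epowr (A (x, t)) p + epowr (B (x, t)) p) \<partial>lborel)"
      using p by (intro nn_integral_mono epowr_add_le)
    also have "\<dots> = ennreal (2 powr p) * (?a t + ?b t)"
      by (simp add: nn_integral_cmult nn_integral_add)
    finally have "epowr (\<integral>\<^sup>+ x. epowr (A (x, t) + B (x, t)) p \<partial>lborel) (q / p) \<le> epowr (ennreal (2 powr p) * (?a t + ?b t)) (q / p)"
      using p q by (intro epowr_mono) auto
    also have "\<dots> = ennreal (2 powr q) * epowr (?a t + ?b t) (q / p)"
      using p by (simp add: epowr_mult epowr_ennreal powr_powr)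
    also have "\<dots> \<le> ennreal (2 powr q) * (ennreal (2 powr (q / p)) * (epowr (?a t) (q / p) + epowr (?b t) (q / p)))"
      using p q by (intro mult_left_mono epowr_add_le) auto
    finally show "epowr (\<integral>\<^sup>+ x. epowr (A (x, t) + B (x, t)) p \<partial>lborel) (q / p) \<le>
      ennreal (2 powr q * 2 powr (q / p)) * (epowr (?a t) (q / p) + epowr (?b t) (q / p))"
      by (simp add: ennreal_mult mult.assoc)
  qed
  also have "\<dots> = ennreal (2 powr q * 2 powr (q / p)) * (mixed_int p q A + mixed_int p q B)"
    unfolding mixed_int_def by (simp add: nn_integral_cmult nn_integral_add)
  finally show ?thesis .
qed

lemma mixed_int_shift:
  assumes [measurable]: "A \<in> borel_measurable borel"
  shows "mixed_int p q (\<lambda>z. A (fst z, snd z + c)) = mixed_int p q A"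
  unfolding mixed_int_def fst_conv snd_conv
  by (rule nn_integral_shift[of "\<lambda>t. epowr (\<integral>\<^sup>+ x. epowr (A (x, t)) p \<partial>lborel) (q / p)"]) measurable

lemma mixed_int_cmult:
  assumes "p \<noteq> 0" and [measurable]: "A \<in> borel_measurable borel"
  shows "mixed_int p q (\<lambda>z. c * A z) = epowr c q * mixed_int p q A"
  using assms unfolding mixed_int_def by (simp add: epowr_mult nn_integral_cmult epowr_epowr)

lemma mixed_int_mono:
  assumes "\<And>z. A z \<le> B z" "0 < p" "0 < q"
  shows "mixed_int p q A \<le> mixed_int p q B"
  using assms unfolding mixed_int_def by (intro nn_integral_mono epowr_mono) auto

text \<open>Holomorphy is assumed so that \<open>bergman f\<close>, cut off outside the disc, is
  Borel measurable and has a polar representation.\<close>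

lemma rho_bergman_le:
  assumes p: "1 < p" and q: "1 < q"
  obtains C :: real where "\<And>f. f \<in> borel_measurable (lebesgue_on disc) \<Longrightarrow> bergman f holomorphic_on disc \<Longrightarrow>
    rho p q (bergman f) \<le> ennreal C * rho p q f"
proof -
  obtain C where C: "0 < C" "\<And>F. F \<in> borel_measurable borel \<Longrightarrow>
      epowr (mixed_int p q (kernop F)) (1 / q) \<le> ennreal C * epowr (mixed_int p q F) (1 / q)"
    by (rule kernop_bounded[OF p q]) (rule that)
  define k where "k = 2 powr q * 2 powr (q / p)"
  have k: "0 < k" by (simp add: k_def)
  \<comment> \<open>Two applications of the quasi-triangle inequality to three translates with equal
    mixed integrals give k (2k + 1); 288 comes from the kernel comparison.\<close>
  define D where "D = 288 powr q * (k * (k * 2 + 1)) * C powr q"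
  have D: "0 < D" using k C(1) by (simp add: D_def add_pos_pos)
  show ?thesis
  proof (rule that)
    fix f :: "complex \<Rightarrow> complex"
    assume f: "f \<in> borel_measurable (lebesgue_on disc)" and hol: "bergman f holomorphic_on disc"
    obtain f' where [measurable]: "f' \<in> borel_measurable borel" and f': "AE w in lborel. w \<in> disc \<longrightarrow> f w = f' w"
      using measurable_lebesgue_on_borel_version[OF f] by auto
    define P where "P = (\<lambda>z. indicator disc z *\<^sub>R bergman f z)"
    have [measurable]: "P \<in> borel_measurable borel"
      unfolding P_def using holomorphic_on_imp_continuous_on[OF hol] by (intro borel_measurable_continuous_on_indicator) auto
    have P: "AE w in lborel. w \<in> disc \<longrightarrow> bergman f w = P w" by (simp add: P_def)
    define F where "F = polar_repr f'"
    have [measurable]: "F \<in> borel_measurable borel" unfolding F_def by measurable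
    have *: "mixed_int p q (kernop F) \<le> ennreal (C powr q) * mixed_int p q F"
    proof -
      have "epowr (epowr (mixed_int p q (kernop F)) (1 / q)) q \<le> epowr (ennreal C * epowr (mixed_int p q F) (1 / q)) q"
        using q by (intro epowr_mono C(2)) auto
      then show ?thesis using q C(1) by (simp add: epowr_mult epowr_ennreal)
    qed
    have "mixed_int p q (polar_repr P) \<le> mixed_int p q (\<lambda>z. 288 * ((kernop F z + kernop F (fst z, snd z + 2 * pi)) + kernop F (fst z, snd z + - (2 * pi))))"
    proof (rule mixed_int_mono)
      fix z :: "real \<times> real"
      show "polar_repr P z \<le> 288 * ((kernop F z + kernop F (fst z, snd z + 2 * pi)) + kernop F (fst z, snd z + - (2 * pi)))"
      proof (cases "0 < fst z \<and> fst z < 1 \<and> 0 \<le> snd z \<and> snd z \<le> 2 * pi")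
        case True
        have "cmod (of_real (1 - fst z) * cis (snd z)) = \<bar>1 - fst z\<bar>"
          by (simp only: norm_mult norm_cis norm_of_real mult_1_right)
        then have "of_real (1 - fst z) * cis (snd z) \<in> disc" using True by simp
        then show ?thesis using bergman_le_kernop[OF f f', of "fst z" "snd z"] True
          by (simp add: polar_repr_def P_def F_def)
      qed (auto simp: polar_repr_def)
    qed (use p q in auto)
    also have "\<dots> = ennreal (288 powr q) * mixed_int p q (\<lambda>z. (kernop F z + kernop F (fst z, snd z + 2 * pi)) + kernop F (fst z, snd z + - (2 * pi)))"
      using p epowr_ennreal[of 288 q] by (subst mixed_int_cmult) auto
    also have "\<dots> \<le> ennreal (288 powr q) * (ennreal k * (mixed_int p q (\<lambda>z. kernop F z + kernop F (fst z, snd z + 2 * pi)) +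
        mixed_int p q (\<lambda>z. kernop F (fst z, snd z + - (2 * pi)))))"
      unfolding k_def using p q by (intro mult_left_mono mixed_int_add_le) auto
    also have "\<dots> \<le> ennreal (288 powr q) * (ennreal k * (ennreal k * (mixed_int p q (kernop F) + mixed_int p q (\<lambda>z. kernop F (fst z, snd z + 2 * pi))) +
        mixed_int p q (\<lambda>z. kernop F (fst z, snd z + - (2 * pi)))))"
      unfolding k_def using p q by (intro mult_left_mono add_right_mono mixed_int_add_le) auto
    also have "\<dots> = ennreal (288 powr q) * (ennreal k * (ennreal k * 2 + 1)) * mixed_int p q (kernop F)"
    proof -
      have "a * (b * (b * (m + m) + m)) = a * (b * (b * 2 + 1)) * m" for a b m :: ennreal
      proof -
        have "b * (m + m) + m = (b * 2 + 1) * m"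
          by (simp only: distrib_right mult_1 mult.assoc mult_2[symmetric])
        then show ?thesis by (simp only: mult.assoc)
      qed
      then show ?thesis by (simp only: mixed_int_shift[OF kernop_measurable[OF \<open>F \<in> borel_measurable borel\<close>]])
    qed
    also have "\<dots> \<le> ennreal (288 powr q) * (ennreal k * (ennreal k * 2 + 1)) * (ennreal (C powr q) * mixed_int p q F)"
      by (intro mult_left_mono *) auto
    also have "\<dots> = ennreal D * mixed_int p q F"
      using k by (simp add: D_def ennreal_mult add_nonneg_nonneg mult_ac)
    finally have "epowr (ennreal (1 / (2 * pi)) * mixed_int p q (polar_repr P)) (1 / q) \<le>
      epowr (ennreal (1 / (2 * pi)) * (ennreal D * mixed_int p q F)) (1 / q)"
      using q by (intro epowr_mono mult_left_mono) auto
    also have "\<dots> = ennreal (D powr (1 / q)) * epowr (ennreal (1 / (2 * pi)) * mixed_int p q F) (1 / q)"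
      using D by (simp add: epowr_mult epowr_ennreal mult_ac)
    finally show "rho p q (bergman f) \<le> ennreal (D powr (1 / q)) * rho p q f"
      using p q by (simp add: rho_eq_mixed_int[OF _ P] rho_eq_mixed_int[OF _ f'] F_def)
  qed
qed

subsection \<open>Power series and the reproducing property\<close>

lemma nn_integral_holder_indicator:
  assumes p: "1 < p" and [measurable]: "f \<in> borel_measurable M" "A \<in> sets M"
  shows "(\<integral>\<^sup>+ x. f x * indicator A x \<partial>M) \<le> epowr (\<integral>\<^sup>+ x. epowr (f x) p \<partial>M) (1 / p) * epowr (emeasure M A) (1 - 1 / p)"
proof -
  let ?p' = "1 / (1 - 1 / p)"
  have "(\<integral>\<^sup>+ x. f x * indicator A x \<partial>M) \<le>
    epowr (\<integral>\<^sup>+ x. epowr (f x) p \<partial>M) (1 / p) * epowr (\<integral>\<^sup>+ x. epowr (indicator A x) ?p' \<partial>M) (1 / ?p')"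
    by (rule nn_integral_holder[OF p]) auto
  also have "(\<integral>\<^sup>+ x. epowr (indicator A x) ?p' \<partial>M) = (\<integral>\<^sup>+ x. indicator A x \<partial>M)"
    by (intro nn_integral_cong) (auto simp: indicator_def)
  finally show ?thesis by simp
qed

lemma measurable_dA_iff: "f \<in> borel_measurable dA \<longleftrightarrow> f \<in> borel_measurable (lebesgue_on disc)"
  by (simp only: measurable_cong_sets[OF sets_dA refl])

text \<open>Hoelder against the constant 1, first in the radius and then in the angle, both of which
  range over bounded intervals.\<close>

lemma LqLp_integrable_dA:
  assumes p: "1 < p" and q: "1 < q" and f: "f \<in> LqLp p q"
  shows "integrable dA f"
proof -
  have meas: "f \<in> borel_measurable (lebesgue_on disc)" and rho: "rho p q f < \<infinity>"
    using f by (auto simp: LqLp_def)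
  obtain f' where [measurable]: "f' \<in> borel_measurable borel" and f': "AE w in lborel. w \<in> disc \<longrightarrow> f w = f' w"
    using measurable_lebesgue_on_borel_version[OF meas] by auto
  define F where "F = polar_repr f'"
  have [measurable]: "F \<in> borel_measurable borel" unfolding F_def by measurable
  have "ennreal (1 / (2 * pi)) * mixed_int p q F < top"
    using rho p q by (simp add: rho_eq_mixed_int[OF _ f'] F_def)
  then have fin: "mixed_int p q F < top"
    by (auto simp: less_top[symmetric] ennreal_mult_eq_top_iff)
  let ?P = "\<lambda>t. \<integral>\<^sup>+ x. epowr (F (x, t)) p \<partial>lborel"
  have "(\<integral>\<^sup>+ w. ennreal (cmod (f w)) \<partial>dA) = ennreal (1 / pi) * (\<integral>\<^sup>+ w. ennreal (1 - fst w) * F w \<partial>lborel)"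
    unfolding F_def by (rule nn_integral_dA_norm[OF meas f']) measurable
  also have "\<dots> \<le> ennreal (1 / pi) * (\<integral>\<^sup>+ w. F w \<partial>lborel)"
  proof (intro mult_left_mono nn_integral_mono)
    fix w :: "real \<times> real"
    show "ennreal (1 - fst w) * F w \<le> F w"
    proof (cases "0 < fst w")
      case True
      then have "ennreal (1 - fst w) * F w \<le> 1 * F w" by (intro mult_right_mono) auto
      then show ?thesis by simp
    qed (simp add: F_def polar_repr_def)
  qed auto
  also have "(\<integral>\<^sup>+ w. F w \<partial>lborel) = (\<integral>\<^sup>+ t. (\<integral>\<^sup>+ x. F (x, t) * indicator {0..1} x \<partial>lborel) * indicator {0..2 * pi} t \<partial>lborel)"
    by (subst nn_integral_lborel_pair(2), measurable)
      (auto intro!: nn_integral_cong simp: F_def polar_repr_def indicator_def)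
  also have "\<dots> \<le> (\<integral>\<^sup>+ t. epowr (?P t) (1 / p) * indicator {0..2 * pi} t \<partial>lborel)"
  proof (intro nn_integral_mono mult_right_mono)
    fix t :: real
    have "(\<integral>\<^sup>+ x. F (x, t) * indicator {0..1} x \<partial>lborel) \<le> epowr (?P t) (1 / p) * epowr (emeasure lborel {0..1::real}) (1 - 1 / p)"
      by (rule nn_integral_holder_indicator[OF p]) auto
    then show "(\<integral>\<^sup>+ x. F (x, t) * indicator {0..1} x \<partial>lborel) \<le> epowr (?P t) (1 / p)" by simp
  qed auto
  also have "\<dots> \<le> epowr (\<integral>\<^sup>+ t. epowr (epowr (?P t) (1 / p)) q \<partial>lborel) (1 / q) * epowr (emeasure lborel {0..2 * pi}) (1 - 1 / q)"
    by (rule nn_integral_holder_indicator[OF q]) auto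
  also have "\<dots> = epowr (mixed_int p q F) (1 / q) * epowr (ennreal (2 * pi)) (1 - 1 / q)"
    by (simp add: mixed_int_def epowr_epowr)
  finally have "(\<integral>\<^sup>+ w. ennreal (cmod (f w)) \<partial>dA) \<le> ennreal (1 / pi) * (epowr (mixed_int p q F) (1 / q) * epowr (ennreal (2 * pi)) (1 - 1 / q))"
    by (simp add: mult_left_mono)
  also have "\<dots> < \<infinity>" using fin by (simp add: ennreal_mult_less_top epowr_ennreal)
  finally show ?thesis
    using meas by (intro integrableI_bounded) (simp_all only: measurable_dA_iff)
qed

lemma space_dA [simp]: "space dA = disc"
  by (simp add: dA_def)

lemma continuous_measurable_dA:
  assumes "continuous_on UNIV (f :: complex \<Rightarrow> complex)"
  shows "f \<in> borel_measurable dA"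
  using continuous_measurable_lebesgue_on[OF assms, of disc] by (simp only: measurable_dA_iff)

lemma integrable_dA_mult_bounded:
  fixes f k :: "complex \<Rightarrow> complex"
  assumes f: "integrable dA f" and k: "k \<in> borel_measurable dA" and b: "\<And>w. w \<in> disc \<Longrightarrow> cmod (k w) \<le> B"
  shows "integrable dA (\<lambda>w. k w * f w)"
proof (rule Bochner_Integration.integrable_bound)
  show "integrable dA (\<lambda>w. B *\<^sub>R f w)" using f by simp
  show "(\<lambda>w. k w * f w) \<in> borel_measurable dA" using k f by simp
  have "cmod (k w * f w) \<le> \<bar>B\<bar> * cmod (f w)" if "w \<in> disc" for w
    unfolding norm_mult using b[OF that] by (intro mult_right_mono) auto
  then show "AE w in dA. cmod (k w * f w) \<le> norm (B *\<^sub>R f w)" by (intro AE_I2) simp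
qed

lemma bergman_kernel_bound:
  assumes z: "z \<in> disc" and w: "w \<in> disc"
  shows "cmod (1 / (1 - z * cnj w)\<^sup>2) \<le> 1 / (1 - cmod z)\<^sup>2"
proof -
  have "cmod (z * cnj w) \<le> cmod z * 1" unfolding norm_mult using w by (intro mult_left_mono) auto
  moreover have "1 - cmod (z * cnj w) \<le> cmod (1 - z * cnj w)"
    using norm_triangle_ineq2[of 1 "z * cnj w"] by simp
  ultimately have "1 - cmod z \<le> cmod (1 - z * cnj w)" by simp
  then have "(1 - cmod z)\<^sup>2 \<le> (cmod (1 - z * cnj w))\<^sup>2" using z by (intro power_mono) auto
  moreover have "0 < (1 - cmod z)\<^sup>2" using z by simp
  ultimately show ?thesis by (simp add: norm_divide norm_power frac_le)
qed

lemma integrable_bergman_kernel_integrand: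
  assumes f: "integrable dA f" and z: "z \<in> disc"
  shows "integrable dA (bergman_kernel_integrand f z)"
proof -
  have "integrable dA (\<lambda>w. (1 / (1 - z * cnj w)\<^sup>2) * f w)"
  proof (rule integrable_dA_mult_bounded[OF f _ bergman_kernel_bound[OF z]])
    show "(\<lambda>w. 1 / (1 - z * cnj w)\<^sup>2) \<in> borel_measurable dA"
      by (intro borel_measurable_divide continuous_measurable_dA continuous_intros)
  qed
  then show ?thesis by (simp add: bergman_kernel_integrand_def[abs_def])
qed

text \<open>Termwise integration of 1/(1 - u)^2, the sum of (n + 1) u^n, at u = z
  \<open>cnj w\<close>, dominated by (n + 1) |z|^n |f|. This yields holomorphy and shows the Taylor
  coefficients to be n + 1 times the moments of f.\<close>

lemma bergman_power_series:
  assumes f: "integrable dA f" and z: "z \<in> disc"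
  shows "(\<lambda>n. (of_nat (Suc n) * (\<integral>w. cnj w ^ n * f w \<partial>dA)) * z ^ n) sums bergman f z"
proof -
  let ?g = "\<lambda>n w. (of_nat (Suc n) * (z * cnj w) ^ n) * f w"
  have cn: "(\<lambda>w. of_nat (Suc n) * (z * cnj w) ^ n) \<in> borel_measurable dA" for n
    by (intro continuous_measurable_dA continuous_intros)
  have bd: "cmod (of_nat (Suc n) * (z * cnj w) ^ n) \<le> real (Suc n) * cmod z ^ n" if "w \<in> disc" for n w
  proof -
    have "cmod (z * cnj w) ^ n \<le> cmod z ^ n"
      using that by (intro power_mono) (auto simp: norm_mult mult_left_le)
    then show ?thesis unfolding norm_mult norm_power norm_of_nat by (intro mult_left_mono) (auto simp: norm_mult)
  qed
  have int: "integrable dA (?g n)" for n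
    by (rule integrable_dA_mult_bounded[OF f cn bd])
  have lt: "cmod (z * cnj w) < 1" if "w \<in> disc" for w
  proof -
    have "cmod (z * cnj w) \<le> cmod z * 1" unfolding norm_mult using that by (intro mult_left_mono) auto
    then show ?thesis using z by simp
  qed
  have "(\<lambda>n. \<integral>w. ?g n w \<partial>dA) sums (\<integral>w. (\<Sum>n. ?g n w) \<partial>dA)"
  proof (rule sums_integral[OF int])
    show "AE w in dA. summable (\<lambda>n. cmod (?g n w))"
    proof (rule AE_I2)
      fix w assume "w \<in> space dA"
      then have "(\<lambda>n. real (Suc n) * cmod (z * cnj w) ^ n) sums (1 / (1 - cmod (z * cnj w))\<^sup>2)"
        using geometric_deriv_sums[of "cmod (z * cnj w)"] lt[of w] by simp
      then have "summable (\<lambda>n. (real (Suc n) * cmod (z * cnj w) ^ n) * cmod (f w))"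
        by (intro summable_mult2) (rule sums_summable)
      then show "summable (\<lambda>n. cmod (?g n w))"
        by (simp only: norm_mult norm_power norm_of_nat)
    qed
    have "summable (\<lambda>n. (real (Suc n) * cmod z ^ n) * (\<integral>w. cmod (f w) \<partial>dA))"
      using geometric_deriv_sums[of "cmod z"] z by (intro summable_mult2) (simp add: sums_iff)
    then show "summable (\<lambda>n. \<integral>w. cmod (?g n w) \<partial>dA)"
    proof (rule summable_comparison_test')
      fix n :: nat
      have "(\<integral>w. cmod (?g n w) \<partial>dA) \<le> (\<integral>w. (real (Suc n) * cmod z ^ n) * cmod (f w) \<partial>dA)"
      proof (rule integral_mono)
        show "cmod (?g n w) \<le> (real (Suc n) * cmod z ^ n) * cmod (f w)" if "w \<in> space dA" for w
          unfolding norm_mult[of _ "f w"] using bd[of w n] that by (intro mult_right_mono) auto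
      qed (use int f in auto)
      then show "norm (\<integral>w. cmod (?g n w) \<partial>dA) \<le> (real (Suc n) * cmod z ^ n) * (\<integral>w. cmod (f w) \<partial>dA)"
        by (simp add: integral_nonneg_AE)
    qed
  qed
  moreover have "(\<integral>w. (\<Sum>n. ?g n w) \<partial>dA) = bergman f z"
    unfolding bergman_def
  proof (rule Bochner_Integration.integral_cong)
    fix w assume "w \<in> space dA"
    then have "(\<lambda>n. of_nat (Suc n) * (z * cnj w) ^ n * f w) sums (1 / (1 - z * cnj w)\<^sup>2 * f w)"
      using geometric_deriv_sums[of "z * cnj w"] lt[of w] by (intro sums_mult2) simp
    then show "(\<Sum>n. ?g n w) = bergman_kernel_integrand f z w"
      by (simp only: sums_iff bergman_kernel_integrand_def) simp
  qed simp
  moreover have "(\<integral>w. ?g n w \<partial>dA) = (of_nat (Suc n) * (\<integral>w. cnj w ^ n * f w \<partial>dA)) * z ^ n" for n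
  proof -
    have "(\<integral>w. ?g n w \<partial>dA) = (\<integral>w. (of_nat (Suc n) * z ^ n) * (cnj w ^ n * f w) \<partial>dA)"
      by (intro Bochner_Integration.integral_cong) (simp_all add: power_mult_distrib mult_ac)
    also have "\<dots> = (of_nat (Suc n) * z ^ n) * (\<integral>w. cnj w ^ n * f w \<partial>dA)"
      by (rule integral_mult_right_zero)
    finally show ?thesis by (simp add: mult_ac)
  qed
  ultimately show ?thesis by simp
qed

lemma bergman_holomorphic:
  assumes "integrable dA f"
  shows "bergman f holomorphic_on disc"
  using bergman_power_series[OF assms]
  by (intro power_series_holomorphic[of 0 1 "\<lambda>n. of_nat (Suc n) * (\<integral>w. cnj w ^ n * f w \<partial>dA)"]) simp

text \<open>The earlier polar formula is for nonnegative integrands. Applied to sets, it identifies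
  a measure as an image measure, and Bochner integrals can then be transported. The inner integral
  runs over a circle, ready for Fourier orthogonality.\<close>

lemma integral_dA_polar:
  fixes h :: "complex \<Rightarrow> complex"
  assumes [measurable]: "h \<in> borel_measurable borel" and int: "integrable dA h"
  shows "(\<integral>w. h w \<partial>dA) = (\<integral>x. (\<integral>t. (if 0 < x \<and> x < 1 \<and> 0 \<le> t \<and> t \<le> 2 * pi
     then ((1 - x) / pi) *\<^sub>R h (of_real (1 - x) * cis t) else 0) \<partial>lborel) \<partial>lborel)"
proof -
  have [measurable]: "disc \<in> sets borel" by simp
  let ?M = "density lborel (\<lambda>w. ennreal (indicator disc w / pi))"
  define W where "W = (\<lambda>z :: real \<times> real. if 0 < fst z \<and> fst z < 1 \<and> 0 \<le> snd z \<and> snd z \<le> 2 * pi then (1 - fst z) / pi else 0)"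
  have W0: "0 \<le> W z" for z by (simp add: W_def)
  have [measurable]: "W \<in> borel_measurable borel" unfolding W_def by measurable
  let ?ph = "\<lambda>z. of_real (1 - fst z) * cis (snd z)"
  \<comment> \<open>\<open>?M\<close> is the Borel counterpart of \<open>dA\<close>, and
    \<open>W\<close> is the polar density including 1/pi.\<close>
  have M: "?M = distr (density lborel (\<lambda>z. ennreal (W z))) borel ?ph"
  proof (rule measure_eqI)
    fix A assume "A \<in> sets ?M"
    then have [measurable]: "A \<in> sets borel" by simp
    have "emeasure ?M A = (\<integral>\<^sup>+ w. (ennreal (1 / pi) * indicator A w) * indicator disc w \<partial>lborel)"
      by (subst emeasure_density) (auto intro!: nn_integral_cong simp: indicator_def)
    also have "\<dots> = (\<integral>\<^sup>+ z. ennreal (W z) * indicator A (?ph z) \<partial>lborel)"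
      by (subst nn_integral_disc_polar, measurable, subst nn_integral_lborel_pair(2), measurable)
        (auto simp: W_def ennreal_mult[symmetric] mult.assoc[symmetric] intro!: nn_integral_cong)
    also have "\<dots> = emeasure (distr (density lborel (\<lambda>z. ennreal (W z))) borel ?ph) A"
      by (subst emeasure_distr, measurable, subst emeasure_density, measurable)
        (auto simp: indicator_def intro!: nn_integral_cong)
    finally show "emeasure ?M A = emeasure (distr (density lborel (\<lambda>z. ennreal (W z))) borel ?ph) A" .
  qed simp
  have hdisc: "(\<lambda>w. indicator disc w *\<^sub>R ((1 / pi) *\<^sub>R h w)) \<in> borel_measurable lborel" by measurable
  have hl: "h \<in> borel_measurable (lebesgue_on disc)"
    by (intro measurable_restrict_space1 measurable_completion) simp
  have int1: "integrable lborel (\<lambda>w. indicator disc w *\<^sub>R ((1 / pi) *\<^sub>R h w))"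
  proof -
    have "integrable (lebesgue_on disc) (\<lambda>w. (1 / pi) *\<^sub>R h w)"
      using int hl unfolding dA_def by (subst (asm) integrable_density) auto
    then have "integrable lebesgue (\<lambda>w. indicator disc w *\<^sub>R ((1 / pi) *\<^sub>R h w))"
      by (subst (asm) integrable_restrict_space) auto
    then show ?thesis by (subst (asm) integrable_completion[OF hdisc])
  qed
  have "integrable ?M h"
  proof -
    have "(\<lambda>w. (indicator disc w / pi) *\<^sub>R h w) = (\<lambda>w. indicator disc w *\<^sub>R ((1 / pi) *\<^sub>R h w))"
      by (simp add: fun_eq_iff)
    then show ?thesis
      using int1 by (subst integrable_density) (simp_all del: scaleR_scaleR)
  qed
  then have "integrable (density lborel (\<lambda>z. ennreal (W z))) (\<lambda>z. h (?ph z))"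
    unfolding M by (subst (asm) integrable_distr_eq) auto
  then have int2: "integrable lborel (\<lambda>z. W z *\<^sub>R h (?ph z))"
    by (subst (asm) integrable_density) (auto simp: W0)
  have "(\<integral>w. h w \<partial>dA) = (\<integral>w. (1 / pi) *\<^sub>R h w \<partial>lebesgue_on disc)"
    unfolding dA_def using hl by (subst integral_density) auto
  also have "\<dots> = (\<integral>w. indicator disc w *\<^sub>R ((1 / pi) *\<^sub>R h w) \<partial>lebesgue)"
    by (rule integral_restrict_space) auto
  also have "\<dots> = (\<integral>w. indicator disc w *\<^sub>R ((1 / pi) *\<^sub>R h w) \<partial>lborel)"
    by (rule integral_completion[OF hdisc])
  also have "\<dots> = (\<integral>w. h w \<partial>?M)"
    by (subst integral_density) (auto intro!: Bochner_Integration.integral_cong)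
  also have "\<dots> = (\<integral>z. h (?ph z) \<partial>density lborel (\<lambda>z. ennreal (W z)))"
    unfolding M by (subst integral_distr) auto
  also have "\<dots> = (\<integral>z. W z *\<^sub>R h (?ph z) \<partial>lborel)"
    by (subst integral_density) (auto simp: W0)
  also have "\<dots> = (\<integral>x. (\<integral>t. W (x, t) *\<^sub>R h (?ph (x, t)) \<partial>lborel) \<partial>lborel)"
    using lborel_pair.integral_fst'[of "\<lambda>z. W z *\<^sub>R h (?ph z)"] int2 by (simp add: lborel_prod)
  also have "\<dots> = (\<integral>x. (\<integral>t. (if 0 < x \<and> x < 1 \<and> 0 \<le> t \<and> t \<le> 2 * pi
     then ((1 - x) / pi) *\<^sub>R h (of_real (1 - x) * cis t) else 0) \<partial>lborel) \<partial>lborel)"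
    by (intro Bochner_Integration.integral_cong) (auto simp: W_def)
  finally show ?thesis .
qed

section \<open>Orthogonality on circles and moments of holomorphic functions\<close>

lemma integral_cis_multiple:
  fixes m :: int
  shows "(\<integral>t. indicator {0..2 * pi} t *\<^sub>R cis (of_int m * t) \<partial>lborel) = (if m = 0 then of_real (2 * pi) else 0)"
proof (cases "m = 0")
  case True
  have "(\<integral>t. indicator {0..2 * pi} t *\<^sub>R (1::complex) \<partial>lborel) = of_real (2 * pi)"
    by (simp add: scaleR_conv_of_real)
  then show ?thesis using True by simp
next
  case False
  define F where "F = (\<lambda>t. cis (of_int m * t) / (\<i> * of_int m))"
  have "(\<integral>t. indicator {0..2 * pi} t *\<^sub>R cis (of_int m * t) \<partial>lborel) = F (2 * pi) - F 0"
  proof (rule integral_FTC_Icc)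
    show "(F has_vector_derivative cis (of_int m * t)) (at t within {0..2 * pi})" for t
    proof -
      have "((\<lambda>z. exp (\<i> * of_int m * z) / (\<i> * of_int m)) has_field_derivative exp (\<i> * of_int m * of_real t)) (at (of_real t))"
        using False by (auto intro!: derivative_eq_intros)
      then have "((\<lambda>t. exp (\<i> * of_int m * of_real t) / (\<i> * of_int m)) has_vector_derivative exp (\<i> * of_int m * of_real t)) (at t within {0..2 * pi})"
        by (rule has_vector_derivative_real_field)
      then show ?thesis by (simp add: F_def cis_conv_exp mult.assoc)
    qed
    show "continuous_on {0..2 * pi} (\<lambda>t. cis (of_int m * t))"
      by (intro continuous_intros)
  qed simp
  also have "\<dots> = 0"
    using cis_multiple_2pi[of "of_int m"] by (simp add: F_def mult.commute)
  finally show ?thesis using False by simp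
qed

text \<open>Multiplied by the n-th power of the conjugate, the k-th Taylor term becomes a multiple
  of e^(i(k-n)t), so only k = n survives, with the factor r^(2n).\<close>

lemma circle_coefficient:
  assumes g: "g holomorphic_on disc" and r: "0 < r" "r < 1"
  shows "(\<integral>t. indicator {0..2 * pi} t *\<^sub>R (cnj (of_real r * cis t) ^ n * g (of_real r * cis t)) \<partial>lborel) =
    of_real (2 * pi * r ^ (2 * n)) * ((deriv ^^ n) g 0 / fact n)"
proof -
  define a where "a = (\<lambda>k. (deriv ^^ k) g 0 / fact k)"
  have ps: "(\<lambda>k. a k * w ^ k) sums g w" if "w \<in> disc" for w
    using holomorphic_power_series[OF g that] by (simp add: a_def)
  have rt: "of_real r * cis t \<in> disc" for t using r by (simp add: norm_mult)
  let ?f = "\<lambda>k t. (a k * of_real (r ^ (k + n))) * (indicator {0..2 * pi} t *\<^sub>R cis (of_int (int k - int n) * t))"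
  have term_eq: "?f k t = indicator {0..2 * pi} t *\<^sub>R (cnj (of_real r * cis t) ^ n * (a k * (of_real r * cis t) ^ k))" for k t
  proof -
    have "cis (of_int (int k - int n) * t) = cis t ^ k * cis (- t) ^ n"
      by (simp add: Complex.DeMoivre cis_mult left_diff_distrib)
    then show ?thesis
      by (simp only:) (simp add: power_mult_distrib cis_cnj power_add scaleR_conv_of_real mult_ac)
  qed
  have intc: "integrable lborel (\<lambda>t. indicator {0..2 * pi} t *\<^sub>R cis (of_int m * t))" for m
    by (rule borel_integrable_compact) (auto intro!: continuous_intros)
  have summ: "summable (\<lambda>k. norm (a k * of_real (r ^ (k + n))))"
  proof -
    \<comment> \<open>Convergence at a larger radius still inside the disc gives absolute
      convergence at r.\<close>
    obtain r' where r': "r < r'" "r' < 1" using r dense by blast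
    have "summable (\<lambda>k. a k * of_real r' ^ k)"
      using ps[of "of_real r'"] r r' by (auto simp: sums_iff)
    then have "summable (\<lambda>k. norm (a k * of_real r ^ k))"
      by (rule powser_insidea) (use r r' in auto)
    then have "summable (\<lambda>k. norm (a k * of_real r ^ k) * r ^ n)" by (rule summable_mult2)
    then show ?thesis using r by (simp add: norm_mult norm_power power_add mult_ac)
  qed
  have normc: "norm (indicator {0..2 * pi} t *\<^sub>R cis s) = indicator {0..2 * pi} t" for t s
    by (simp add: indicator_def)
  have "(\<lambda>k. \<integral>t. ?f k t \<partial>lborel) sums (\<integral>t. (\<Sum>k. ?f k t) \<partial>lborel)"
  proof (rule sums_integral)
    show "integrable lborel (?f k)" for k by (intro integrable_mult_right intc)
    show "AE t in lborel. summable (\<lambda>k. norm (?f k t))"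
    proof (rule AE_I2)
      fix t
      show "summable (\<lambda>k. norm (?f k t))"
        unfolding norm_mult[of _ "_ *\<^sub>R _"] normc by (rule summable_mult2[OF summ])
    qed
    have "(\<integral>t. norm (?f k t) \<partial>lborel) = norm (a k * of_real (r ^ (k + n))) * (2 * pi)" for k
    proof -
      have "(\<integral>t. norm (?f k t) \<partial>lborel) = (\<integral>t. norm (a k * of_real (r ^ (k + n))) * indicator {0..2 * pi} t \<partial>lborel)"
        by (simp only: norm_mult[of _ "_ *\<^sub>R _"] normc)
      then show ?thesis by simp
    qed
    then show "summable (\<lambda>k. \<integral>t. norm (?f k t) \<partial>lborel)"
      using summable_mult2[OF summ, of "2 * pi"] by simp
  qed
  moreover have "(\<integral>t. ?f k t \<partial>lborel) = (if k = n then a k * of_real (r ^ (k + k)) * of_real (2 * pi) else 0)" for k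
    by (subst integral_mult_right_zero) (simp only: integral_cis_multiple, simp)
  moreover have "(\<Sum>k. ?f k t) = indicator {0..2 * pi} t *\<^sub>R (cnj (of_real r * cis t) ^ n * g (of_real r * cis t))" for t
    unfolding term_eq by (rule sums_unique[symmetric]) (intro sums_scaleR_right sums_mult ps rt)
  ultimately have "(\<lambda>k. if k = n then a k * of_real (r ^ (k + k)) * of_real (2 * pi) else 0) sums
     (\<integral>t. indicator {0..2 * pi} t *\<^sub>R (cnj (of_real r * cis t) ^ n * g (of_real r * cis t)) \<partial>lborel)" by simp
  from sums_unique2[OF this sums_single] show ?thesis
    unfolding a_def of_real_mult mult_2[of n] by (simp only: mult_ac)
qed

text \<open>Each circle contributes 2 pi r^(2n) times the Taylor coefficient, and 2 r^(2n+1)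
  integrates to 1/(n + 1) over [0, 1].\<close>

lemma holomorphic_moment:
  assumes g: "g holomorphic_on disc" and int: "integrable dA g"
  shows "(\<integral>w. cnj w ^ n * g w \<partial>dA) = (deriv ^^ n) g 0 / fact n / of_nat (Suc n)"
proof -
  have [measurable]: "disc \<in> sets borel" by simp
  let ?a = "(deriv ^^ n) g 0 / fact n"
  \<comment> \<open>g is arbitrary outside the disc; the cut-off makes it Borel on the whole plane,
    as the polar formula requires.\<close>
  let ?h = "\<lambda>w. cnj w ^ n * (indicator disc w *\<^sub>R g w)"
  have gm [measurable]: "(\<lambda>w. indicator disc w *\<^sub>R g w) \<in> borel_measurable borel"
    using holomorphic_on_imp_continuous_on[OF g] by (intro borel_measurable_continuous_on_indicator) auto
  have [measurable]: "(\<lambda>w. cnj w ^ n) \<in> borel_measurable borel"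
    by (intro borel_measurable_continuous_onI continuous_intros)
  have hg: "?h w = cnj w ^ n * g w" if "w \<in> disc" for w using that by simp
  have "integrable dA (\<lambda>w. cnj w ^ n * g w)"
    by (rule integrable_dA_mult_bounded[OF int, of _ 1])
      (auto intro!: continuous_measurable_dA continuous_intros simp: norm_power power_le_one)
  moreover have "integrable dA ?h \<longleftrightarrow> integrable dA (\<lambda>w. cnj w ^ n * g w)"
    by (rule Bochner_Integration.integrable_cong) (use hg in auto)
  ultimately have "integrable dA ?h" by simp
  have "(\<integral>w. cnj w ^ n * g w \<partial>dA) = (\<integral>w. ?h w \<partial>dA)"
    by (intro Bochner_Integration.integral_cong) (use hg in auto)
  also have "\<dots> = (\<integral>x. (\<integral>t. (if 0 < x \<and> x < 1 \<and> 0 \<le> t \<and> t \<le> 2 * pi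
     then ((1 - x) / pi) *\<^sub>R ?h (of_real (1 - x) * cis t) else 0) \<partial>lborel) \<partial>lborel)"
    by (rule integral_dA_polar[OF _ \<open>integrable dA ?h\<close>]) measurable
  also have "\<dots> = (\<integral>x. (indicator {0..1} x * (2 * (1 - x) ^ (2 * n + 1))) *\<^sub>R ?a \<partial>lborel)"
  proof (rule integral_cong_AE)
    have ne: "AE x in lborel. x \<noteq> 0 \<and> x \<noteq> (1::real)" by (intro AE_conjI AE_lborel_singleton)
    then show "AE x in lborel. (\<integral>t. (if 0 < x \<and> x < 1 \<and> 0 \<le> t \<and> t \<le> 2 * pi
       then ((1 - x) / pi) *\<^sub>R ?h (of_real (1 - x) * cis t) else 0) \<partial>lborel) =
       (indicator {0..1} x * (2 * (1 - x) ^ (2 * n + 1))) *\<^sub>R ?a"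
    proof eventually_elim
      case (elim x)
      show ?case
      proof (cases "0 < x \<and> x < 1")
        case True
        have "cmod (of_real (1 - x) * cis t) = \<bar>1 - x\<bar>" for t
          by (simp only: norm_mult norm_cis norm_of_real mult_1_right)
        then have d: "of_real (1 - x) * cis t \<in> disc" for t using True by simp
        have "(\<integral>t. (if 0 < x \<and> x < 1 \<and> 0 \<le> t \<and> t \<le> 2 * pi
            then ((1 - x) / pi) *\<^sub>R ?h (of_real (1 - x) * cis t) else 0) \<partial>lborel) =
          (\<integral>t. ((1 - x) / pi) *\<^sub>R (indicator {0..2 * pi} t *\<^sub>R (cnj (of_real (1 - x) * cis t) ^ n * g (of_real (1 - x) * cis t))) \<partial>lborel)"
          using True hg[OF d] by (intro Bochner_Integration.integral_cong) (auto simp: indicator_def)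
        also have "\<dots> = ((1 - x) / pi) *\<^sub>R (of_real (2 * pi * (1 - x) ^ (2 * n)) * ?a)"
          using True by (subst integral_scaleR_right, subst circle_coefficient[OF g]) auto
        also have "\<dots> = ((1 - x) / pi * (2 * pi * (1 - x) ^ (2 * n))) *\<^sub>R ?a"
          by (simp only: scaleR_conv_of_real of_real_mult mult.assoc)
        also have "(1 - x) / pi * (2 * pi * (1 - x) ^ (2 * n)) = indicator {0..1} x * (2 * (1 - x) ^ (2 * n + 1))"
          using True by simp
        finally show ?thesis .
      next
        case False
        then have "x \<notin> {0..1}" using elim by auto
        moreover have "(if 0 < x \<and> x < 1 \<and> b then c else (0 :: complex)) = 0" for b c using False by auto
        ultimately show ?thesis by simp
      qed
    qed
  qed measurable
  also have "\<dots> = (\<integral>x. indicator {0..1} x * (2 * (1 - x) ^ (2 * n + 1)) \<partial>lborel) *\<^sub>R ?a"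
  proof (rule integral_scaleR_left)
    have "integrable lborel (\<lambda>x::real. indicator {0..1} x *\<^sub>R (2 * (1 - x) ^ (2 * n + 1)))"
      by (rule borel_integrable_compact) (auto intro!: continuous_intros)
    then show "integrable lborel (\<lambda>x::real. indicator {0..1} x * (2 * (1 - x) ^ (2 * n + 1)))"
      by (simp only: real_scaleR_def)
  qed
  also have "(\<integral>x. indicator {0..1} x * (2 * (1 - x) ^ (2 * n + 1)) \<partial>lborel) = 1 / real (Suc n)"
  proof -
    \<comment> \<open>The exponent is 2(n + 1), so division by n + 1 leaves the factor 2 of the
      integrand.\<close>
    let ?F = "\<lambda>x. - ((1 - x) ^ Suc (2 * n + 1)) / real (Suc n)"
    have "(\<integral>x. indicator {0..1} x *\<^sub>R (2 * (1 - x) ^ (2 * n + 1)) \<partial>lborel) = ?F 1 - ?F (0::real)"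
    proof (rule integral_FTC_Icc)
      fix x :: real
      have "((\<lambda>x. (1 - x) ^ Suc (2 * n + 1)) has_real_derivative
          (1 + of_nat (2 * n + 1)) * (-1 * (1 - x) ^ (2 * n + 1))) (at x within {0..1})"
        by (rule DERIV_power_Suc) (auto intro!: derivative_eq_intros)
      note DERIV_cdivide[OF DERIV_minus[OF this], of "real (Suc n)"]
      moreover have "- ((1 + real (2 * n + 1)) * (-1 * c)) / real (Suc n) = 2 * c" for c
        by (simp add: field_simps)
      ultimately have "(?F has_real_derivative 2 * (1 - x) ^ (2 * n + 1)) (at x within {0..1})"
        by (simp only:)
      then show "(?F has_vector_derivative 2 * (1 - x) ^ (2 * n + 1)) (at x within {0..1})"
        by (simp only: has_real_derivative_iff_has_vector_derivative)
    qed (auto intro!: continuous_intros)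
    then show ?thesis by simp
  qed
  finally show ?thesis by (simp add: scaleR_conv_of_real)
qed

text \<open>The factor n + 1 of the kernel expansion cancels the 1/(n + 1) of the moments, so both
  sides have the same Taylor series.\<close>

lemma bergman_reproducing:
  assumes g: "g holomorphic_on disc" and int: "integrable dA g" and z: "z \<in> disc"
  shows "bergman g z = g z"
proof -
  have "(\<lambda>n. (deriv ^^ n) g 0 / fact n * z ^ n) sums bergman g z"
    using bergman_power_series[OF int z] by (simp add: holomorphic_moment[OF g int] del: of_nat_Suc)
  moreover have "(\<lambda>n. (deriv ^^ n) g 0 / fact n * z ^ n) sums g z"
    using holomorphic_power_series[OF g z] by simp
  ultimately show ?thesis by (rule sums_unique2)
qed

lemma RM_subset_LqLp: "RM p q \<subseteq> LqLp p q"
  by (auto simp: RM_def LqLp_def intro!: continuous_imp_measurable_on_sets_lebesgue holomorphic_on_imp_continuous_on)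

text \<open>\<open>bergman\<close> is total, with value 0 where the integral fails to exist, so the
  first conjunct records that P is well defined. Functions are arbitrary off the disc, so linearity
  and surjectivity are equalities on the disc.\<close>

theorem theorem4p3:
  fixes p q :: real
  assumes "1 < p" and "1 < q"
  shows
    "(\<forall>f \<in> LqLp p q. \<forall>z \<in> disc. integrable dA (bergman_kernel_integrand f z)) \<and>
     (\<forall>f \<in> LqLp p q. \<forall>g \<in> LqLp p q. \<forall>a b. \<forall>z \<in> disc.
        bergman (\<lambda>w. a * f w + b * g w) z = a * bergman f z + b * bergman g z) \<and>
     (\<forall>f \<in> LqLp p q. bergman f \<in> RM p q) \<and>
     (\<exists>C::real. \<forall>f \<in> LqLp p q. rho p q (bergman f) \<le> ennreal C * rho p q f) \<and>
     (\<forall>g \<in> RM p q. \<exists>f \<in> LqLp p q. \<forall>z \<in> disc. bergman f z = g z)"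
proof -
  note L1 = LqLp_integrable_dA[OF assms]
  obtain C where C: "\<And>f. f \<in> borel_measurable (lebesgue_on disc) \<Longrightarrow> bergman f holomorphic_on disc \<Longrightarrow>
      rho p q (bergman f) \<le> ennreal C * rho p q f"
    by (rule rho_bergman_le[OF assms]) (rule that)
  have bound: "rho p q (bergman f) \<le> ennreal C * rho p q f" if "f \<in> LqLp p q" for f
    using that by (intro C bergman_holomorphic L1) (auto simp: LqLp_def)
  have RM: "bergman f \<in> RM p q" if f: "f \<in> LqLp p q" for f
  proof -
    have "ennreal C * rho p q f < \<infinity>" using f by (auto simp: LqLp_def ennreal_mult_less_top)
    with bound[OF f] have "rho p q (bergman f) < \<infinity>" by (rule order_le_less_trans)
    then show ?thesis by (simp add: RM_def bergman_holomorphic[OF L1[OF f]])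
  qed
  have linear: "bergman (\<lambda>w. a * f w + b * g w) z = a * bergman f z + b * bergman g z"
    if f: "f \<in> LqLp p q" and g: "g \<in> LqLp p q" and z: "z \<in> disc" for f g a b z
  proof -
    have "bergman_kernel_integrand (\<lambda>w. a * f w + b * g w) z =
      (\<lambda>w. a * bergman_kernel_integrand f z w + b * bergman_kernel_integrand g z w)"
      by (simp add: bergman_kernel_integrand_def fun_eq_iff add_divide_distrib)
    then show ?thesis
      using integrable_bergman_kernel_integrand[OF L1[OF f] z] integrable_bergman_kernel_integrand[OF L1[OF g] z]
      by (simp add: bergman_def)
  qed
  \<comment> \<open>g is its own preimage, because \<open>RM\<close> is contained in
    \<open>LqLp\<close> and P fixes its elements.\<close>
  have onto: "\<exists>f \<in> LqLp p q. \<forall>z \<in> disc. bergman f z = g z" if g: "g \<in> RM p q" for g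
  proof (intro bexI ballI)
    show "g \<in> LqLp p q" using g RM_subset_LqLp by blast
    then show "bergman g z = g z" if "z \<in> disc" for z
      using g that L1 by (intro bergman_reproducing) (auto simp: RM_def)
  qed
  show ?thesis
  proof (intro conjI ballI allI exI)
    show "integrable dA (bergman_kernel_integrand f z)" if "f \<in> LqLp p q" "z \<in> disc" for f z
      by (rule integrable_bergman_kernel_integrand[OF L1[OF that(1)] that(2)])
  qed (fact linear RM bound onto)+
qed

end
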